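(* Let $\mathcal{I}$ be a collection of Bruhat intervals in Coxeter groups. Let $[u_1,v_1],[u_2,v_2]\in\mathcal{I}$ with $u_1,v_1\in W_1^{J_1}$ and $u_2,v_2\in W_2^{J_2}$, where $W_1,W_2$ are Coxeter groups with sets of simple generators $S_1,S_2$ and $J_1\subseteq S_1$, $J_2\subseteq S_2$. Let $\varphi:[u_1,v_1]\to[u_2,v_2]$ be a poset isomorphism restricting to a bijection $A^{J_1}_{u_1,v_1}\to A^{J_2}_{u_2,v_2}$. (a) If $\mathcal{I}$ is upper $R$-invariant, then $R^{J_1,x}_{u_1,v_1}=R^{J_2,x}_{u_2,v_2}$ for $x\in\{-1,q\}$. (b) If $\mathcal{I}$ is upper $P$-invariant, then $P^{J_1,q}_{u_1,v_1}=P^{J_2,q}_{u_2,v_2}$. If moreover $\varphi$ restricts to an isomorphism $[u_1,v_1]^{J_1}\to[u_2,v_2]^{J_2}$, then: (c) If $\mathcal{I}$ is fully invariant, we have $P^{J_1,x}_{u_1,v_1}=P^{J_2,x}_{u_2,v_2}$ and $R^{J_1,x}_{u_1,v_1}=R^{J_2,x}_{u_2,v_2}$ for $x\in\{-1,q\}$.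
   Context: Let $W$ be a Coxeter group with set of simple generators $S$, length function $\ell$ and identity $e$; let $J\subseteq S$. $W_J$ is the parabolic subgroup generated by $J$ and $W^J$ is the set of minimum-length representatives of the left cosets $wW_J$. $\leq$ denotes the (strong) Bruhat order on $W$, $\lessdot$ its cover relation, and $[u,v]=\{y\in W\mid u\leq y\leq v\}$, viewed as a poset under Bruhat order. For $u,v\in W^J$ put $[u,v]^J=[u,v]\cap W^J$ (with the induced order) and $A^J_{u,v}=\{a\in W^J\mid u\lessdot a\leq v\}$. Parabolic $R$-polynomials: for $x\in\{-1,q\}$, the family of polynomials $\{R^{J,x}_{u,v}\}_{u,v\in W^J}\subset\mathbb{Z}[q]$ is uniquely determined by: (i) $R^{J,x}_{u,v}=0$ if $u\not\leq v$; (ii) $R^{J,x}_{u,u}=1$; (iii) for all $s\in S$ with $\ell(sv)<\ell(v)$, $R^{J,x}_{u,v}$ equals $R^{J,x}_{su,sv}$ if $\ell(su)<\ell(u)$; equals $(q-1)R^{J,x}_{u,sv}+qR^{J,x}_{su,sv}$ if $\ell(su)>\ell(u)$ and $su\in W^J$; and equals $(q-1-x)R^{J,x}_{u,sv}$ if $\ell(su)>\ell(u)$ but $su\notin W^J$. Parabolic Kazhdan--Lusztig polynomials: for $x\in\{-1,q\}$, the family of polynomials $\{P^{J,x}_{u,v}\}_{u,v\in W^J}\subset\mathbb{Z}[q]$ is uniquely determined by: (i) $P^{J,x}_{u,v}=0$ if $u\not\leq v$; (ii) $P^{J,x}_{u,u}=1$; (iii) $\deg P^{J,x}_{u,v}\leq\frac12(\ell(v)-\ell(u)-1)$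 if $u<v$; (iv) $q^{\ell(v)-\ell(u)}P^{J,x}_{u,v}(q^{-1})=\sum_{\sigma\in[u,v]^J}R^{J,x}_{u,\sigma}P^{J,x}_{\sigma,v}$. The ordinary polynomials $R_{u,v}$ and $P_{u,v}$ ($u,v\in W$) are the case $J=\emptyset$, which is independent of $x$. Let $\mathcal{I}$ be a collection of Bruhat intervals in (possibly different) Coxeter groups. $\mathcal{I}$ is upper $R$-invariant (resp. upper $P$-invariant) if for all $[u_1,v_1],[u_2,v_2]\in\mathcal{I}$ and all poset isomorphisms $\varphi:[u_1,v_1]\to[u_2,v_2]$ we have $R_{y,v_1}=R_{\varphi(y),v_2}$ (resp. $P_{y,v_1}=P_{\varphi(y),v_2}$) for all $y\in[u_1,v_1]$. $\mathcal{I}$ is fully invariant if for all $[u_1,v_1],[u_2,v_2]\in\mathcal{I}$ and all poset isomorphisms $\varphi:[u_1,v_1]\to[u_2,v_2]$ we have $R_{y,y'}=R_{\varphi(y),\varphi(y')}$ for all $y,y'\in[u_1,v_1]$. *)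

theory Defs
  imports "HOL-Algebra.Coset" "HOL-Algebra.Generated_Groups"
    "HOL-Computational_Algebra.Polynomial"
begin

section \<open>Coxeter systems\<close>

text \<open>
  A Coxeter matrix on \<open>S\<close>; the entry \<open>0\<close> encodes \<open>m(s,t) = \<infinity>\<close>, i.e. no relation.
\<close>

definition coxeter_matrix :: "'a set \<Rightarrow> ('a \<Rightarrow> 'a \<Rightarrow> nat) \<Rightarrow> bool" where
  "coxeter_matrix S m \<longleftrightarrow>
     (\<forall>s\<in>S. m s s = 1) \<and>
     (\<forall>s\<in>S. \<forall>t\<in>S. s \<noteq> t \<longrightarrow> m s t = m t s \<and> m s t \<noteq> 1)"

definition word_prod :: "('a, 'b) monoid_scheme \<Rightarrow> 'a list \<Rightarrow> 'a" where
  "word_prod G ws = foldr (\<otimes>\<^bsub>G\<^esub>) ws \<one>\<^bsub>G\<^esub>"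

text \<open>
  Insertion of a defining relator \<open>(s t)\<^bsup>m(s,t)\<^esup>\<close> into a word. Since \<open>m(s,s) = 1\<close>, the generators
  are involutions modulo these relations, so the group presented by
  \<open>\<langle>S | (s t)\<^bsup>m(s,t)\<^esup> = e\<rangle>\<close> consists of the words over \<open>S\<close> (no formal inverses are needed) modulo
  the equivalence closure of this relation.
\<close>

definition insert_relator :: "'a set \<Rightarrow> ('a \<Rightarrow> 'a \<Rightarrow> nat) \<Rightarrow> 'a list \<Rightarrow> 'a list \<Rightarrow> bool" where
  "insert_relator S m ws ws' \<longleftrightarrow>
     (\<exists>xs ys. \<exists>s\<in>S. \<exists>t\<in>S. ws = xs @ ys \<and> ws' = xs @ concat (replicate (m s t) [s, t]) @ ys)"

text \<open>
  \<open>(G, S)\<close> is a Coxeter system: \<open>G\<close> is generated by \<open>S\<close> and is presented by the relators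
  \<open>(s t)\<^bsup>m(s,t)\<^esup>\<close> of some Coxeter matrix. \<open>S\<close> may be infinite.
\<close>

locale coxeter_system = group G for G (structure) +
  fixes S :: "'a set"
  assumes gens_closed: "S \<subseteq> carrier G"
    and gens_generate: "generate G S = carrier G"
    and presentation: "\<exists>m. coxeter_matrix S m \<and>
      (\<forall>ws\<in>lists S. \<forall>ws'\<in>lists S.
         word_prod G ws = word_prod G ws' \<longleftrightarrow> equivclp (insert_relator S m) ws ws')"

definition cox_length :: "('a, 'b) monoid_scheme \<Rightarrow> 'a set \<Rightarrow> 'a \<Rightarrow> nat" where
  "cox_length G S w = (LEAST n. \<exists>ws\<in>lists S. length ws = n \<and> word_prod G ws = w)"


section \<open>Bruhat order\<close>

definition reflections :: "('a, 'b) monoid_scheme \<Rightarrow> 'a set \<Rightarrow> 'a set" where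
  "reflections G S = {w \<otimes>\<^bsub>G\<^esub> s \<otimes>\<^bsub>G\<^esub> inv\<^bsub>G\<^esub> w | w s. w \<in> carrier G \<and> s \<in> S}"

definition bruhat_step :: "('a, 'b) monoid_scheme \<Rightarrow> 'a set \<Rightarrow> 'a \<Rightarrow> 'a \<Rightarrow> bool" where
  "bruhat_step G S u v \<longleftrightarrow> u \<in> carrier G \<and>
     (\<exists>t\<in>reflections G S. v = u \<otimes>\<^bsub>G\<^esub> t) \<and> cox_length G S u < cox_length G S v"

definition bruhat_le :: "('a, 'b) monoid_scheme \<Rightarrow> 'a set \<Rightarrow> 'a \<Rightarrow> 'a \<Rightarrow> bool" where
  "bruhat_le G S u v \<longleftrightarrow> u \<in> carrier G \<and> v \<in> carrier G \<and> (bruhat_step G S)\<^sup>*\<^sup>* u v"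

definition bruhat_less :: "('a, 'b) monoid_scheme \<Rightarrow> 'a set \<Rightarrow> 'a \<Rightarrow> 'a \<Rightarrow> bool" where
  "bruhat_less G S u v \<longleftrightarrow> bruhat_le G S u v \<and> u \<noteq> v"

definition bruhat_cover :: "('a, 'b) monoid_scheme \<Rightarrow> 'a set \<Rightarrow> 'a \<Rightarrow> 'a \<Rightarrow> bool" where
  "bruhat_cover G S u v \<longleftrightarrow> bruhat_less G S u v \<and>
     (\<nexists>z. bruhat_less G S u z \<and> bruhat_less G S z v)"

definition bruhat_interval :: "('a, 'b) monoid_scheme \<Rightarrow> 'a set \<Rightarrow> 'a \<Rightarrow> 'a \<Rightarrow> 'a set" where
  "bruhat_interval G S u v = {y \<in> carrier G. bruhat_le G S u y \<and> bruhat_le G S y v}"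


section \<open>Parabolic quotients\<close>

text \<open>Minimum-length representatives of the left cosets \<open>w W\<^sub>J\<close>, where \<open>W\<^sub>J = generate G J\<close>.\<close>

definition min_reps :: "('a, 'b) monoid_scheme \<Rightarrow> 'a set \<Rightarrow> 'a set \<Rightarrow> 'a set" where
  "min_reps G S J =
     {w \<in> carrier G. \<forall>y \<in> w <#\<^bsub>G\<^esub> generate G J. cox_length G S w \<le> cox_length G S y}"

definition par_interval ::
    "('a, 'b) monoid_scheme \<Rightarrow> 'a set \<Rightarrow> 'a set \<Rightarrow> 'a \<Rightarrow> 'a \<Rightarrow> 'a set" where
  "par_interval G S J u v = bruhat_interval G S u v \<inter> min_reps G S J"

definition par_atoms ::
    "('a, 'b) monoid_scheme \<Rightarrow> 'a set \<Rightarrow> 'a set \<Rightarrow> 'a \<Rightarrow> 'a \<Rightarrow> 'a set" where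
  "par_atoms G S J u v = {a \<in> min_reps G S J. bruhat_cover G S u a \<and> bruhat_le G S a v}"


section \<open>Parabolic \<open>R\<close>-polynomials and Kazhdan--Lusztig polynomials\<close>

abbreviation q_var :: "int poly" where
  "q_var \<equiv> [:0, 1:]"

text \<open>
  The families below are indexed by \<open>W\<^sup>J \<times> W\<^sup>J\<close>; as total functions they are required to vanish
  elsewhere, so that the family characterised by the remaining conditions is a unique function.
\<close>

definition is_R_family ::
    "('a, 'b) monoid_scheme \<Rightarrow> 'a set \<Rightarrow> 'a set \<Rightarrow> int poly \<Rightarrow> ('a \<Rightarrow> 'a \<Rightarrow> int poly) \<Rightarrow> bool" where
  "is_R_family G S J x R \<longleftrightarrow>
     (\<forall>u v. u \<notin> min_reps G S J \<or> v \<notin> min_reps G S J \<longrightarrow> R u v = 0) \<and>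
     (\<forall>u \<in> min_reps G S J. \<forall>v \<in> min_reps G S J.
        (\<not> bruhat_le G S u v \<longrightarrow> R u v = 0) \<and>
        (u = v \<longrightarrow> R u v = 1) \<and>
        (\<forall>s\<in>S. cox_length G S (s \<otimes>\<^bsub>G\<^esub> v) < cox_length G S v \<longrightarrow>
           (cox_length G S (s \<otimes>\<^bsub>G\<^esub> u) < cox_length G S u \<longrightarrow>
              R u v = R (s \<otimes>\<^bsub>G\<^esub> u) (s \<otimes>\<^bsub>G\<^esub> v)) \<and>
           (cox_length G S (s \<otimes>\<^bsub>G\<^esub> u) > cox_length G S u \<and> s \<otimes>\<^bsub>G\<^esub> u \<in> min_reps G S J \<longrightarrow>
              R u v = (q_var - 1) * R u (s \<otimes>\<^bsub>G\<^esub> v) + q_var * R (s \<otimes>\<^bsub>G\<^esub> u) (s \<otimes>\<^bsub>G\<^esub> v)) \<and>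
           (cox_length G S (s \<otimes>\<^bsub>G\<^esub> u) > cox_length G S u \<and> s \<otimes>\<^bsub>G\<^esub> u \<notin> min_reps G S J \<longrightarrow>
              R u v = (q_var - 1 - x) * R u (s \<otimes>\<^bsub>G\<^esub> v))))"

definition par_R ::
    "('a, 'b) monoid_scheme \<Rightarrow> 'a set \<Rightarrow> 'a set \<Rightarrow> int poly \<Rightarrow> 'a \<Rightarrow> 'a \<Rightarrow> int poly" where
  "par_R G S J x = (THE R. is_R_family G S J x R)"

text \<open>
  \<open>q\<^sup>n p(q\<^sup>-\<^sup>1)\<close>, for \<open>degree p \<le> n\<close> (\<open>reflect_poly p\<close> being \<open>q\<^bsup>degree p\<^esup> p(q\<^sup>-\<^sup>1)\<close>). The degree condition
  in \<open>is_P_family\<close> ensures that the subtraction is never truncated where this is used.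
\<close>

definition q_reverse :: "nat \<Rightarrow> int poly \<Rightarrow> int poly" where
  "q_reverse n p = q_var ^ (n - degree p) * reflect_poly p"

definition is_P_family ::
    "('a, 'b) monoid_scheme \<Rightarrow> 'a set \<Rightarrow> 'a set \<Rightarrow> int poly \<Rightarrow> ('a \<Rightarrow> 'a \<Rightarrow> int poly) \<Rightarrow> bool" where
  "is_P_family G S J x P \<longleftrightarrow>
     (\<forall>u v. u \<notin> min_reps G S J \<or> v \<notin> min_reps G S J \<longrightarrow> P u v = 0) \<and>
     (\<forall>u \<in> min_reps G S J. \<forall>v \<in> min_reps G S J.
        (\<not> bruhat_le G S u v \<longrightarrow> P u v = 0) \<and>
        (u = v \<longrightarrow> P u v = 1) \<and>
        (bruhat_less G S u v \<longrightarrow>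
           2 * int (degree (P u v)) \<le> int (cox_length G S v) - int (cox_length G S u) - 1) \<and>
        (bruhat_le G S u v \<longrightarrow>
           q_reverse (cox_length G S v - cox_length G S u) (P u v) =
             (\<Sum>\<sigma>\<in>par_interval G S J u v. par_R G S J x u \<sigma> * P \<sigma> v)))"

definition par_P ::
    "('a, 'b) monoid_scheme \<Rightarrow> 'a set \<Rightarrow> 'a set \<Rightarrow> int poly \<Rightarrow> 'a \<Rightarrow> 'a \<Rightarrow> int poly" where
  "par_P G S J x = (THE P. is_P_family G S J x P)"

text \<open>
  The ordinary polynomials are the case \<open>J = \<emptyset>\<close>, where every element is a minimal representative
  and \<open>x\<close> does not enter the recursion; the choice \<open>x = -1\<close> is immaterial.
\<close>

definition KL_R :: "('a, 'b) monoid_scheme \<Rightarrow> 'a set \<Rightarrow> 'a \<Rightarrow> 'a \<Rightarrow> int poly" where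
  "KL_R G S = par_R G S {} (-1)"

definition KL_P :: "('a, 'b) monoid_scheme \<Rightarrow> 'a set \<Rightarrow> 'a \<Rightarrow> 'a \<Rightarrow> int poly" where
  "KL_P G S = par_P G S {} (-1)"


section \<open>Collections of Bruhat intervals and combinatorial invariance\<close>

definition poset_iso ::
    "('a \<Rightarrow> 'a \<Rightarrow> bool) \<Rightarrow> 'a set \<Rightarrow> ('b \<Rightarrow> 'b \<Rightarrow> bool) \<Rightarrow> 'b set \<Rightarrow> ('a \<Rightarrow> 'b) \<Rightarrow> bool" where
  "poset_iso leA A leB B \<phi> \<longleftrightarrow>
     bij_betw \<phi> A B \<and> (\<forall>x\<in>A. \<forall>y\<in>A. leA x y \<longleftrightarrow> leB (\<phi> x) (\<phi> y))"

text \<open>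
  A Bruhat interval together with its ambient Coxeter system: \<open>(G, S, u, v)\<close> stands for the
  interval \<open>[u,v]\<close> in the Coxeter system \<open>(G, S)\<close>. The groups occurring in one collection may
  differ, but share the type of elements.
\<close>

type_synonym 'a cox_interval = "'a monoid \<times> 'a set \<times> 'a \<times> 'a"

definition bruhat_intervals :: "'a cox_interval set \<Rightarrow> bool" where
  "bruhat_intervals I \<longleftrightarrow>
     (\<forall>(G, S, u, v) \<in> I. coxeter_system G S \<and> u \<in> carrier G \<and> v \<in> carrier G)"

definition upper_R_invariant :: "'a cox_interval set \<Rightarrow> bool" where
  "upper_R_invariant I \<longleftrightarrow>
     (\<forall>(G1, S1, u1, v1) \<in> I. \<forall>(G2, S2, u2, v2) \<in> I. \<forall>\<phi>.
        poset_iso (bruhat_le G1 S1) (bruhat_interval G1 S1 u1 v1)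
                  (bruhat_le G2 S2) (bruhat_interval G2 S2 u2 v2) \<phi> \<longrightarrow>
        (\<forall>y \<in> bruhat_interval G1 S1 u1 v1. KL_R G1 S1 y v1 = KL_R G2 S2 (\<phi> y) v2))"

definition upper_P_invariant :: "'a cox_interval set \<Rightarrow> bool" where
  "upper_P_invariant I \<longleftrightarrow>
     (\<forall>(G1, S1, u1, v1) \<in> I. \<forall>(G2, S2, u2, v2) \<in> I. \<forall>\<phi>.
        poset_iso (bruhat_le G1 S1) (bruhat_interval G1 S1 u1 v1)
                  (bruhat_le G2 S2) (bruhat_interval G2 S2 u2 v2) \<phi> \<longrightarrow>
        (\<forall>y \<in> bruhat_interval G1 S1 u1 v1. KL_P G1 S1 y v1 = KL_P G2 S2 (\<phi> y) v2))"

definition fully_invariant :: "'a cox_interval set \<Rightarrow> bool" where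
  "fully_invariant I \<longleftrightarrow>
     (\<forall>(G1, S1, u1, v1) \<in> I. \<forall>(G2, S2, u2, v2) \<in> I. \<forall>\<phi>.
        poset_iso (bruhat_le G1 S1) (bruhat_interval G1 S1 u1 v1)
                  (bruhat_le G2 S2) (bruhat_interval G2 S2 u2 v2) \<phi> \<longrightarrow>
        (\<forall>y \<in> bruhat_interval G1 S1 u1 v1. \<forall>y' \<in> bruhat_interval G1 S1 u1 v1.
           KL_R G1 S1 y y' = KL_R G2 S2 (\<phi> y) (\<phi> y')))"

end

theory Submission
  imports Defs
begin

text \<open>
  Fix \<open>u, v \<in> W\<^sup>J\<close>. Two formulas of Deodhar express parabolic polynomials by ordinary ones along
  the coset \<open>u W\<^sub>J\<close>: the polynomial \<open>R\<^sup>J\<^sup>,\<^sup>x\<close> of \<open>(u, v)\<close> is the sum of \<open>(-x)\<^bsup>\<ell>(z)\<^esup> R(u z, v)\<close>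
  over \<open>z \<in> W\<^sub>J\<close> (lemma \<open>par_R_interval_sum\<close>), and \<open>P\<^sup>J\<^sup>,\<^sup>q\<close> is the sum of
  \<open>(-1)\<^bsup>\<ell>(z)\<^esup> P(u z, v)\<close> (lemma \<open>par_P_q_interval_sum\<close>). Only the \<open>u z\<close> below \<open>v\<close> contribute,
  and these can be recognised from the order alone: an element \<open>y\<close> of \<open>[u,v]\<close> lies in \<open>u W\<^sub>J\<close>
  exactly if no element of \<open>A\<^sup>J\<close> lies below \<open>y\<close> (lemma \<open>coset_in_interval_iff\<close>). Moreover
  \<open>\<ell>(z) = \<ell>(y) - \<ell>(u)\<close> is the rank of \<open>y\<close> in \<open>[u,v]\<close>. Hence an isomorphism of intervals that
  respects the sets \<open>A\<^sup>J\<close> and the polynomials \<open>R(y, v)\<close>, respectively \<open>P(y, v)\<close>, carries one sum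
  to the other. This gives (a) and (b). If the isomorphism also respects \<open>[u,v]\<^sup>J\<close>, then the same
  argument applies to each subinterval with end points in \<open>[u,v]\<^sup>J\<close>. So all \<open>R\<^sup>J\<^sup>,\<^sup>x\<close> on \<open>[u,v]\<^sup>J\<close>
  agree, and they determine the polynomials \<open>P\<^sup>J\<^sup>,\<^sup>x\<close>, which is (c).

  The polynomials are given as the unique solutions of recursions, so all of this depends on
  proving that solutions exist.

  For the ordinary R-polynomials one needs that the recursion does not depend on the chosen
  descents. It applies an operator on functions \<open>W \<Rightarrow> \<int>[q]\<close> for each letter of a reduced word. For
  the inverse operators independence of the word is evident at the identity, and since they commute
  with operators built from right multiplication, it spreads to all of \<open>W\<close> (lemmas
  \<open>foldr_K_left_independent\<close> and \<open>foldr_R_left_independent\<close>).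

  The parabolic polynomials are then defined by Deodhar's sum. How a simple reflection \<open>s\<close> moves
  the coset \<open>u W\<^sub>J\<close>, down, up, or onto itself, produces the three clauses of their recursion. In
  the third case the elements of the coset are paired by \<open>s\<close>, and the weights \<open>(-x)\<^bsup>\<ell>(z)\<^esup>\<close> form an
  eigenvector because \<open>x\<close> is a root of \<open>x\<^sup>2 = (q - 1) x + q\<close>.

  For the Kazhdan--Lusztig polynomials the argument is Stanley's: it suffices that the matrix \<open>R\<close>
  is inverted by its own reversal. For \<open>W\<close> this is lemma \<open>Rpoly_kernel\<close>; summation over cosets carries
  it over to \<open>W\<^sup>J\<close> (lemma \<open>Rpar_kernel\<close>).

  The facts about Coxeter groups that are used (exchange condition, lifting property, coset
  representatives, chain property) are derived from one source, the cocycle identity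
  \<open>inversions_mult\<close> for the inversion sets.
\<close>

section \<open>Words and inversions\<close>

context coxeter_system
begin

abbreviation len :: "'a \<Rightarrow> nat" where "len \<equiv> cox_length G S"
abbreviation le :: "'a \<Rightarrow> 'a \<Rightarrow> bool" where "le \<equiv> bruhat_le G S"
abbreviation ldesc :: "'a \<Rightarrow> 'a \<Rightarrow> bool" where "ldesc s w \<equiv> len (s \<otimes> w) < len w"
abbreviation wprod :: "'a list \<Rightarrow> 'a" where "wprod \<equiv> word_prod G"

declare in_lists_conv_set [simp] ball_Un [simp]

lemma gen_closed [simp]: "s \<in> S \<Longrightarrow> s \<in> carrier G"
  using gens_closed by blast

lemma inv_cancel_left [simp]:
  "x \<in> carrier G \<Longrightarrow> y \<in> carrier G \<Longrightarrow> inv x \<otimes> (x \<otimes> y) = y"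
  "x \<in> carrier G \<Longrightarrow> y \<in> carrier G \<Longrightarrow> x \<otimes> (inv x \<otimes> y) = y"
  by (simp_all flip: m_assoc)

lemma word_prod_Nil [simp]: "wprod [] = \<one>"
  by (simp add: word_prod_def)

lemma word_prod_Cons [simp]: "wprod (s # ws) = s \<otimes> wprod ws"
  by (simp add: word_prod_def)

lemma word_prod_closed [simp]: "ws \<in> lists S \<Longrightarrow> wprod ws \<in> carrier G"
  by (induction ws) auto

lemma word_prod_append [simp]:
  "xs \<in> lists S \<Longrightarrow> ys \<in> lists S \<Longrightarrow> wprod (xs @ ys) = wprod xs \<otimes> wprod ys"
  by (induction xs) (auto simp: m_assoc)

lemma relator_lists: "s \<in> S \<Longrightarrow> t \<in> S \<Longrightarrow> concat (replicate n [s, t]) \<in> lists S"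
  by (induction n) auto

lemma word_prod_relator:
  "s \<in> S \<Longrightarrow> t \<in> S \<Longrightarrow> wprod (concat (replicate n [s, t])) = (s \<otimes> t) [^] n"
proof (induction n)
  case (Suc n)
  thus ?case
    using nat_pow_Suc2[of "s \<otimes> t" n] by (simp add: relator_lists m_assoc del: nat_pow_Suc)
qed simp

definition cox_mat :: "'a \<Rightarrow> 'a \<Rightarrow> nat" where
  "cox_mat = (SOME m. coxeter_matrix S m \<and>
      (\<forall>ws\<in>lists S. \<forall>ws'\<in>lists S.
         word_prod G ws = word_prod G ws' \<longleftrightarrow> equivclp (insert_relator S m) ws ws'))"

lemma cox_mat:
  "coxeter_matrix S cox_mat"
  "ws \<in> lists S \<Longrightarrow> ws' \<in> lists S \<Longrightarrow>
     word_prod G ws = word_prod G ws' \<longleftrightarrow> equivclp (insert_relator S cox_mat) ws ws'"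
  using someI_ex[OF presentation] unfolding cox_mat_def by blast+

lemma relator_eq_one:
  assumes "s \<in> S" "t \<in> S"
  shows "(s \<otimes> t) [^] cox_mat s t = \<one>"
proof -
  have "insert_relator S cox_mat [] (concat (replicate (cox_mat s t) [s, t]))"
    unfolding insert_relator_def using assms by fastforce
  hence "equivclp (insert_relator S cox_mat) [] (concat (replicate (cox_mat s t) [s, t]))"
    by blast
  hence "wprod [] = wprod (concat (replicate (cox_mat s t) [s, t]))"
    using cox_mat(2)[of "[]" "concat (replicate (cox_mat s t) [s, t])"] assms
    by (simp add: relator_lists)
  thus ?thesis using assms by (simp add: word_prod_relator)
qed

lemma gen_square [simp]: "s \<in> S \<Longrightarrow> s \<otimes> s = \<one>"
  using relator_eq_one[of s s] cox_mat(1) by (simp add: coxeter_matrix_def)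

lemma gen_inv [simp]: "s \<in> S \<Longrightarrow> inv s = s"
  by (intro inv_equality) auto

lemma gen_cancel_left [simp]: "s \<in> S \<Longrightarrow> y \<in> carrier G \<Longrightarrow> s \<otimes> (s \<otimes> y) = y"
  by (simp flip: m_assoc)

lemma gen_cancel_right [simp]: "s \<in> S \<Longrightarrow> y \<in> carrier G \<Longrightarrow> y \<otimes> s \<otimes> s = y"
  by (simp add: m_assoc)

lemma rev_lists [simp]: "rev ws \<in> lists S \<longleftrightarrow> ws \<in> lists S"
  by (simp add: in_lists_conv_set)

lemma word_prod_rev: "ws \<in> lists S \<Longrightarrow> wprod (rev ws) = inv (wprod ws)"
  by (induction ws) (simp_all add: inv_mult_group)

lemma word_exists:
  assumes "w \<in> carrier G"
  obtains ws where "ws \<in> lists S" "wprod ws = w"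
proof -
  have "w \<in> generate G S" using assms gens_generate by simp
  hence "\<exists>ws\<in>lists S. wprod ws = w"
  proof (induction rule: generate.induct)
    case one show ?case by (rule bexI[of _ "[]"]) auto
  next
    case (incl h) thus ?case by (intro bexI[of _ "[h]"]) auto
  next
    case (inv h) thus ?case by (intro bexI[of _ "[h]"]) auto
  next
    case (eng h1 h2)
    then obtain xs ys where "xs \<in> lists S" "wprod xs = h1" "ys \<in> lists S" "wprod ys = h2"
      by blast
    thus ?case by (intro bexI[of _ "xs @ ys"]) auto
  qed
  thus ?thesis using that by blast
qed

text \<open>
  Deleting the \<open>i\<close>-th letter of a word multiplies its product on the right by the \<open>i\<close>-th entry of
  this list. The parity with which a given element occurs in the list turns out to depend on the
  product of the word only, and this is how the presentation enters the theory.
\<close>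

primrec word_refls :: "'a list \<Rightarrow> 'a list" where
  "word_refls [] = []"
| "word_refls (s # ws) = (inv (wprod ws) \<otimes> s \<otimes> wprod ws) # word_refls ws"

lemma length_word_refls [simp]: "length (word_refls ws) = length ws"
  by (induction ws) auto

lemma word_refls_closed: "ws \<in> lists S \<Longrightarrow> set (word_refls ws) \<subseteq> carrier G"
  by (induction ws) auto

lemma word_refls_append:
  assumes "xs \<in> lists S" "ys \<in> lists S"
  shows "word_refls (xs @ ys) = map (\<lambda>r. inv (wprod ys) \<otimes> r \<otimes> wprod ys) (word_refls xs) @ word_refls ys"
  using assms(1) assms(2) by (induction xs) (auto simp: m_assoc inv_mult_group)

lemma count_list_map_inj:
  "inj_on f A \<Longrightarrow> set xs \<subseteq> A \<Longrightarrow> x \<in> A \<Longrightarrow> count_list (map f xs) (f x) = count_list xs x"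
  by (induction xs) (auto dest: inj_onD)

lemma count_word_refls_append:
  assumes "xs \<in> lists S" "ys \<in> lists S" "t \<in> carrier G"
  shows "count_list (word_refls (xs @ ys)) t =
    count_list (word_refls xs) (wprod ys \<otimes> t \<otimes> inv (wprod ys)) + count_list (word_refls ys) t"
proof -
  let ?f = "\<lambda>r. inv (wprod ys) \<otimes> r \<otimes> wprod ys"
  have "inj_on ?f (carrier G)"
    using assms by (auto simp: inj_on_def)
  hence "count_list (map ?f (word_refls xs)) (?f (wprod ys \<otimes> t \<otimes> inv (wprod ys))) =
      count_list (word_refls xs) (wprod ys \<otimes> t \<otimes> inv (wprod ys))"
    using assms word_refls_closed by (intro count_list_map_inj) auto
  moreover have "?f (wprod ys \<otimes> t \<otimes> inv (wprod ys)) = t"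
    using assms by (simp add: m_assoc)
  ultimately show ?thesis using assms by (simp add: word_refls_append)
qed

lemma swap_pow:
  assumes "s \<in> S" "t \<in> S"
  shows "inv ((s \<otimes> t) [^] (n::nat)) \<otimes> t = t \<otimes> (s \<otimes> t) [^] n"
proof (induction n)
  case (Suc n)
  have "inv ((s \<otimes> t) [^] Suc n) \<otimes> t = (t \<otimes> s) \<otimes> (inv ((s \<otimes> t) [^] n) \<otimes> t)"
    using assms by (simp add: inv_mult_group m_assoc)
  also have "\<dots> = t \<otimes> ((s \<otimes> t) \<otimes> (s \<otimes> t) [^] n)"
    using assms Suc by (simp add: m_assoc)
  also have "(s \<otimes> t) \<otimes> (s \<otimes> t) [^] n = (s \<otimes> t) [^] Suc n"
    using assms by (metis nat_pow_Suc2 gen_closed m_closed)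
  finally show ?case .
qed (use assms in auto)

text \<open>
  An alternating word in \<open>s, t\<close> yields the reflections \<open>t (s t)\<^sup>j\<close> of a dihedral group. They repeat
  with period \<open>m(s,t)\<close>, so that a relator contains each of them an even number of times.
\<close>

lemma word_refls_relator:
  assumes "s \<in> S" "t \<in> S"
  shows "word_refls (concat (replicate n [s, t])) = map (\<lambda>j. t \<otimes> (s \<otimes> t) [^] j) (rev [0..<2*n])"
proof (induction n)
  case (Suc n)
  define p where "p = (s \<otimes> t) [^] n"
  have p: "p \<in> carrier G" "wprod (concat (replicate n [s, t])) = p"
    using assms by (auto simp: p_def word_prod_relator)
  have pp: "p \<otimes> p = (s \<otimes> t) [^] (2 * n)"
    using assms by (simp add: p_def nat_pow_mult mult_2)
  have sw: "inv p \<otimes> t = t \<otimes> p" using swap_pow[OF assms, of n] by (simp add: p_def)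
  have 1: "inv p \<otimes> t \<otimes> p = t \<otimes> (s \<otimes> t) [^] (2 * n)"
    using assms p by (simp add: sw m_assoc pp)
  have "inv (t \<otimes> p) \<otimes> s \<otimes> (t \<otimes> p) = (inv p \<otimes> t) \<otimes> ((s \<otimes> t) \<otimes> p)"
    using assms p by (simp add: inv_mult_group m_assoc)
  also have "\<dots> = t \<otimes> (p \<otimes> ((s \<otimes> t) \<otimes> p))"
    using assms p by (simp add: sw m_assoc)
  also have "(s \<otimes> t) \<otimes> p = p \<otimes> (s \<otimes> t)"
    using assms unfolding p_def by (metis nat_pow_Suc2 nat_pow_Suc gen_closed m_closed)
  also have "p \<otimes> (p \<otimes> (s \<otimes> t)) = (s \<otimes> t) [^] Suc (2 * n)"
    using assms p pp by (simp flip: m_assoc)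
  finally have 2: "inv (t \<otimes> p) \<otimes> s \<otimes> (t \<otimes> p) = t \<otimes> (s \<otimes> t) [^] Suc (2 * n)" .
  show ?case using Suc p 1 2 by simp
qed auto

lemma even_count_word_refls_relator:
  assumes "s \<in> S" "t \<in> S"
  shows "even (count_list (word_refls (concat (replicate (cox_mat s t) [s, t]))) r)"
proof -
  define m where "m = cox_mat s t"
  define f where "f = (\<lambda>j. t \<otimes> (s \<otimes> t) [^] (j::nat))"
  have per: "f (j + m) = f j" for j
    using assms relator_eq_one[OF assms] by (simp add: f_def m_def flip: nat_pow_mult)
  have "[0..<2 * m] = [0..<m] @ map (\<lambda>j. j + m) [0..<m]"
    by (simp add: mult_2 map_add_upt upt_add_eq_append[of 0])
  hence "map f [0..<2 * m] = map f [0..<m] @ map f [0..<m]"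
    by (simp add: comp_def per)
  hence "even (count_list (map f [0..<2 * m]) r)"
    by simp
  thus ?thesis
    using word_refls_relator[OF assms] by (simp add: m_def f_def flip: rev_map)
qed

text \<open>
  The letters before an inserted relator are conjugated by a word whose product does not change,
  so only the even contribution of the relator itself is new.
\<close>

lemma even_count_word_refls_insert_relator:
  assumes "insert_relator S cox_mat ws ws'" "ws \<in> lists S" "r \<in> carrier G"
  shows "even (count_list (word_refls ws) r) \<longleftrightarrow> even (count_list (word_refls ws') r)"
proof -
  obtain xs ys s t where *: "s \<in> S" "t \<in> S" "ws = xs @ ys"
      "ws' = xs @ concat (replicate (cox_mat s t) [s, t]) @ ys"
    using assms(1) unfolding insert_relator_def by blast
  have xy: "xs \<in> lists S" "ys \<in> lists S" using * assms by auto
  define rel where "rel = concat (replicate (cox_mat s t) [s, t])"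
  have rel: "rel \<in> lists S" "wprod rel = \<one>"
    using * by (auto simp: rel_def relator_lists word_prod_relator relator_eq_one)
  have "even (count_list (word_refls rel) r')" for r'
    using * even_count_word_refls_relator by (simp add: rel_def)
  moreover have "count_list (word_refls ws') r =
      count_list (word_refls xs) (wprod ys \<otimes> r \<otimes> inv (wprod ys)) +
      (count_list (word_refls rel) (wprod ys \<otimes> r \<otimes> inv (wprod ys)) + count_list (word_refls ys) r)"
    using xy rel assms(3) count_word_refls_append[of xs "rel @ ys" r] count_word_refls_append[of rel ys r]
    unfolding *(4) rel_def[symmetric] by simp
  moreover have "count_list (word_refls ws) r =
      count_list (word_refls xs) (wprod ys \<otimes> r \<otimes> inv (wprod ys)) + count_list (word_refls ys) r"
    using xy assms(3) count_word_refls_append[of xs ys r] unfolding *(3) by simp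
  ultimately show ?thesis by simp
qed

lemma insert_relator_lists:
  assumes "insert_relator S m ws ws'"
  shows "ws \<in> lists S \<longleftrightarrow> ws' \<in> lists S"
proof -
  obtain xs ys s t where *: "s \<in> S" "t \<in> S" "ws = xs @ ys"
      "ws' = xs @ concat (replicate (m s t) [s, t]) @ ys"
    using assms unfolding insert_relator_def by blast
  show ?thesis
    using relator_lists[OF *(1,2), of "m s t"] unfolding *(3,4) append_in_lists_conv by blast
qed

lemma even_count_word_refls_cong:
  assumes "wprod ws = wprod ws'" "ws \<in> lists S" "ws' \<in> lists S" "r \<in> carrier G"
  shows "even (count_list (word_refls ws) r) \<longleftrightarrow> even (count_list (word_refls ws') r)"
proof -
  have "equivclp (insert_relator S cox_mat) ws ws'" using assms cox_mat(2) by blast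
  hence "ws' \<in> lists S \<and> (even (count_list (word_refls ws) r) \<longleftrightarrow> even (count_list (word_refls ws') r))"
  proof (induction rule: equivclp_induct)
    case base thus ?case using assms by simp
  next
    case (step y z)
    have z: "z \<in> lists S"
      using step insert_relator_lists by blast
    thus ?case using step even_count_word_refls_insert_relator assms by blast
  qed
  thus ?thesis by simp
qed

text \<open>
  These turn out to be the reflections \<open>t\<close> with \<open>\<ell>(w t) < \<ell>(w)\<close>; see \<open>inversion_iff\<close>. The
  description by parities makes the cocycle identity below immediate.
\<close>

definition inversions :: "'a \<Rightarrow> 'a set" where
  "inversions w = {t \<in> carrier G. \<exists>ws\<in>lists S. wprod ws = w \<and> odd (count_list (word_refls ws) t)}"

lemma inversions_word_prod:
  "ws \<in> lists S \<Longrightarrow> inversions (wprod ws) = {t \<in> carrier G. odd (count_list (word_refls ws) t)}"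
  unfolding inversions_def using even_count_word_refls_cong by blast

text \<open>
  The cocycle identity \<open>N(x y) = N(y) \<triangle> y\<^sup>-\<^sup>1 N(x) y\<close>, with \<open>\<triangle>\<close> the symmetric difference. Exchange,
  lifting and the theory of minimal coset representatives all follow from it.
\<close>

lemma inversions_mult:
  assumes "x \<in> carrier G" "y \<in> carrier G" "t \<in> carrier G"
  shows "t \<in> inversions (x \<otimes> y) \<longleftrightarrow> (t \<in> inversions y) \<noteq> (y \<otimes> t \<otimes> inv y \<in> inversions x)"
proof -
  obtain xs ys where *: "xs \<in> lists S" "wprod xs = x" "ys \<in> lists S" "wprod ys = y"
    using assms word_exists by metis
  have "inversions (x \<otimes> y) = inversions (wprod (xs @ ys))" using * by simp
  also have "\<dots> = {t \<in> carrier G. odd (count_list (word_refls (xs @ ys)) t)}"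
    using * by (intro inversions_word_prod) auto
  finally show ?thesis
    using * assms inversions_word_prod[of xs] inversions_word_prod[of ys]
    by (auto simp: count_word_refls_append)
qed

lemma inversions_one [simp]: "inversions \<one> = {}"
  using inversions_word_prod[of "[]"] by simp

lemma inversions_gen [simp]: "s \<in> S \<Longrightarrow> inversions s = {s}"
proof -
  assume s: "s \<in> S"
  have "inversions (wprod [s]) = {t \<in> carrier G. odd (count_list [s] t)}"
    using s by (subst inversions_word_prod) (simp_all add: m_assoc)
  also have "\<dots> = {s}" using s by (auto split: if_splits)
  finally show "inversions s = {s}" using s by simp
qed

lemma inversions_closed: "t \<in> inversions w \<Longrightarrow> t \<in> carrier G"
  by (simp add: inversions_def)

lemma gen_neq_one: "s \<in> S \<Longrightarrow> s \<noteq> \<one>"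
  using inversions_gen inversions_one by blast


section \<open>Length and strong exchange\<close>


lemma len_word_prod_le: "ws \<in> lists S \<Longrightarrow> len (wprod ws) \<le> length ws"
  unfolding cox_length_def by (rule Least_le) blast

lemma reduced_word_exists:
  assumes "w \<in> carrier G"
  obtains ws where "ws \<in> lists S" "wprod ws = w" "length ws = len w"
proof -
  obtain ws where "ws \<in> lists S" "wprod ws = w" using word_exists[OF assms] .
  hence "\<exists>n. \<exists>ws\<in>lists S. length ws = n \<and> word_prod G ws = w" by blast
  hence "\<exists>ws\<in>lists S. length ws = len w \<and> word_prod G ws = w"
    unfolding cox_length_def by (rule LeastI_ex)
  thus ?thesis using that by blast
qed

lemma len_one [simp]: "len \<one> = 0"
  using len_word_prod_le[of "[]"] by simp

lemma len_eq_0 [simp]: "w \<in> carrier G \<Longrightarrow> len w = 0 \<longleftrightarrow> w = \<one>"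
  by (metis len_one length_0_conv reduced_word_exists word_prod_Nil)

lemma len_inv_le: "w \<in> carrier G \<Longrightarrow> len (inv w) \<le> len w"
  by (metis len_word_prod_le length_rev reduced_word_exists rev_lists word_prod_rev)

lemma len_inv [simp]: "w \<in> carrier G \<Longrightarrow> len (inv w) = len w"
  using len_inv_le[of w] len_inv_le[of "inv w"] by simp

lemma reflectionI: "w \<in> carrier G \<Longrightarrow> s \<in> S \<Longrightarrow> inv w \<otimes> s \<otimes> w \<in> reflections G S"
  unfolding reflections_def by (intro CollectI exI[of _ "inv w"] exI[of _ s]) simp

lemma reflection_closed [simp]: "t \<in> reflections G S \<Longrightarrow> t \<in> carrier G"
  by (auto simp: reflections_def)

lemma reflection_square [simp]: "t \<in> reflections G S \<Longrightarrow> t \<otimes> t = \<one>"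
  unfolding reflections_def by clarify (simp add: m_assoc)

lemma reflection_inv [simp]: "t \<in> reflections G S \<Longrightarrow> inv t = t"
  by (intro inv_equality) auto

lemma reflection_conj:
  assumes "t \<in> reflections G S" "u \<in> carrier G"
  shows "u \<otimes> t \<otimes> inv u \<in> reflections G S"
proof -
  obtain w s where "w \<in> carrier G" "s \<in> S" "t = w \<otimes> s \<otimes> inv w"
    using assms(1) unfolding reflections_def by blast
  hence "u \<otimes> t \<otimes> inv u = (u \<otimes> w) \<otimes> s \<otimes> inv (u \<otimes> w)" "u \<otimes> w \<in> carrier G"
    using assms by (simp_all add: m_assoc inv_mult_group)
  thus ?thesis using \<open>s \<in> S\<close> unfolding reflections_def by blast
qed

lemma word_prod_mult_word_refls:
  assumes "ws \<in> lists S" "t \<in> set (word_refls ws)"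
  shows "\<exists>ws'\<in>lists S. wprod ws' = wprod ws \<otimes> t \<and> Suc (length ws') = length ws"
  using assms
proof (induction ws)
  case (Cons s ws)
  have s: "s \<in> S" "ws \<in> lists S" using Cons by auto
  show ?case
  proof (cases "t \<in> set (word_refls ws)")
    case True
    then obtain ws' where "ws' \<in> lists S" "wprod ws' = wprod ws \<otimes> t" "Suc (length ws') = length ws"
      using Cons s by blast
    moreover have "t \<in> carrier G" using True word_refls_closed s by blast
    ultimately show ?thesis using s by (intro bexI[of _ "s # ws'"]) (auto simp: m_assoc)
  next
    case False
    hence "t = inv (wprod ws) \<otimes> s \<otimes> wprod ws" using Cons by simp
    thus ?thesis using s by (intro bexI[of _ ws]) (simp_all add: m_assoc)
  qed
qed simp

lemma inversion_shorter:
  assumes "w \<in> carrier G" "t \<in> inversions w"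
  shows "len (w \<otimes> t) < len w"
proof -
  obtain ws where ws: "ws \<in> lists S" "wprod ws = w" "length ws = len w"
    using reduced_word_exists[OF assms(1)] .
  have "odd (count_list (word_refls ws) t)" using assms ws inversions_word_prod[of ws] by auto
  hence "t \<in> set (word_refls ws)" by (metis count_notin even_zero)
  then obtain ws' where "ws' \<in> lists S" "wprod ws' = w \<otimes> t" "Suc (length ws') = len w"
    using word_prod_mult_word_refls[of ws t] ws by auto
  thus ?thesis using len_word_prod_le[of ws'] by simp
qed

text \<open>
  In the product \<open>t = w s w\<^sup>-\<^sup>1\<close> the contributions of \<open>w\<close> and \<open>w\<^sup>-\<^sup>1\<close> to the parity of \<open>t\<close> cancel, and
  \<open>s\<close> contributes once.
\<close>

lemma reflection_self_inversion:
  assumes "t \<in> reflections G S"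
  shows "t \<in> inversions t"
proof -
  obtain w s where w: "w \<in> carrier G" "s \<in> S" "t = w \<otimes> s \<otimes> inv w"
    using assms unfolding reflections_def by blast
  have c: "inv w \<otimes> t \<otimes> w = s" using w by (simp add: m_assoc)
  have "s \<in> inversions (inv w \<otimes> w) \<longleftrightarrow> (s \<in> inversions w) \<noteq> (t \<in> inversions (inv w))"
    using inversions_mult[of "inv w" w s] w by simp
  hence 1: "s \<in> inversions w \<longleftrightarrow> t \<in> inversions (inv w)" using w by simp
  have 2: "s \<in> inversions (w \<otimes> s) \<longleftrightarrow> s \<notin> inversions w"
    using inversions_mult[of w s s] w by (simp add: m_assoc)
  have "t \<in> inversions ((w \<otimes> s) \<otimes> inv w) \<longleftrightarrow>
      (t \<in> inversions (inv w)) \<noteq> (s \<in> inversions (w \<otimes> s))"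
    using inversions_mult[of "w \<otimes> s" "inv w" t] w c by simp
  thus ?thesis using 1 2 w by simp
qed

lemma inversions_mult_reflection:
  assumes "t \<in> reflections G S" "w \<in> carrier G"
  shows "t \<in> inversions (w \<otimes> t) \<longleftrightarrow> t \<notin> inversions w"
  using inversions_mult[of w t t] assms reflection_self_inversion[of t] by (simp add: m_assoc)

text \<open>
  The strong exchange condition. If \<open>t\<close> is not an inversion of \<open>w\<close>, then it is one of \<open>w t\<close> by
  the cocycle identity, so the length drops from \<open>w t\<close> to \<open>w\<close>.
\<close>

lemma inversion_iff:
  assumes "t \<in> reflections G S" "w \<in> carrier G"
  shows "t \<in> inversions w \<longleftrightarrow> len (w \<otimes> t) < len w"
    and "t \<notin> inversions w \<longleftrightarrow> len w < len (w \<otimes> t)"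
proof -
  have "t \<notin> inversions w \<Longrightarrow> len (w \<otimes> t \<otimes> t) < len (w \<otimes> t)"
    using assms inversions_mult_reflection[of t w] inversion_shorter[of "w \<otimes> t" t] by simp
  hence "t \<notin> inversions w \<Longrightarrow> len w < len (w \<otimes> t)"
    using assms by (simp add: m_assoc)
  moreover have "t \<in> inversions w \<Longrightarrow> len (w \<otimes> t) < len w"
    using inversion_shorter assms by blast
  ultimately show "t \<in> inversions w \<longleftrightarrow> len (w \<otimes> t) < len w"
      "t \<notin> inversions w \<longleftrightarrow> len w < len (w \<otimes> t)"
    by force+
qed

text \<open>
  If the first letter repeated a later reflection, both letters could be deleted from the word
  without changing its product.
\<close>

lemma distinct_word_refls_reduced:
  assumes "ws \<in> lists S" "length ws = len (wprod ws)"
  shows "distinct (word_refls ws)"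
  using assms
proof (induction ws)
  case (Cons s ws)
  have s: "s \<in> S" "ws \<in> lists S" using Cons by auto
  obtain us where us: "us \<in> lists S" "wprod us = wprod ws" "length us = len (wprod ws)"
    using reduced_word_exists[OF word_prod_closed[OF s(2)]] .
  have "len (wprod (s # us)) \<le> length (s # us)"
    using len_word_prod_le[of "s # us"] us s by simp
  hence red: "length ws = len (wprod ws)"
    using Cons.prems us len_word_prod_le[of ws] s by simp
  have "inv (wprod ws) \<otimes> s \<otimes> wprod ws \<notin> set (word_refls ws)"
  proof
    assume "inv (wprod ws) \<otimes> s \<otimes> wprod ws \<in> set (word_refls ws)"
    then obtain ws' where "ws' \<in> lists S"
        "wprod ws' = wprod ws \<otimes> (inv (wprod ws) \<otimes> s \<otimes> wprod ws)" "Suc (length ws') = length ws"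
      using word_prod_mult_word_refls s by blast
    moreover from this have "wprod ws' = wprod (s # ws)" using s by (simp add: m_assoc)
    ultimately show False using len_word_prod_le[of ws'] Cons.prems by simp
  qed
  thus ?case using Cons.IH red s by simp
qed simp

lemma inversions_card:
  assumes "w \<in> carrier G"
  shows "finite (inversions w)" "card (inversions w) = len w"
proof -
  obtain ws where ws: "ws \<in> lists S" "wprod ws = w" "length ws = len w"
    using reduced_word_exists[OF assms] .
  have d: "distinct (word_refls ws)" using distinct_word_refls_reduced ws by simp
  have "distinct xs \<Longrightarrow> odd (count_list xs t) \<longleftrightarrow> t \<in> set xs" for t :: 'a and xs
    by (induction xs) auto
  with d have "odd (count_list (word_refls ws) t) \<longleftrightarrow> t \<in> set (word_refls ws)" for t
    by blast
  hence "inversions w = set (word_refls ws)"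
    using inversions_word_prod[of ws] ws word_refls_closed[of ws] by auto
  thus "finite (inversions w)" "card (inversions w) = len w"
    using d ws by (simp_all add: distinct_card)
qed

lemma inversions_gen_mult:
  assumes "s \<in> S" "w \<in> carrier G"
  defines "r \<equiv> inv w \<otimes> s \<otimes> w"
  shows "r \<in> inversions w \<Longrightarrow> inversions (s \<otimes> w) = inversions w - {r}"
    and "r \<notin> inversions w \<Longrightarrow> inversions (s \<otimes> w) = insert r (inversions w)"
proof -
  have r: "r \<in> carrier G" using assms by simp
  have "t \<in> inversions (s \<otimes> w) \<longleftrightarrow> (t \<in> inversions w) \<noteq> (t = r)" if "t \<in> carrier G" for t
  proof -
    have "w \<otimes> t \<otimes> inv w = s \<longleftrightarrow> t = r"
    proof
      assume "w \<otimes> t \<otimes> inv w = s"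
      hence "r = inv w \<otimes> (w \<otimes> t \<otimes> inv w) \<otimes> w" by (simp add: r_def)
      thus "t = r" using assms(2) that by (simp add: m_assoc)
    next
      assume "t = r"
      thus "w \<otimes> t \<otimes> inv w = s" using assms by (simp add: r_def m_assoc)
    qed
    thus ?thesis using inversions_mult[of s w t] assms that by simp
  qed
  thus "r \<in> inversions w \<Longrightarrow> inversions (s \<otimes> w) = inversions w - {r}"
    "r \<notin> inversions w \<Longrightarrow> inversions (s \<otimes> w) = insert r (inversions w)"
    using r inversions_closed by blast+
qed

lemma left_descent_iff:
  assumes "s \<in> S" "w \<in> carrier G"
  shows "ldesc s w \<longleftrightarrow> inv w \<otimes> s \<otimes> w \<in> inversions w"
  using inversion_iff(1)[OF reflectionI[of w s], of w] assms by (simp add: m_assoc)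

lemma len_gen_mult:
  assumes "s \<in> S" "w \<in> carrier G"
  shows "ldesc s w \<Longrightarrow> Suc (len (s \<otimes> w)) = len w"
    and "\<not> ldesc s w \<Longrightarrow> len (s \<otimes> w) = Suc (len w)"
proof -
  assume "ldesc s w"
  hence "inv w \<otimes> s \<otimes> w \<in> inversions w" using left_descent_iff assms by blast
  moreover from this have "inversions (s \<otimes> w) = inversions w - {inv w \<otimes> s \<otimes> w}"
    using inversions_gen_mult assms by blast
  ultimately show "Suc (len (s \<otimes> w)) = len w"
    using inversions_card[of w] inversions_card[of "s \<otimes> w"] assms
    by (metis card_Suc_Diff1 gen_closed m_closed)
next
  assume "\<not> ldesc s w"
  hence "inv w \<otimes> s \<otimes> w \<notin> inversions w" using left_descent_iff assms by blast
  moreover from this have "inversions (s \<otimes> w) = insert (inv w \<otimes> s \<otimes> w) (inversions w)"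
    using inversions_gen_mult assms by blast
  ultimately show "len (s \<otimes> w) = Suc (len w)"
    using inversions_card[of w] inversions_card[of "s \<otimes> w"] assms
    by (metis card_insert_disjoint gen_closed m_closed)
qed

lemma len_gen [simp]: "s \<in> S \<Longrightarrow> len s = 1"
  using len_gen_mult(2)[of s \<one>] by simp

lemma len_mult_gen:
  assumes "s \<in> S" "w \<in> carrier G"
  shows "len (w \<otimes> s) < len w \<Longrightarrow> Suc (len (w \<otimes> s)) = len w"
    and "\<not> len (w \<otimes> s) < len w \<Longrightarrow> len (w \<otimes> s) = Suc (len w)"
proof -
  have "len (s \<otimes> inv w) = len (inv (w \<otimes> s))" using assms by (simp add: inv_mult_group)
  also have "\<dots> = len (w \<otimes> s)" using assms by simp
  finally show "len (w \<otimes> s) < len w \<Longrightarrow> Suc (len (w \<otimes> s)) = len w"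
      "\<not> len (w \<otimes> s) < len w \<Longrightarrow> len (w \<otimes> s) = Suc (len w)"
    using len_gen_mult[of s "inv w"] assms by simp_all
qed

lemma left_descent_exists:
  assumes "w \<in> carrier G" "w \<noteq> \<one>"
  obtains s where "s \<in> S" "ldesc s w"
proof -
  obtain ws where ws: "ws \<in> lists S" "wprod ws = w" "length ws = len w"
    using reduced_word_exists[OF assms(1)] .
  then obtain s us where us: "ws = s # us" using assms by (cases ws) auto
  have "s \<otimes> w = wprod us" using ws us by auto
  hence "ldesc s w" using len_word_prod_le[of us] ws us by simp
  moreover have "s \<in> S" using ws us by simp
  ultimately show ?thesis using that by blast
qed

text \<open>
  The inversion sets of \<open>w\<close> and \<open>s w\<close> differ only in \<open>w\<^sup>-\<^sup>1 s w\<close>, which is not \<open>r\<close>; so left and right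
  descents do not influence each other. This is what makes left and right operators commute.
\<close>

lemma descent_parallel:
  assumes "s \<in> S" "r \<in> S" "w \<in> carrier G" "s \<otimes> w \<noteq> w \<otimes> r"
  shows "len (s \<otimes> (w \<otimes> r)) < len (w \<otimes> r) \<longleftrightarrow> ldesc s w"
    and "len (s \<otimes> w \<otimes> r) < len (s \<otimes> w) \<longleftrightarrow> len (w \<otimes> r) < len w"
proof -
  have r: "r \<in> reflections G S" using reflectionI[of \<one> r] assms by simp
  define p where "p = inv w \<otimes> s \<otimes> w"
  have p: "p \<in> carrier G" "p \<noteq> r"
  proof -
    show "p \<in> carrier G" using assms by (simp add: p_def)
    have "w \<otimes> p = s \<otimes> w" using assms by (simp add: p_def m_assoc)
    thus "p \<noteq> r" using assms by auto
  qed
  have "r \<otimes> p \<otimes> r \<noteq> r"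
  proof
    assume "r \<otimes> p \<otimes> r = r"
    hence "r \<otimes> (r \<otimes> p \<otimes> r) \<otimes> r = r \<otimes> r \<otimes> r" using assms by simp
    thus False using assms p by (simp add: m_assoc)
  qed
  hence "r \<otimes> p \<otimes> r \<in> inversions (w \<otimes> r) \<longleftrightarrow> r \<otimes> (r \<otimes> p \<otimes> r) \<otimes> inv r \<in> inversions w"
    using inversions_mult[of w r "r \<otimes> p \<otimes> r"] assms p by simp
  also have "r \<otimes> (r \<otimes> p \<otimes> r) \<otimes> inv r = p" using assms p by (simp add: m_assoc)
  finally have "r \<otimes> p \<otimes> r \<in> inversions (w \<otimes> r) \<longleftrightarrow> p \<in> inversions w" .
  moreover have "inv (w \<otimes> r) \<otimes> s \<otimes> (w \<otimes> r) = r \<otimes> p \<otimes> r"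
    using assms by (simp add: p_def m_assoc inv_mult_group)
  ultimately show "len (s \<otimes> (w \<otimes> r)) < len (w \<otimes> r) \<longleftrightarrow> ldesc s w"
    using left_descent_iff[of s w] left_descent_iff[of s "w \<otimes> r"] assms by (simp add: p_def)
  have "r \<in> inversions (s \<otimes> w) \<longleftrightarrow> r \<in> inversions w"
    using inversions_gen_mult[OF assms(1,3), folded p_def] p
    by (cases "p \<in> inversions w") auto
  thus "len (s \<otimes> w \<otimes> r) < len (s \<otimes> w) \<longleftrightarrow> len (w \<otimes> r) < len w"
    using inversion_iff(1)[OF r] assms by simp
qed

section \<open>Bruhat order and lifting\<close>

lemma le_closed: "le u v \<Longrightarrow> u \<in> carrier G" "le u v \<Longrightarrow> v \<in> carrier G"
  by (simp_all add: bruhat_le_def)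

lemma le_refl [simp]: "u \<in> carrier G \<Longrightarrow> le u u"
  by (simp add: bruhat_le_def)

lemma le_trans: "le u v \<Longrightarrow> le v w \<Longrightarrow> le u w"
  by (auto simp: bruhat_le_def)

lemma step_closed: "bruhat_step G S u v \<Longrightarrow> u \<in> carrier G \<and> v \<in> carrier G"
  by (auto simp: bruhat_step_def)

lemma step_le: "bruhat_step G S u v \<Longrightarrow> le u v"
  using step_closed by (auto simp: bruhat_le_def)

lemma stepI:
  "u \<in> carrier G \<Longrightarrow> t \<in> reflections G S \<Longrightarrow> len u < len (u \<otimes> t) \<Longrightarrow> bruhat_step G S u (u \<otimes> t)"
  by (auto simp: bruhat_step_def)

lemma le_induct [consumes 1, case_names refl step]:
  assumes "le u v" "\<And>u. u \<in> carrier G \<Longrightarrow> P u u"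
    and "\<And>u v w. le u v \<Longrightarrow> P u v \<Longrightarrow> bruhat_step G S v w \<Longrightarrow> P u w"
  shows "P u v"
proof -
  have u: "u \<in> carrier G" using assms(1) le_closed by blast
  have "(bruhat_step G S)\<^sup>*\<^sup>* u v" using assms(1) by (simp add: bruhat_le_def)
  hence "P u v \<and> le u v"
  proof (induction rule: rtranclp_induct)
    case base thus ?case using assms(2) u by simp
  next
    case (step y z)
    thus ?case using assms(3) step_le le_trans by blast
  qed
  thus ?thesis by simp
qed

lemma le_len: "le u v \<Longrightarrow> len u \<le> len v \<and> (len u = len v \<longrightarrow> u = v)"
proof (induction rule: le_induct)
  case (step u v w)
  thus ?case by (auto simp: bruhat_step_def)
qed simp

lemma le_antisym: "le u v \<Longrightarrow> le v u \<Longrightarrow> u = v"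
  using le_len[of u v] le_len[of v u] by simp

lemma le_one: "le u \<one> \<Longrightarrow> u = \<one>"
  using le_len[of u \<one>] le_closed by auto

lemma le_gen_mult: "s \<in> S \<Longrightarrow> w \<in> carrier G \<Longrightarrow> len w < len (s \<otimes> w) \<Longrightarrow> le w (s \<otimes> w)"
  using stepI[of w "inv w \<otimes> s \<otimes> w"] reflectionI[of w s] step_le by (simp add: m_assoc)

lemma gen_mult_le:
  assumes "s \<in> S" "w \<in> carrier G" "ldesc s w"
  shows "le (s \<otimes> w) w"
  using le_gen_mult[of s "s \<otimes> w"] assms by simp

text \<open>
  Write \<open>v = u t\<close>. Unless \<open>t = u\<^sup>-\<^sup>1 s u\<close>, passing from \<open>u\<close> to \<open>s u\<close> does not change whether \<open>t\<close> is an
  inversion.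
\<close>

lemma step_gen_mult:
  assumes "bruhat_step G S u v" "s \<in> S"
  shows "v = s \<otimes> u \<or> bruhat_step G S (s \<otimes> u) (s \<otimes> v)"
proof -
  obtain t where t: "u \<in> carrier G" "t \<in> reflections G S" "v = u \<otimes> t" "len u < len v"
    using assms by (auto simp: bruhat_step_def)
  have n: "t \<notin> inversions u" using t inversion_iff by simp
  show ?thesis
  proof (cases "t = inv u \<otimes> s \<otimes> u")
    case True
    thus ?thesis using t assms by (simp add: m_assoc)
  next
    case False
    hence "t \<notin> inversions (s \<otimes> u)"
      using inversions_gen_mult[of s u] n t assms by blast
    hence "len (s \<otimes> u) < len (s \<otimes> u \<otimes> t)" using t assms inversion_iff by simp
    hence "bruhat_step G S (s \<otimes> u) (s \<otimes> u \<otimes> t)" using t assms by (intro stepI) auto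
    thus ?thesis using t assms by (simp add: m_assoc)
  qed
qed

text \<open>
  The larger and the smaller element of \<open>{w, s w}\<close>. That both maps are monotone summarises the
  lifting property in all its cases.
\<close>

definition upper :: "'a \<Rightarrow> 'a \<Rightarrow> 'a" where
  "upper s w = (if ldesc s w then w else s \<otimes> w)"

definition lower :: "'a \<Rightarrow> 'a \<Rightarrow> 'a" where
  "lower s w = (if ldesc s w then s \<otimes> w else w)"

lemma upper_lower_le:
  assumes "s \<in> S" "w \<in> carrier G"
  shows "le w (upper s w)" "le (s \<otimes> w) (upper s w)" "le (lower s w) w" "le (lower s w) (s \<otimes> w)"
  using le_gen_mult[OF assms] gen_mult_le[OF assms] len_gen_mult(2)[OF assms] assms
  by (auto simp: upper_def lower_def)

lemma upper_lower_gen_mult: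
  assumes "s \<in> S" "w \<in> carrier G"
  shows "upper s (s \<otimes> w) = upper s w" "lower s (s \<otimes> w) = lower s w"
  using len_gen_mult(2)[OF assms] assms by (auto simp: upper_def lower_def)

text \<open>
  A step from \<open>u\<close> to \<open>v\<close> either joins \<open>u\<close> to \<open>s u\<close>, where both maps are constant, or is accompanied
  by a step from \<open>s u\<close> to \<open>s v\<close>.
\<close>

lemma upper_lower_mono:
  assumes "le u v" "s \<in> S"
  shows "le (upper s u) (upper s v) \<and> le (lower s u) (lower s v)"
  using assms(1)
proof (induction rule: le_induct)
  case (refl u)
  thus ?case using assms(2) by (simp add: upper_def lower_def)
next
  case (step u v w)
  have bs: "bruhat_step G S v w" using step by blast
  have c: "v \<in> carrier G" "w \<in> carrier G" using step_closed[OF bs] by auto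
  have "le (upper s v) (upper s w) \<and> le (lower s v) (lower s w)"
  proof (cases "w = s \<otimes> v")
    case True
    thus ?thesis using upper_lower_gen_mult[of s v] assms(2) c
      by (simp add: upper_def lower_def)
  next
    case False
    hence le: "le v w" "le (s \<otimes> v) (s \<otimes> w)"
      using step_gen_mult[OF bs assms(2)] bs step_le by auto
    have "upper s v = v \<or> upper s v = s \<otimes> v" "lower s w = w \<or> lower s w = s \<otimes> w"
      by (auto simp: upper_def lower_def)
    thus ?thesis
      using le upper_lower_le[OF assms(2) c(1)] upper_lower_le[OF assms(2) c(2)] le_trans by metis
  qed
  thus ?case using step le_trans by blast
qed

lemma lift_both:
  assumes "le u v" "s \<in> S" "ldesc s u" "ldesc s v"
  shows "le (s \<otimes> u) (s \<otimes> v)"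
  using upper_lower_mono[OF assms(1,2)] assms by (simp add: lower_def)

lemma lift_down:
  assumes "le u v" "s \<in> S" "\<not> ldesc s u" "ldesc s v"
  shows "le u (s \<otimes> v)"
  using upper_lower_mono[OF assms(1,2)] assms by (simp add: lower_def)

lemma lift_up:
  assumes "le u v" "s \<in> S" "ldesc s v"
  shows "le (s \<otimes> u) v"
  using upper_lower_mono[OF assms(1,2)] upper_lower_le(2)[of s u] assms le_closed le_trans
  by (metis upper_def)

lemma lift_mult:
  assumes "le u v" "s \<in> S" "\<not> ldesc s v"
  shows "le (s \<otimes> u) (s \<otimes> v)" 
  using upper_lower_mono[OF assms(1,2)] upper_lower_le(2)[of s u] assms le_closed le_trans
  by (metis upper_def)

lemma le_inv:
  assumes "le u v"
  shows "le (inv u) (inv v)"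
  using assms
proof (induction rule: le_induct)
  case (step u v w)
  then obtain t where t: "v \<in> carrier G" "t \<in> reflections G S" "w = v \<otimes> t" "len v < len w"
    by (auto simp: bruhat_step_def)
  have "inv w = inv v \<otimes> (v \<otimes> t \<otimes> inv v)" using t by (simp add: inv_mult_group m_assoc)
  moreover have "len (inv v) < len (inv w)" using t by simp
  ultimately have "bruhat_step G S (inv v) (inv w)"
    using t reflection_conj[of t v] by (metis stepI inv_closed)
  thus ?case using step step_le le_trans by blast
qed simp

lemma lift_down_right:
  assumes "le u v" "s \<in> S" "\<not> len (u \<otimes> s) < len u" "len (v \<otimes> s) < len v"
  shows "le u (v \<otimes> s)"
proof -
  have c: "u \<in> carrier G" "v \<in> carrier G" using assms le_closed by auto
  have i: "s \<otimes> inv w = inv (w \<otimes> s)" if "w \<in> carrier G" for w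
    using assms that by (simp add: inv_mult_group)
  have "le (inv u) (s \<otimes> inv v)"
    using le_inv[OF assms(1)] assms c by (intro lift_down) (simp_all add: i)
  hence "le (inv (inv u)) (inv (s \<otimes> inv v))" by (rule le_inv)
  thus ?thesis using c assms by (simp add: inv_mult_group)
qed

text \<open>
  By lifting, the elements below \<open>v\<close> lie below \<open>s v\<close> or are \<open>s\<close>-translates of such elements.
\<close>

lemma finite_below: "v \<in> carrier G \<Longrightarrow> finite {u. le u v}"
proof (induction "len v" arbitrary: v rule: less_induct)
  case less
  show ?case
  proof (cases "v = \<one>")
    case True
    hence "{u. le u v} \<subseteq> {\<one>}" using le_one by auto
    thus ?thesis using finite_subset by blast
  next
    case False
    then obtain s where s: "s \<in> S" "ldesc s v"
      using left_descent_exists less by blast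
    have "{u. le u v} \<subseteq> {u. le u (s \<otimes> v)} \<union> (\<otimes>) s ` {u. le u (s \<otimes> v)}"
    proof
      fix u assume "u \<in> {u. le u v}"
      hence u: "le u v" "u \<in> carrier G" using le_closed by auto
      show "u \<in> {u. le u (s \<otimes> v)} \<union> (\<otimes>) s ` {u. le u (s \<otimes> v)}"
      proof (cases "ldesc s u")
        case True
        hence "le (s \<otimes> u) (s \<otimes> v)" using lift_both u s by blast
        thus ?thesis using s u by (intro UnI2 image_eqI[of _ _ "s \<otimes> u"]) auto
      qed (use lift_down u s in blast)
    qed
    moreover have "finite {u. le u (s \<otimes> v)}" using less s by simp
    ultimately show ?thesis by (meson finite_UnI finite_imageI finite_subset)
  qed
qed

end

section \<open>Minimal coset representatives\<close>

locale parabolic = coxeter_system +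
  fixes J :: "'a set"
  assumes J_subset: "J \<subseteq> S"
begin

abbreviation WJ :: "'a set" where "WJ \<equiv> generate G J"
abbreviation MJ :: "'a set" where "MJ \<equiv> min_reps G S J"

lemma J_closed: "J \<subseteq> carrier G"
  using J_subset gens_closed by blast

lemma WJ_closed [simp]: "z \<in> WJ \<Longrightarrow> z \<in> carrier G"
  using generate_incl[OF J_closed] by blast

lemma WJ_one [simp]: "\<one> \<in> WJ"
  by (rule generate.one)

lemma WJ_mult: "y \<in> WJ \<Longrightarrow> z \<in> WJ \<Longrightarrow> y \<otimes> z \<in> WJ"
  by (rule generate.eng)

lemma WJ_inv: "z \<in> WJ \<Longrightarrow> inv z \<in> WJ"
  using generate_m_inv_closed[OF J_closed] by blast

lemma WJ_conj:
  assumes "z \<in> WJ" "r \<in> carrier G"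
  shows "z \<otimes> r \<otimes> inv z \<in> WJ \<longleftrightarrow> r \<in> WJ"
proof
  assume "z \<otimes> r \<otimes> inv z \<in> WJ"
  hence "inv z \<otimes> (z \<otimes> r \<otimes> inv z) \<otimes> z \<in> WJ" using assms WJ_mult WJ_inv by blast
  thus "r \<in> WJ" using assms by (simp add: m_assoc)
qed (use assms WJ_mult WJ_inv in blast)

lemma inversions_WJ: "z \<in> WJ \<Longrightarrow> inversions z \<subseteq> WJ"
proof (induction rule: generate.induct)
  case (incl h) thus ?case using J_subset generate.incl[of h J G] by auto
next
  case (inv h) thus ?case using J_subset generate.incl[of h J G] by auto
next
  case (eng y z)
  show ?case
  proof
    fix t assume t: "t \<in> inversions (y \<otimes> z)"
    have "t \<in> carrier G" using t inversions_closed by blast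
    hence "t \<in> inversions z \<or> z \<otimes> t \<otimes> inv z \<in> inversions y"
      using inversions_mult[of y z t] eng t by auto
    thus "t \<in> WJ" using eng WJ_conj[of z t] \<open>t \<in> carrier G\<close> by blast
  qed
qed simp

lemma min_repD: "w \<in> MJ \<Longrightarrow> z \<in> WJ \<Longrightarrow> len w \<le> len (w \<otimes> z)"
  unfolding min_reps_def l_coset_def by blast

lemma min_repI:
  "w \<in> carrier G \<Longrightarrow> (\<And>z. z \<in> WJ \<Longrightarrow> len w \<le> len (w \<otimes> z)) \<Longrightarrow> w \<in> MJ"
  unfolding min_reps_def l_coset_def by blast

lemma MJ_closed [simp]: "w \<in> MJ \<Longrightarrow> w \<in> carrier G"
  by (simp add: min_reps_def)

text \<open>
  Conjugation by \<open>z \<in> W\<^sub>J\<close> preserves \<open>W\<^sub>J\<close>. So in the cocycle identity for \<open>w z\<close> the part that comes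
  from \<open>w\<close> avoids \<open>W\<^sub>J\<close>, while the inversions of \<open>z\<close> lie in \<open>W\<^sub>J\<close>: the two parts are
  disjoint and their cardinalities add up.
\<close>

lemma inversions_mult_WJ:
  assumes "w \<in> carrier G" "inversions w \<inter> WJ = {}" "z \<in> WJ"
  shows "inversions (w \<otimes> z) \<inter> WJ = inversions z" "len (w \<otimes> z) = len w + len z"
proof -
  define D where "D = {t \<in> carrier G. z \<otimes> t \<otimes> inv z \<in> inversions w}"
  have D: "D \<inter> WJ = {}" using assms WJ_conj[of z] by (auto simp: D_def)
  have iz: "inversions z \<subseteq> WJ" using inversions_WJ assms by blast
  have "t \<in> inversions (w \<otimes> z) \<longleftrightarrow> t \<in> inversions z \<union> D" for t
  proof (cases "t \<in> carrier G")
    case True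
    have "\<not> (t \<in> inversions z \<and> t \<in> D)" using D iz by blast
    thus ?thesis using inversions_mult[of w z t] assms True by (auto simp: D_def)
  next
    case False
    thus ?thesis using inversions_closed by (auto simp: D_def)
  qed
  hence eq: "inversions (w \<otimes> z) = inversions z \<union> D" by blast
  thus "inversions (w \<otimes> z) \<inter> WJ = inversions z" using D iz by blast
  have "bij_betw (\<lambda>t. z \<otimes> t \<otimes> inv z) D (inversions w)"
  proof (rule bij_betw_byWitness[where f' = "\<lambda>t. inv z \<otimes> t \<otimes> z"])
    have "\<forall>t\<in>inversions w. t \<in> carrier G" using inversions_closed by blast
    thus "\<forall>t\<in>D. inv z \<otimes> (z \<otimes> t \<otimes> inv z) \<otimes> z = t"
      "\<forall>t\<in>inversions w. z \<otimes> (inv z \<otimes> t \<otimes> z) \<otimes> inv z = t"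
      "(\<lambda>t. z \<otimes> t \<otimes> inv z) ` D \<subseteq> inversions w" "(\<lambda>t. inv z \<otimes> t \<otimes> z) ` inversions w \<subseteq> D"
      using assms by (auto simp: D_def m_assoc)
  qed
  hence "card D = len w" "finite D"
    using inversions_card[OF assms(1)] bij_betw_same_card bij_betw_finite by metis+
  moreover have "inversions z \<inter> D = {}" using D iz by blast
  ultimately have "card (inversions (w \<otimes> z)) = len z + len w"
    using inversions_card[of z] assms(3) by (simp add: eq card_Un_disjoint)
  thus "len (w \<otimes> z) = len w + len z" using inversions_card[of "w \<otimes> z"] assms by simp
qed

text \<open>
  An inversion in \<open>W\<^sub>J\<close> would lead to a shorter element of the same coset; the converse is
  additivity of length.
\<close>

lemma min_reps_iff: "w \<in> MJ \<longleftrightarrow> w \<in> carrier G \<and> inversions w \<inter> WJ = {}"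
proof
  assume w: "w \<in> MJ"
  have "t \<notin> WJ" if "t \<in> inversions w" for t
  proof
    assume "t \<in> WJ"
    hence "len w \<le> len (w \<otimes> t)" using w min_repD by blast
    thus False using inversion_shorter[of w t] w that by simp
  qed
  thus "w \<in> carrier G \<and> inversions w \<inter> WJ = {}" using w by auto
next
  assume "w \<in> carrier G \<and> inversions w \<inter> WJ = {}"
  thus "w \<in> MJ" using inversions_mult_WJ(2)[of w] by (intro min_repI) simp_all
qed

lemma len_min_rep_mult: "w \<in> MJ \<Longrightarrow> z \<in> WJ \<Longrightarrow> len (w \<otimes> z) = len w + len z"
  using inversions_mult_WJ(2) min_reps_iff by blast

lemma coset_decomposition:
  assumes "w \<in> carrier G"
  shows "\<exists>u\<in>MJ. \<exists>z\<in>WJ. w = u \<otimes> z"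
  using assms
proof (induction "len w" arbitrary: w rule: less_induct)
  case less
  show ?case
  proof (cases "w \<in> MJ")
    case True
    thus ?thesis by (intro bexI[of _ w] bexI[of _ \<one>]) simp_all
  next
    case False
    then obtain t where t: "t \<in> inversions w" "t \<in> WJ" using less min_reps_iff by blast
    moreover have "w \<otimes> t \<in> carrier G" using less t by simp
    ultimately obtain u z where uz: "u \<in> MJ" "z \<in> WJ" "w \<otimes> t = u \<otimes> z"
      using less inversion_shorter[of w t] by blast
    have "w = (w \<otimes> t) \<otimes> inv t" using less t by (simp add: m_assoc)
    also have "\<dots> = u \<otimes> (z \<otimes> inv t)" using less t uz by (simp add: m_assoc)
    finally show ?thesis using uz t WJ_mult WJ_inv by blast
  qed
qed

lemma min_rep_unique:
  assumes "u \<in> MJ" "u \<otimes> z \<in> MJ" "z \<in> WJ"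
  shows "z = \<one>"
proof -
  have "inversions z = {}"
    using inversions_mult_WJ(1)[of u z] assms min_reps_iff by blast
  thus ?thesis using inversions_card[of z] assms by simp
qed

lemma coset_decomposition_unique:
  assumes "u \<in> MJ" "u' \<in> MJ" "z \<in> WJ" "z' \<in> WJ" "u \<otimes> z = u' \<otimes> z'"
  shows "u = u'" "z = z'"
proof -
  have "u' = (u' \<otimes> z') \<otimes> inv z'" using assms by (simp add: m_assoc)
  also have "\<dots> = u \<otimes> (z \<otimes> inv z')" using assms by (simp add: m_assoc flip: assms(5))
  finally have u': "u' = u \<otimes> (z \<otimes> inv z')" .
  hence "z \<otimes> inv z' = \<one>"
    using min_rep_unique[of u "z \<otimes> inv z'"] assms WJ_mult WJ_inv by metis
  thus "u = u'" using u' assms by simp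
  thus "z = z'" using assms by simp
qed

lemma gen_mult_min_rep_down:
  assumes "w \<in> MJ" "s \<in> S" "ldesc s w"
  shows "s \<otimes> w \<in> MJ"
proof -
  have "inversions (s \<otimes> w) \<subseteq> inversions w"
    using inversions_gen_mult(1)[of s w] left_descent_iff[of s w] assms by auto
  thus ?thesis using assms min_reps_iff by auto
qed

lemma len_1_gen:
  assumes "w \<in> carrier G" "len w = 1"
  shows "w \<in> S"
proof -
  obtain ws where ws: "ws \<in> lists S" "wprod ws = w" "length ws = 1"
    using reduced_word_exists[OF assms(1)] assms(2) by metis
  then obtain s where "ws = [s]" by (auto simp: length_Suc_conv)
  thus ?thesis using ws by auto
qed

text \<open>
  Deodhar's lemma. If \<open>s w\<close> is not minimal, its only new inversion \<open>j = w\<^sup>-\<^sup>1 s w\<close> must lie in \<open>W\<^sub>J\<close>, and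
  additivity of length forces \<open>\<ell>(j) = 1\<close>.
\<close>

lemma gen_mult_not_min_rep:
  assumes "w \<in> MJ" "s \<in> S" "s \<otimes> w \<notin> MJ"
  defines "j \<equiv> inv w \<otimes> s \<otimes> w"
  shows "j \<in> S" "j \<in> WJ" "s \<otimes> w = w \<otimes> j"
proof -
  have w: "w \<in> carrier G" "inversions w \<inter> WJ = {}" using assms min_reps_iff by blast+
  have up: "\<not> ldesc s w" using gen_mult_min_rep_down assms by blast
  hence j: "j \<notin> inversions w" using left_descent_iff[of s w] assms by simp
  hence "inversions (s \<otimes> w) = insert j (inversions w)"
    using inversions_gen_mult(2)[of s w] assms by simp
  thus jW: "j \<in> WJ" using assms w min_reps_iff[of "s \<otimes> w"] by auto
  show eq: "s \<otimes> w = w \<otimes> j" using assms w by (simp add: j_def m_assoc)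
  have "len (s \<otimes> w) = len w + len j" using len_min_rep_mult[OF assms(1) jW] eq by simp
  hence "len j = 1" using len_gen_mult(2)[of s w] up assms w by simp
  thus "j \<in> S" using len_1_gen WJ_closed[OF jW] by blast
qed

text \<open>
  Induction along reduced words of \<open>z \<in> W\<^sub>J\<close>; their letters stay in \<open>W\<^sub>J\<close> because a right descent of \<open>z\<close>
  is an inversion of \<open>z\<close>.
\<close>

lemma WJ_induct [consumes 1, case_names one mult]:
  assumes "z \<in> WJ" "P \<one>"
    and "\<And>z j. z \<in> WJ \<Longrightarrow> j \<in> S \<Longrightarrow> j \<in> WJ \<Longrightarrow> len (z \<otimes> j) = Suc (len z) \<Longrightarrow> P z \<Longrightarrow> P (z \<otimes> j)"
  shows "P z"
  using assms(1)
proof (induction "len z" arbitrary: z rule: less_induct)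
  case less
  show ?case
  proof (cases "z = \<one>")
    case False
    then obtain j where j: "j \<in> S" "len (j \<otimes> inv z) < len (inv z)"
      using left_descent_exists[of "inv z"] less by auto
    have e: "j \<otimes> inv z = inv (z \<otimes> j)" using j less by (simp add: inv_mult_group)
    have lt: "len (z \<otimes> j) < len z" using j less unfolding e by simp
    have "j \<in> inversions z"
      using inversion_iff(1)[of j z] lt j less reflectionI[of \<one> j] by simp
    hence jW: "j \<in> WJ" using inversions_WJ less by blast
    have zj: "z \<otimes> j \<in> WJ" using WJ_mult less jW by blast
    moreover have "len (z \<otimes> j \<otimes> j) = Suc (len (z \<otimes> j))"
      using len_mult_gen(1)[of j z] lt j less by simp
    ultimately have "P (z \<otimes> j \<otimes> j)"
      using assms(3)[of "z \<otimes> j" j] less.hyps[OF lt zj] j jW by blast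
    thus ?thesis using j less by simp
  qed (use assms in simp)
qed

text \<open>
  Since \<open>a\<close> has no right descent in \<open>W\<^sub>J\<close>, lifting on the right strips the letters of \<open>z\<close> one by one.
\<close>

lemma le_min_rep:
  assumes "z \<in> WJ" "a \<in> MJ" "u \<in> MJ" "le a (u \<otimes> z)"
  shows "le a u"
  using assms(1,4)
proof (induction rule: WJ_induct)
  case one thus ?case using assms by simp
next
  case (mult z j)
  have "j \<notin> inversions a" using assms min_reps_iff mult by blast
  hence "\<not> len (a \<otimes> j) < len a"
    using inversion_iff(1)[of j a] mult assms reflectionI[of \<one> j] by simp
  moreover have "len (u \<otimes> (z \<otimes> j) \<otimes> j) < len (u \<otimes> (z \<otimes> j))"
    using mult assms len_min_rep_mult[of u z] len_min_rep_mult[of u "z \<otimes> j"] WJ_mult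
    by (simp add: m_assoc)
  ultimately have "le a (u \<otimes> (z \<otimes> j) \<otimes> j)"
    using mult lift_down_right by blast
  thus ?case using mult assms by (simp add: m_assoc)
qed

lemma min_rep_le: 
  assumes "z \<in> WJ" "u \<in> MJ"
  shows "le u (u \<otimes> z)"
  using assms(1)
proof (induction rule: WJ_induct)
  case one thus ?case using assms by simp
next
  case (mult z j)
  have "len (u \<otimes> z) < len (u \<otimes> z \<otimes> j)"
    using mult assms len_min_rep_mult[of u z] len_min_rep_mult[of u "z \<otimes> j"] WJ_mult
    by (simp add: m_assoc)
  hence "le (u \<otimes> z) (u \<otimes> z \<otimes> j)"
    using mult assms reflectionI[of \<one> j] by (intro step_le stepI) auto
  hence "le u (u \<otimes> z \<otimes> j)" using mult le_trans by blast
  thus ?case using mult assms by (simp add: m_assoc)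
qed

text \<open>
  The chain property of \<open>W\<^sup>J\<close>. Take a left descent \<open>s\<close> of \<open>w\<close> and argue by induction on \<open>\<ell>(w)\<close>. If
  \<open>s\<close> is an ascent of \<open>u\<close>, then \<open>u \<le> s w\<close>, so that induction applies to \<open>s w\<close> unless \<open>s u \<in> W\<^sup>J\<close>, in
  which case \<open>s u\<close> itself is the element sought. If \<open>s\<close> is a descent of \<open>u\<close>, induction yields an \<open>a\<close>
  between \<open>s u\<close> and \<open>s w\<close>. Then either \<open>a = u\<close>, so that \<open>u \<le> s w\<close> and induction applies again, or
  \<open>s a\<close> is the element sought.
\<close>

lemma min_rep_chain:
  assumes "u \<in> MJ" "w \<in> MJ" "le u w" "u \<noteq> w"
  shows "\<exists>a\<in>MJ. len a = Suc (len u) \<and> le u a \<and> le a w"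
  using assms
proof (induction "len w" arbitrary: u w rule: less_induct)
  case less
  have c: "u \<in> carrier G" "w \<in> carrier G" using less by auto
  have "w \<noteq> \<one>" using less le_one by blast
  then obtain s where s: "s \<in> S" "ldesc s w"
    using left_descent_exists c by blast
  have sw: "s \<otimes> w \<in> MJ" "le (s \<otimes> w) w"
    using gen_mult_min_rep_down less s gen_mult_le c by blast+
  have via: ?case if "le u (s \<otimes> w)" "u \<noteq> s \<otimes> w"
    using less.hyps[of "s \<otimes> w" u] that s sw less.prems le_trans by blast
  show ?case
  proof (cases "ldesc s u")
    case True
    have su: "s \<otimes> u \<in> MJ" "le (s \<otimes> u) (s \<otimes> w)" "s \<otimes> u \<noteq> s \<otimes> w"
      using gen_mult_min_rep_down less True s lift_both c by auto
    obtain a where a: "a \<in> MJ" "len a = Suc (len (s \<otimes> u))" "le (s \<otimes> u) a" "le a (s \<otimes> w)"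
      using less.hyps[of "s \<otimes> w" "s \<otimes> u"] s sw su by blast
    have lu: "len a = len u" using a len_gen_mult(1)[of s u] True s c by simp
    have ac: "a \<in> carrier G" using a by simp
    show ?thesis
    proof (cases "a = u")
      case True
      hence "le u (s \<otimes> w)" using a by simp
      moreover have "u \<noteq> s \<otimes> w"
        using \<open>ldesc s u\<close> s c by auto
      ultimately show ?thesis by (rule via)
    next
      case False
      have up: "\<not> ldesc s a"
      proof
        assume *: "ldesc s a"
        have "le (s \<otimes> (s \<otimes> u)) a" using lift_up[OF a(3) s(1) *] .
        hence "le u a" using s c by simp
        thus False using le_len[of u a] lu False by simp
      qed
      have ua: "le u (s \<otimes> a)"
        using lift_mult[OF a(3) s(1) up] s c by simp
      have lsa: "len (s \<otimes> a) = Suc (len u)" using len_gen_mult(2)[of s a] up s ac lu by simp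
      \<comment> \<open>Otherwise \<open>u \<le> s a\<close> would project to \<open>u \<le> a\<close>, with equal lengths.\<close>
      have "s \<otimes> a \<in> MJ"
      proof (rule ccontr)
        assume n: "s \<otimes> a \<notin> MJ"
        have "le u a"
          using le_min_rep[of "inv a \<otimes> s \<otimes> a" u a] gen_mult_not_min_rep[OF a(1) s(1) n] ua less
            a by simp
        thus False using le_len[of u a] lu False by simp
      qed
      moreover have "le (s \<otimes> a) w"
        using lift_up[of a w s] a sw s le_trans by blast
      ultimately show ?thesis using ua lsa by blast
    qed
  next
    case False
    have usw: "le u (s \<otimes> w)" using lift_down less False s by blast
    show ?thesis
    proof (cases "s \<otimes> u \<in> MJ")
      case True
      have "le (s \<otimes> u) w" using lift_up less s by blast
      moreover have "len (s \<otimes> u) = Suc (len u)" using len_gen_mult(2)[of s u] False s c by simp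
      moreover have "le u (s \<otimes> u)" using le_gen_mult[of s u] s c calculation by simp
      ultimately show ?thesis using True by blast
    next
      case False
      hence "u \<noteq> s \<otimes> w" using s c less by auto
      thus ?thesis using via usw by blast
    qed
  qed
qed

end

context coxeter_system
begin

lemma generate_empty_eq: "generate G {} = {\<one>}"
  using generate_empty by simp

sublocale ord: parabolic G S "{}"
  by unfold_locales simp

lemma min_reps_empty [simp]: "min_reps G S {} = carrier G"
proof -
  have "\<one> \<notin> inversions w" for w
  proof
    assume a: "\<one> \<in> inversions w"
    hence "w \<in> carrier G" by (auto simp: inversions_def)
    thus False using a inversion_shorter[of w \<one>] by simp
  qed
  thus ?thesis using ord.min_reps_iff generate_empty_eq by auto
qed

text \<open>
  The chain property for \<open>J = \<emptyset>\<close>: Bruhat order is graded by length.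
\<close>

lemma bruhat_cover_iff: "bruhat_cover G S u a \<longleftrightarrow> le u a \<and> len a = Suc (len u)"
proof
  assume "bruhat_cover G S u a"
  hence *: "le u a" "u \<noteq> a" "\<And>z. le u z \<Longrightarrow> u \<noteq> z \<Longrightarrow> le z a \<Longrightarrow> z = a"
    by (auto simp: bruhat_cover_def bruhat_less_def)
  have "u \<in> carrier G" "a \<in> carrier G" using * le_closed by auto
  then obtain b where b: "len b = Suc (len u)" "le u b" "le b a"
    using ord.min_rep_chain[of u a] * by auto
  moreover have "u \<noteq> b" using b by auto
  ultimately have "b = a" using *(3)[of b] by auto
  thus "le u a \<and> len a = Suc (len u)" using * b by simp
next
  assume *: "le u a \<and> len a = Suc (len u)"
  have "z = u \<or> z = a" if "le u z" "le z a" for z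
  proof -
    have "len z = len u \<or> len z = len a"
      using le_len[OF that(1)] le_len[OF that(2)] * by linarith
    thus ?thesis using le_len[OF that(1)] le_len[OF that(2)] by metis
  qed
  moreover have "u \<noteq> a" using * by auto
  ultimately show "bruhat_cover G S u a"
    using * unfolding bruhat_cover_def bruhat_less_def by blast
qed

end

context parabolic
begin

text \<open>
  If \<open>a \<le> u z\<close> for an element \<open>a\<close> of \<open>A\<^sup>J\<close>, then \<open>a \<le> u\<close> by \<open>le_min_rep\<close>, which is absurd. Conversely let
  \<open>y = p z\<close> with \<open>p \<in> W\<^sup>J\<close> different from \<open>u\<close>. Then \<open>u < p\<close>, again by \<open>le_min_rep\<close>, and the chain
  property provides an element of \<open>A\<^sup>J\<close> below \<open>p\<close>.
\<close>

lemma coset_in_interval_iff: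
  assumes "u \<in> MJ" "v \<in> MJ" "le u y" "le y v"
  shows "(\<exists>z\<in>WJ. y = u \<otimes> z) \<longleftrightarrow> (\<forall>a\<in>par_atoms G S J u v. \<not> le a y)"
proof
  assume "\<exists>z\<in>WJ. y = u \<otimes> z"
  then obtain z where z: "z \<in> WJ" "y = u \<otimes> z" by blast
  show "\<forall>a\<in>par_atoms G S J u v. \<not> le a y"
  proof (intro ballI notI)
    fix a assume a: "a \<in> par_atoms G S J u v" "le a y"
    hence "a \<in> MJ" "len a = Suc (len u)" by (auto simp: par_atoms_def bruhat_cover_iff)
    hence "le a u" using le_min_rep z a assms by blast
    thus False using le_len \<open>len a = Suc (len u)\<close> by fastforce
  qed
next
  assume no: "\<forall>a\<in>par_atoms G S J u v. \<not> le a y"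
  obtain p z where pz: "p \<in> MJ" "z \<in> WJ" "y = p \<otimes> z"
    using coset_decomposition assms le_closed by blast
  have up: "le u p" using le_min_rep[of z u p] pz assms by blast
  have "u = p"
  proof (rule ccontr)
    assume "u \<noteq> p"
    then obtain a where a: "a \<in> MJ" "len a = Suc (len u)" "le u a" "le a p"
      using min_rep_chain[of u p] up pz assms by blast
    have "le p y" using min_rep_le pz by simp
    hence "le a y" "le a v" using a assms le_trans by blast+
    hence "a \<in> par_atoms G S J u v" using a by (simp add: par_atoms_def bruhat_cover_iff)
    thus False using no \<open>le a y\<close> by blast
  qed
  thus "\<exists>z\<in>WJ. y = u \<otimes> z" using pz by blast
qed

end

section \<open>Hecke operators and R-polynomials\<close>

context coxeter_system
begin

text \<open>
  If \<open>s v < v\<close>, this operator turns the column \<open>R(\<cdot>, s v)\<close> into the column \<open>R(\<cdot>, v)\<close>.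
\<close>

definition R_left :: "'a \<Rightarrow> ('a \<Rightarrow> int poly) \<Rightarrow> 'a \<Rightarrow> int poly" where
  "R_left s f u = (if ldesc s u then f (s \<otimes> u) else (q_var - 1) * f u + q_var * f (s \<otimes> u))"

text \<open>
  By the Hecke relation this is \<open>q\<close> times the inverse of \<open>R_left s\<close>. In contrast to \<open>R_left\<close>, the
  product of these operators along a reduced word is easy to evaluate at the identity, by
  \<open>foldr_K_left_eval_additive\<close>.
\<close>

definition K_left :: "'a \<Rightarrow> ('a \<Rightarrow> int poly) \<Rightarrow> 'a \<Rightarrow> int poly" where
  "K_left s f u = R_left s f u - (q_var - 1) * f u"

definition R_right :: "'a \<Rightarrow> ('a \<Rightarrow> int poly) \<Rightarrow> 'a \<Rightarrow> int poly" where
  "R_right r f u = (if len (u \<otimes> r) < len u then f (u \<otimes> r) else (q_var - 1) * f u + q_var * f (u \<otimes> r))"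

definition K_right :: "'a \<Rightarrow> ('a \<Rightarrow> int poly) \<Rightarrow> 'a \<Rightarrow> int poly" where
  "K_right r f u = R_right r f u - (q_var - 1) * f u"

text \<open>
  The operators only see the values of a function on the group, so identities between them hold
  up to this relation.
\<close>

definition agree :: "('a \<Rightarrow> int poly) \<Rightarrow> ('a \<Rightarrow> int poly) \<Rightarrow> bool" where
  "agree f g \<longleftrightarrow> (\<forall>u\<in>carrier G. f u = g u)"

lemma agreeI: "(\<And>u. u \<in> carrier G \<Longrightarrow> f u = g u) \<Longrightarrow> agree f g"
  by (simp add: agree_def)

lemma agreeD: "agree f g \<Longrightarrow> u \<in> carrier G \<Longrightarrow> f u = g u"
  by (simp add: agree_def)

lemma agree_refl [simp]: "agree f f"
  by (simp add: agree_def)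

lemma agree_trans [trans]: "agree f g \<Longrightarrow> agree g h \<Longrightarrow> agree f h"
  by (simp add: agree_def)

lemma R_left_cong: "agree f g \<Longrightarrow> s \<in> S \<Longrightarrow> agree (R_left s f) (R_left s g)"
  by (simp add: agree_def R_left_def)

lemma K_left_cong: "agree f g \<Longrightarrow> s \<in> S \<Longrightarrow> agree (K_left s f) (K_left s g)"
  by (simp add: agree_def R_left_def K_left_def)

lemma R_right_cong: "agree f g \<Longrightarrow> s \<in> S \<Longrightarrow> agree (R_right s f) (R_right s g)"
  by (simp add: agree_def R_right_def)

lemma R_left_smult: "R_left s (\<lambda>u. c * f u) = (\<lambda>u. c * R_left s f u)"
  by (rule ext) (simp add: R_left_def algebra_simps)

lemma K_left_smult: "K_left s (\<lambda>u. c * f u) = (\<lambda>u. c * K_left s f u)"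
  by (rule ext) (simp add: K_left_def R_left_smult algebra_simps)

lemma K_left_eval: 
  "K_left s f u = (if ldesc s u then f (s \<otimes> u) - (q_var - 1) * f u else q_var * f (s \<otimes> u))"
  by (simp add: K_left_def R_left_def)

lemma K_right_eval: 
  "K_right s f u = (if len (u \<otimes> s) < len u then f (u \<otimes> s) - (q_var - 1) * f u else q_var * f (u \<otimes> s))"
  by (simp add: K_right_def R_right_def)

lemma K_left_R_left: "s \<in> S \<Longrightarrow> u \<in> carrier G \<Longrightarrow> K_left s (R_left s f) u = q_var * f u"
  using len_gen_mult[of s u] by (auto simp: K_left_eval R_left_def algebra_simps)

lemma R_left_K_left: "s \<in> S \<Longrightarrow> u \<in> carrier G \<Longrightarrow> R_left s (K_left s f) u = q_var * f u"
  using len_gen_mult[of s u] by (auto simp: K_left_eval R_left_def algebra_simps)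

text \<open>
  If \<open>s u = u r\<close>, both operators involve the same two values and coincide at \<open>u\<close>. Otherwise descents on
  one side do not depend on the other side, and the operators act on separate coordinates.
\<close>

lemma K_left_K_right_commute:
  assumes "s \<in> S" "r \<in> S" "u \<in> carrier G"
  shows "K_left s (K_right r f) u = K_right r (K_left s f) u"
proof (cases "s \<otimes> u = u \<otimes> r")
  case True
  define a where "a = s \<otimes> u"
  have a: "u \<otimes> r = a" "s \<otimes> u = a" "s \<otimes> a = u" "a \<otimes> r = u"
    using True[symmetric] gen_cancel_right[of r u] gen_cancel_left[of s u] assms
    by (simp_all add: a_def)
  have "len a \<noteq> len u" using len_gen_mult[of s u] assms a by (cases "len a < len u") auto
  thus ?thesis by (auto simp: K_left_eval K_right_eval a algebra_simps)
next
  case False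
  have "s \<otimes> (u \<otimes> r) = s \<otimes> u \<otimes> r" using assms by (simp add: m_assoc)
  thus ?thesis using descent_parallel[OF assms False]
    by (simp add: K_left_eval K_right_eval algebra_simps)
qed

lemma R_left_R_right_commute:
  assumes "s \<in> S" "r \<in> S" "u \<in> carrier G"
  shows "R_left s (R_right r f) u = R_right r (R_left s f) u"
proof -
  define c where "c = q_var - 1"
  have R_left: "R_left s g = (\<lambda>u. K_left s g u + c * g u)" and R_right: "R_right r g = (\<lambda>u. K_right r g u + c * g u)"
    for g by (simp_all add: K_left_def K_right_def c_def)
  have add: "K_left s (\<lambda>u. g u + c * h u) u = K_left s g u + c * K_left s h u"
    "K_right r (\<lambda>u. g u + c * h u) u = K_right r g u + c * K_right r h u" for g h
    unfolding K_left_eval K_right_eval c_def[symmetric] by (simp_all add: algebra_simps)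
  show ?thesis
    unfolding R_left R_right add using K_left_K_right_commute[OF assms, of f] by (simp add: distrib_left)
qed

lemma foldr_R_left_cong: "agree f g \<Longrightarrow> ws \<in> lists S \<Longrightarrow> agree (foldr R_left ws f) (foldr R_left ws g)"
  by (induction ws) (simp_all add: R_left_cong)

lemma foldr_K_left_cong: "agree f g \<Longrightarrow> ws \<in> lists S \<Longrightarrow> agree (foldr K_left ws f) (foldr K_left ws g)"
  by (induction ws) (simp_all add: K_left_cong)

lemma foldr_R_left_smult: "foldr R_left ws (\<lambda>u. c * f u) = (\<lambda>u. c * foldr R_left ws f u)"
  by (induction ws) (simp_all add: R_left_smult)

lemma foldr_K_left_smult: "foldr K_left ws (\<lambda>u. c * f u) = (\<lambda>u. c * foldr K_left ws f u)"
  by (induction ws) (simp_all add: K_left_smult)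

lemma len_word_mult_le:
  assumes "ws \<in> lists S" "u \<in> carrier G"
  shows "len (inv (wprod ws) \<otimes> u) \<le> len u + length ws"
  using assms
proof (induction ws arbitrary: u)
  case (Cons s ws)
  have "inv (wprod (s # ws)) \<otimes> u = inv (wprod ws) \<otimes> (s \<otimes> u)"
    using Cons by (simp add: inv_mult_group m_assoc)
  moreover have "len (s \<otimes> u) \<le> len u + 1"
    using len_gen_mult[of s u] Cons by (cases "ldesc s u") auto
  moreover have "len (inv (wprod ws) \<otimes> (s \<otimes> u)) \<le> len (s \<otimes> u) + length ws"
    using Cons.IH[of "s \<otimes> u"] Cons by simp
  ultimately show ?case by simp
qed simp

text \<open>
  Along a chain of ascents only the branch \<open>q f(s u)\<close> of \<open>K_left\<close> is used.
\<close>

lemma foldr_K_left_eval_additive: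
  assumes "ws \<in> lists S" "u \<in> carrier G" "len (inv (wprod ws) \<otimes> u) = len u + length ws"
  shows "foldr K_left ws f u = q_var ^ length ws * f (inv (wprod ws) \<otimes> u)"
  using assms
proof (induction ws arbitrary: u)
  case (Cons s ws)
  have eq: "inv (wprod (s # ws)) \<otimes> u = inv (wprod ws) \<otimes> (s \<otimes> u)"
    using Cons by (simp add: inv_mult_group m_assoc)
  have b: "len (inv (wprod ws) \<otimes> (s \<otimes> u)) \<le> len (s \<otimes> u) + length ws"
    using len_word_mult_le[of ws "s \<otimes> u"] Cons by simp
  hence up: "len (s \<otimes> u) = Suc (len u)" "\<not> ldesc s u"
    using len_gen_mult[of s u] Cons unfolding eq by auto
  have "foldr K_left ws f (s \<otimes> u) = q_var ^ length ws * f (inv (wprod ws) \<otimes> (s \<otimes> u))"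
    using Cons up unfolding eq by (intro Cons.IH) auto
  thus ?case unfolding eq using up K_left_eval[of s "foldr K_left ws f" u] by simp
qed simp

lemma foldr_K_left_K_right_commute:
  assumes "ws \<in> lists S" "r \<in> S"
  shows "agree (foldr K_left ws (K_right r f)) (K_right r (foldr K_left ws f))"
  using assms(1)
proof (induction ws)
  case (Cons s ws)
  have "agree (K_left s (foldr K_left ws (K_right r f))) (K_left s (K_right r (foldr K_left ws f)))"
    using Cons by (intro K_left_cong) auto
  also have "agree (K_left s (K_right r (foldr K_left ws f))) (K_right r (K_left s (foldr K_left ws f)))"
    using Cons assms by (intro agreeI K_left_K_right_commute) auto
  finally show ?case by simp
qed simp

lemma foldr_R_left_R_right_commute:
  assumes "ws \<in> lists S" "r \<in> S"
  shows "agree (foldr R_left ws (R_right r f)) (R_right r (foldr R_left ws f))"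
  using assms(1)
proof (induction ws)
  case (Cons s ws)
  have "agree (R_left s (foldr R_left ws (R_right r f))) (R_left s (R_right r (foldr R_left ws f)))"
    using Cons by (intro R_left_cong) auto
  also have "agree (R_left s (R_right r (foldr R_left ws f))) (R_right r (R_left s (foldr R_left ws f)))"
    using Cons assms by (intro agreeI R_left_R_right_commute) auto
  finally show ?case by simp
qed simp

definition reduced :: "'a list \<Rightarrow> bool" where
  "reduced ws \<longleftrightarrow> ws \<in> lists S \<and> length ws = len (wprod ws)"

text \<open>
  At the identity the value is \<open>q\<^bsup>\<ell>(w)\<^esup> f(w\<^sup>-\<^sup>1)\<close> for every reduced word of \<open>w\<close>. The value of a function
  \<open>g\<close> at \<open>u\<close> is, up to the factor \<open>q\<close>, the value of \<open>K_right r g\<close> at the shorter element \<open>u r\<close>, and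
  right operators commute with left ones; so independence spreads from the identity to \<open>W\<close>.
\<close>

lemma foldr_K_left_independent:
  assumes "reduced ws" "reduced ws'" "wprod ws = wprod ws'"
  shows "agree (foldr K_left ws f) (foldr K_left ws' f)"
proof (rule agreeI)
  fix u assume "u \<in> carrier G"
  thus "foldr K_left ws f u = foldr K_left ws' f u"
  proof (induction "len u" arbitrary: u f rule: less_induct)
    case less
    have ws: "ws \<in> lists S" "ws' \<in> lists S" "length ws = length ws'"
      using assms by (auto simp: reduced_def)
    show ?case
    proof (cases "u = \<one>")
      case True
      have "foldr K_left us f \<one> = q_var ^ length us * f (inv (wprod us))" if "reduced us" for us
        using foldr_K_left_eval_additive[of us \<one> f] that by (auto simp: reduced_def)
      from this[OF assms(1)] this[OF assms(2)] show ?thesis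
        unfolding True assms(3) ws(3) by metis
    next
      case False
      then obtain r where r: "r \<in> S" "len (r \<otimes> inv u) < len (inv u)"
        using left_descent_exists[of "inv u"] less by auto
      have "r \<otimes> inv u = inv (u \<otimes> r)" using r less by (simp add: inv_mult_group)
      hence lt: "len (u \<otimes> r) < len u" using r less by simp
      have K_right: "K_right r g (u \<otimes> r) = q_var * g u" for g
        using lt r less by (simp add: K_right_eval)
      have c: "u \<otimes> r \<in> carrier G" using r less by simp
      have "q_var * foldr K_left ws f u = foldr K_left ws (K_right r f) (u \<otimes> r)"
        using agreeD[OF foldr_K_left_K_right_commute[OF ws(1) r(1), of f] c] K_right by simp
      also have "\<dots> = foldr K_left ws' (K_right r f) (u \<otimes> r)"
        using less.hyps[OF lt c] .
      also have "\<dots> = q_var * foldr K_left ws' f u"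
        using agreeD[OF foldr_K_left_K_right_commute[OF ws(2) r(1), of f] c] K_right by simp
      finally show ?thesis by simp
    qed
  qed
qed

lemma foldr_K_left_R_left:
  assumes "ws \<in> lists S"
  shows "agree (foldr K_left (rev ws) (foldr R_left ws f)) (\<lambda>u. q_var ^ length ws * f u)"
  using assms
proof (induction ws)
  case (Cons s ws)
  have "agree (K_left s (R_left s (foldr R_left ws f))) (\<lambda>u. q_var * foldr R_left ws f u)"
    using Cons by (intro agreeI K_left_R_left) auto
  hence "agree (foldr K_left (rev ws) (K_left s (R_left s (foldr R_left ws f))))
      (foldr K_left (rev ws) (\<lambda>u. q_var * foldr R_left ws f u))"
    using Cons by (intro foldr_K_left_cong) auto
  hence "agree (foldr K_left (rev ws) (K_left s (R_left s (foldr R_left ws f))))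
      (\<lambda>u. q_var * foldr K_left (rev ws) (foldr R_left ws f) u)"
    unfolding foldr_K_left_smult .
  thus ?case using Cons by (simp add: agree_def)
qed simp

lemma foldr_R_left_K_left:
  assumes "ws \<in> lists S"
  shows "agree (foldr R_left ws (foldr K_left (rev ws) f)) (\<lambda>u. q_var ^ length ws * f u)"
  using assms
proof (induction ws arbitrary: f)
  case (Cons s ws)
  have "agree (R_left s (foldr R_left ws (foldr K_left (rev ws) (K_left s f))))
      (R_left s (\<lambda>u. q_var ^ length ws * K_left s f u))"
    using Cons by (intro R_left_cong) auto
  also have "agree (R_left s (\<lambda>u. q_var ^ length ws * K_left s f u)) (\<lambda>u. q_var ^ length (s # ws) * f u)"
    unfolding R_left_smult using Cons R_left_K_left[of s _ f] by (simp add: agree_def mult.left_commute)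
  finally show ?case by simp
qed simp

text \<open>
  The operator of a word in \<open>R_left\<close> is, up to a power of \<open>q\<close>, the inverse of the operator of the
  reversed word in \<open>K_left\<close>.
\<close>

lemma foldr_R_left_independent:
  assumes "reduced ws" "reduced ws'" "wprod ws = wprod ws'"
  shows "agree (foldr R_left ws f) (foldr R_left ws' f)"
proof -
  have ws: "ws \<in> lists S" "ws' \<in> lists S" "length ws = length ws'"
    using assms by (auto simp: reduced_def)
  let ?g = "foldr R_left ws' f" and ?c = "q_var ^ length ws"
  have "agree (foldr K_left (rev ws) ?g) (foldr K_left (rev ws') ?g)"
    using assms ws by (intro foldr_K_left_independent) (auto simp: reduced_def word_prod_rev)
  also have "agree (foldr K_left (rev ws') ?g) (\<lambda>u. ?c * f u)"
    using foldr_K_left_R_left[OF ws(2), of f] ws by simp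
  finally have "agree (foldr R_left ws (foldr K_left (rev ws) ?g)) (foldr R_left ws (\<lambda>u. ?c * f u))"
    using ws by (intro foldr_R_left_cong) auto
  moreover have "agree (foldr R_left ws (foldr K_left (rev ws) ?g)) (\<lambda>u. ?c * ?g u)"
    using foldr_R_left_K_left ws by blast
  ultimately have "agree (\<lambda>u. ?c * ?g u) (\<lambda>u. ?c * foldr R_left ws f u)"
    by (simp add: agree_def foldr_R_left_smult)
  thus ?thesis by (auto simp: agree_def)
qed

definition delta :: "'a \<Rightarrow> int poly" where
  "delta u = (if u = \<one> then 1 else 0)"

definition Rpoly :: "'a \<Rightarrow> 'a \<Rightarrow> int poly" where
  "Rpoly u v = (if u \<in> carrier G \<and> v \<in> carrier G
     then foldr R_left (SOME ws. reduced ws \<and> wprod ws = v) delta u else 0)"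

lemma Rpoly_word:
  assumes "reduced ws" "wprod ws = v" "u \<in> carrier G"
  shows "Rpoly u v = foldr R_left ws delta u"
proof -
  let ?ws = "SOME ws. reduced ws \<and> wprod ws = v"
  have "reduced ?ws \<and> wprod ?ws = v" using someI[of "\<lambda>ws. reduced ws \<and> wprod ws = v" ws] assms by blast
  hence "agree (foldr R_left ?ws delta) (foldr R_left ws delta)"
    using assms by (intro foldr_R_left_independent) auto
  moreover have "v \<in> carrier G" using assms by (auto simp: reduced_def)
  ultimately show ?thesis using assms by (simp add: Rpoly_def agree_def)
qed

lemma Rpoly_one: "u \<in> carrier G \<Longrightarrow> Rpoly u \<one> = delta u"
  using Rpoly_word[of "[]" \<one> u] by (simp add: reduced_def)

lemma Rpoly_left:
  assumes "s \<in> S" "v \<in> carrier G" "ldesc s v" "u \<in> carrier G"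
  shows "Rpoly u v = R_left s (\<lambda>w. Rpoly w (s \<otimes> v)) u"
proof -
  have "s \<otimes> v \<in> carrier G" using assms by simp
  then obtain ws where ws: "ws \<in> lists S" "wprod ws = s \<otimes> v" "length ws = len (s \<otimes> v)"
    using reduced_word_exists by blast
  have r1: "reduced ws" using ws by (simp add: reduced_def)
  have w: "wprod (s # ws) = v" using ws assms by simp
  have r2: "reduced (s # ws)" 
    unfolding reduced_def w using ws assms len_gen_mult(1)[of s v] by simp
  have "agree (R_left s (\<lambda>w. Rpoly w (s \<otimes> v))) (R_left s (foldr R_left ws delta))"
    using assms Rpoly_word[OF r1 ws(2)] by (intro R_left_cong agreeI) auto
  thus ?thesis using Rpoly_word[OF r2 w] assms by (simp add: agree_def)
qed

text \<open>
  On the column of the identity left and right operators agree, and a right operator can be moved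
  in front of all the left ones.
\<close>

lemma Rpoly_right:
  assumes "r \<in> S" "v \<in> carrier G" "len v < len (v \<otimes> r)" "u \<in> carrier G"
  shows "Rpoly u (v \<otimes> r) = R_right r (\<lambda>w. Rpoly w v) u"
proof -
  obtain ws where ws: "ws \<in> lists S" "wprod ws = v" "length ws = len v"
    using reduced_word_exists[OF assms(2)] .
  have r1: "reduced ws" using ws by (simp add: reduced_def)
  have w: "wprod (ws @ [r]) = v \<otimes> r" using ws assms by simp
  have r2: "reduced (ws @ [r])" 
    unfolding reduced_def w using ws assms len_mult_gen(2)[of r v] by simp
  have d: "agree (R_left r delta) (R_right r delta)"
  proof (rule agreeI)
    fix u assume u: "u \<in> carrier G"
    have "r \<otimes> u = \<one> \<longleftrightarrow> u = r" using assms(1) u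
      by (metis gen_cancel_left gen_square r_one gen_closed)
    moreover have "u \<otimes> r = \<one> \<longleftrightarrow> u = r" using assms(1) u
      by (metis gen_cancel_right gen_square l_one gen_closed)
    ultimately show "R_left r delta u = R_right r delta u"
      using assms gen_neq_one[of r] by (cases "u = \<one>"; cases "u = r") (auto simp: R_left_def R_right_def delta_def)
  qed
  have "agree (foldr R_left (ws @ [r]) delta) (foldr R_left ws (R_right r delta))"
    using foldr_R_left_cong[OF d ws(1)] by simp
  also have "agree (foldr R_left ws (R_right r delta)) (R_right r (foldr R_left ws delta))"
    using foldr_R_left_R_right_commute ws assms by blast
  also have "agree (R_right r (foldr R_left ws delta)) (R_right r (\<lambda>w. Rpoly w v))"
    using assms Rpoly_word[OF r1 ws(2)] by (intro R_right_cong agreeI) auto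
  finally show ?thesis using Rpoly_word[OF r2 w] assms by (simp add: agree_def)
qed

lemma Rpoly_support: "Rpoly u v \<noteq> 0 \<Longrightarrow> le u v"
proof (induction "len v" arbitrary: u v rule: less_induct)
  case less
  have c: "u \<in> carrier G" "v \<in> carrier G" using less by (auto simp: Rpoly_def split: if_splits)
  show ?case
  proof (cases "v = \<one>")
    case True
    thus ?thesis using Rpoly_one[of u] less c by (auto simp: delta_def split: if_splits)
  next
    case False
    then obtain s where s: "s \<in> S" "ldesc s v" using left_descent_exists c by blast
    have "Rpoly u (s \<otimes> v) \<noteq> 0 \<or> Rpoly (s \<otimes> u) (s \<otimes> v) \<noteq> 0"
      using Rpoly_left[of s v u] s c less.prems by (auto simp: R_left_def split: if_splits)
    moreover have sv: "\<not> len (s \<otimes> (s \<otimes> v)) < len (s \<otimes> v)" using s c by simp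
    have "le (s \<otimes> v) v" using gen_mult_le s c by blast
    ultimately show ?thesis
    proof (elim disjE)
      assume "Rpoly u (s \<otimes> v) \<noteq> 0"
      thus ?thesis using less.hyps s \<open>le (s \<otimes> v) v\<close> le_trans by blast
    next
      assume "Rpoly (s \<otimes> u) (s \<otimes> v) \<noteq> 0"
      hence "le (s \<otimes> u) (s \<otimes> v)" using less.hyps s by blast
      hence "le (s \<otimes> (s \<otimes> u)) (s \<otimes> (s \<otimes> v))" using lift_mult sv s by blast
      thus ?thesis using s c by simp
    qed
  qed
qed

lemma Rpoly_self: "v \<in> carrier G \<Longrightarrow> Rpoly v v = 1"
proof (induction "len v" arbitrary: v rule: less_induct)
  case less
  show ?case
  proof (cases "v = \<one>")
    case True
    thus ?thesis by (simp add: Rpoly_one delta_def)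
  next
    case False
    then obtain s where s: "s \<in> S" "ldesc s v" using left_descent_exists less by blast
    thus ?thesis using Rpoly_left[of s v v] less by (simp add: R_left_def)
  qed
qed

lemma Rpoly_degree: "le u v \<Longrightarrow> degree (Rpoly u v) + len u \<le> len v"
proof (induction "len v" arbitrary: u v rule: less_induct)
  case less
  have c: "u \<in> carrier G" "v \<in> carrier G" using less le_closed by auto
  show ?case
  proof (cases "v = \<one>")
    case True
    hence "u = \<one>" using le_one less by blast
    thus ?thesis using Rpoly_self[of \<one>] True by simp
  next
    case False
    then obtain s where s: "s \<in> S" "ldesc s v" using left_descent_exists c by blast
    have lv: "Suc (len (s \<otimes> v)) = len v" using len_gen_mult s c by simp
    have luv: "len u \<le> len v" using le_len less by blast
    show ?thesis
    proof (cases "ldesc s u")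
      case True
      hence "Rpoly u v = Rpoly (s \<otimes> u) (s \<otimes> v)"
        using Rpoly_left[of s v u] s c by (simp add: R_left_def)
      moreover have "degree (Rpoly (s \<otimes> u) (s \<otimes> v)) + len (s \<otimes> u) \<le> len (s \<otimes> v)"
        using lift_both less True s by blast
      ultimately show ?thesis using len_gen_mult(1)[of s u] True s c lv by simp
    next
      case False
      let ?A = "Rpoly u (s \<otimes> v)" and ?B = "Rpoly (s \<otimes> u) (s \<otimes> v)"
      have lu: "len (s \<otimes> u) = Suc (len u)" using len_gen_mult(2)[of s u] False s c by simp
      have eq: "Rpoly u v = (q_var - 1) * ?A + q_var * ?B"
        using Rpoly_left[of s v u] s c False by (simp add: R_left_def)
      have "degree ?A + len u \<le> len (s \<otimes> v)" using lift_down less False s by blast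
      moreover have "degree ((q_var - 1) * ?A) \<le> 1 + degree ?A"
        by (rule order.trans[OF degree_mult_le]) (simp add: one_pCons)
      ultimately have dA: "degree ((q_var - 1) * ?A) + len u \<le> len v" using lv by simp
      have dB: "degree (q_var * ?B) + len u \<le> len v"
      proof (cases "?B = 0")
        case True
        thus ?thesis using luv by simp
      next
        case False
        hence "degree ?B + len (s \<otimes> u) \<le> len (s \<otimes> v)" using Rpoly_support less s by blast
        moreover have "degree (q_var * ?B) \<le> 1 + degree ?B"
          by (rule order.trans[OF degree_mult_le]) simp
        ultimately show ?thesis using lv lu by simp
      qed
      show ?thesis using dA dB degree_add_le_max[of "(q_var - 1) * ?A" "q_var * ?B"]
        unfolding eq by linarith
    qed
  qed
qed

end

section \<open>Reversal of polynomials and weighted involutions\<close>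

lemma coeff_q_reverse:
  assumes "degree p \<le> n"
  shows "coeff (q_reverse n p) i = (if i \<le> n then coeff p (n - i) else 0)"
proof -
  have "q_reverse n p = monom 1 (n - degree p) * reflect_poly p"
    by (simp add: q_reverse_def monom_altdef)
  hence "coeff (q_reverse n p) i =
      (if n - degree p \<le> i then coeff (reflect_poly p) (i - (n - degree p)) else 0)"
    by (simp add: coeff_monom_mult)
  also have "\<dots> = (if i \<le> n then coeff p (n - i) else 0)"
    using assms by (auto simp: coeff_reflect_poly coeff_eq_0 diff_diff_right intro!: arg_cong[where f = "coeff p"])
  finally show ?thesis .
qed

lemma degree_q_reverse: "degree p \<le> n \<Longrightarrow> degree (q_reverse n p) \<le> n"
  by (rule degree_le) (simp add: coeff_q_reverse)

lemma q_reverse_0 [simp]: "q_reverse n 0 = 0"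
  by (simp add: q_reverse_def)

lemma q_reverse_1 [simp]: "q_reverse 0 1 = 1"
  by (simp add: q_reverse_def)

lemma q_reverse_add:
  "degree p \<le> n \<Longrightarrow> degree r \<le> n \<Longrightarrow> q_reverse n (p + r) = q_reverse n p + q_reverse n r"
  by (rule poly_eqI) (simp add: coeff_q_reverse degree_add_le)

lemma q_reverse_sum:
  "(\<And>a. a \<in> A \<Longrightarrow> degree (f a) \<le> n) \<Longrightarrow> q_reverse n (sum f A) = (\<Sum>a\<in>A. q_reverse n (f a))"
  by (induction A rule: infinite_finite_induct)
    (simp_all add: q_reverse_add degree_sum_le)

lemma q_reverse_mult:
  assumes "degree p \<le> m" "degree r \<le> n"
  shows "q_reverse (m + n) (p * r) = q_reverse m p * q_reverse n r"
proof (cases "p = 0 \<or> r = 0")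
  case False
  hence "m + n - degree (p * r) = (m - degree p) + (n - degree r)"
    using assms by (simp add: degree_mult_eq)
  thus ?thesis by (simp add: q_reverse_def reflect_poly_mult power_add mult_ac)
qed auto

lemma q_reverse_q_reverse: "degree p \<le> n \<Longrightarrow> q_reverse n (q_reverse n p) = p"
  by (rule poly_eqI) (auto simp: coeff_q_reverse degree_q_reverse coeff_eq_0)

lemma q_reverse_linear:
  assumes "degree p \<le> n" "degree c \<le> 1"
  shows "q_reverse (Suc n) (c * p) = q_reverse 1 c * q_reverse n p"
  using q_reverse_mult[of c 1 p n] assms by simp

lemma q_reverse_power:
  assumes "degree c \<le> 1" "degree p \<le> n"
  shows "degree (c ^ k * p) \<le> k + n" "q_reverse (k + n) (c ^ k * p) = q_reverse 1 c ^ k * q_reverse n p"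
proof (induction k)
  case (Suc k)
  {
    case 1
    have "degree (c * (c ^ k * p)) \<le> degree c + degree (c ^ k * p)" by (rule degree_mult_le)
    thus ?case using Suc assms(1) by (simp add: mult.assoc)
  next
    case 2
    have "q_reverse (Suc (k + n)) (c * (c ^ k * p)) = q_reverse 1 c * q_reverse (k + n) (c ^ k * p)"
      using Suc(1) assms(1) by (rule q_reverse_linear)
    thus ?case unfolding Suc(2) by (simp only: power_Suc add_Suc mult.assoc)
  }
qed (use assms in simp_all)

lemma q_reverse_pad: "degree p \<le> n \<Longrightarrow> q_reverse (Suc n) p = q_var * q_reverse n p"
  by (simp add: q_reverse_def Suc_diff_le)

lemma q_reverse_linear_poly: "q_reverse (Suc 0) [:a, b:] = [:b, a:]"
  by (rule poly_eqI) (simp add: coeff_q_reverse coeff_pCons split: nat.split)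

lemma q_reverse_1_values [simp]:
  "q_reverse (Suc 0) 1 = q_var" "q_reverse (Suc 0) q_var = 1"
  "q_reverse (Suc 0) (q_var - 1) = 1 - q_var" "q_reverse (Suc 0) (- q_var) = - 1"
  using q_reverse_linear_poly[of 1 0] q_reverse_linear_poly[of 0 1]
    q_reverse_linear_poly[of "-1" 1] q_reverse_linear_poly[of 0 "-1"]
  by (simp_all add: one_pCons)

lemma sum_involution:
  fixes h :: "'b \<Rightarrow> 'c::comm_monoid_add"
  assumes "finite A" "\<And>z. z \<in> A \<Longrightarrow> \<sigma> z \<in> A" "\<And>z. z \<in> A \<Longrightarrow> \<sigma> (\<sigma> z) = z"
    and "\<And>z. z \<in> A \<Longrightarrow> P (\<sigma> z) \<longleftrightarrow> \<not> P z"
  shows "sum h A = (\<Sum>z\<in>{z \<in> A. P z}. h z + h (\<sigma> z))"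
proof -
  have "sum h A = sum h {z \<in> A. P z} + sum h {z \<in> A. \<not> P z}"
    using assms(1) by (subst sum.union_disjoint[symmetric]) (auto intro: sum.cong)
  also have "sum h {z \<in> A. \<not> P z} = (\<Sum>z\<in>{z \<in> A. P z}. h (\<sigma> z))"
    using assms by (intro sum.reindex_bij_witness[of _ \<sigma> \<sigma>]) auto
  finally show ?thesis by (simp add: sum.distrib)
qed

text \<open>
  The two values \<open>-1\<close> and \<open>q\<close> of \<open>x\<close> are the roots of \<open>x\<^sup>2 = (q - 1) x + q\<close>, and their sum is \<open>q - 1\<close>.
\<close>

definition other_root :: "int poly \<Rightarrow> int poly" where "other_root x = q_var - 1 - x"

lemma other_root_quadratic: "x \<in> {-1, q_var} \<Longrightarrow> - x * other_root x = q_var"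
  by (auto simp: other_root_def)

lemma degree_other_root: "x \<in> {-1, q_var} \<Longrightarrow> degree (- x) \<le> 1"
  by auto

lemma q_reverse_x: "x \<in> {-1, q_var} \<Longrightarrow> q_reverse 1 (- x) = other_root x"
  using q_reverse_1_values(1) q_reverse_linear_poly[of 0 "-1"]
  by (auto simp: other_root_def) (simp add: one_pCons)

lemma q_reverse_x_power:
  assumes "x \<in> {-1, q_var}" "degree p \<le> n"
  shows "degree ((- x) ^ k * p) \<le> k + n" "q_reverse (k + n) ((- x) ^ k * p) = other_root x ^ k * q_reverse n p"
  using q_reverse_power[OF degree_other_root[OF assms(1)] assms(2), of k]
  by (simp_all only: q_reverse_x[OF assms(1)])

text \<open>
  On a pair \<open>{z, \<sigma> z}\<close> the map \<open>f \<mapsto> g\<close> is a Hecke operator, and the weights \<open>(-x)\<^bsup>l(z)\<^esup>\<close> form an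
  eigenvector of its transpose. Its eigenvalue is the root of the Hecke relation other than \<open>x\<close>.
\<close>

lemma twisted_sum_involution:
  fixes f g :: "'b \<Rightarrow> int poly" and l :: "'b \<Rightarrow> nat"
  assumes "finite A" "\<And>z. z \<in> A \<Longrightarrow> \<sigma> z \<in> A" "\<And>z. z \<in> A \<Longrightarrow> \<sigma> (\<sigma> z) = z"
    and up: "\<And>z. z \<in> A \<Longrightarrow> \<not> l (\<sigma> z) < l z \<Longrightarrow> l (\<sigma> z) = Suc (l z)"
    and g: "\<And>z. z \<in> A \<Longrightarrow>
      g z = (if l (\<sigma> z) < l z then f (\<sigma> z) else (q_var - 1) * f z + q_var * f (\<sigma> z))"
    and x: "x \<in> {-1, q_var}"
  shows "(\<Sum>z\<in>A. (- x) ^ l z * g z) = other_root x * (\<Sum>z\<in>A. (- x) ^ l z * f z)"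
proof -
  let ?U = "{z \<in> A. \<not> l (\<sigma> z) < l z}"
  have "l (\<sigma> (\<sigma> z)) < l (\<sigma> z) \<longleftrightarrow> \<not> l (\<sigma> z) < l z" if "z \<in> A" for z
    using up[OF that] assms(3)[OF that] by auto
  hence pairing: "sum h A = (\<Sum>z\<in>?U. h z + h (\<sigma> z))" for h :: "'b \<Rightarrow> int poly"
    using assms by (intro sum_involution) auto
  have pair: "(- x) ^ l z * g z + (- x) ^ l (\<sigma> z) * g (\<sigma> z) =
      other_root x * ((- x) ^ l z * f z + (- x) ^ l (\<sigma> z) * f (\<sigma> z))" if "z \<in> ?U" for z
  proof -
    have z: "z \<in> A" "l (\<sigma> z) = Suc (l z)" using that up by auto
    have gz: "g z = (q_var - 1) * f z + q_var * f (\<sigma> z)" "g (\<sigma> z) = f z"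
      using g[OF z(1)] g[OF assms(2)[OF z(1)]] z assms(3)[OF z(1)] by simp_all
    define c b where "c = other_root x" and "b = (- x) ^ l z"
    have c: "q_var - 1 = c + x" "q_var = - x * c"
      using other_root_quadratic[OF x] by (simp_all add: c_def other_root_def)
    have "(- x) ^ l z * g z + (- x) ^ l (\<sigma> z) * g (\<sigma> z) =
        b * ((c + x) * f z + (- x * c) * f (\<sigma> z)) + (- x * b) * f z"
      by (simp only: gz z(2) power_Suc b_def[symmetric] c(1), simp only: c(2))
    also have "\<dots> = c * (b * f z + (- x * b) * f (\<sigma> z))"
      by (simp add: algebra_simps)
    finally show ?thesis by (simp only: z(2) power_Suc b_def c_def)
  qed
  show ?thesis unfolding pairing sum_distrib_left by (intro sum.cong refl pair) 
qed

section \<open>Parabolic R-polynomials as weighted sums over cosets\<close>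

context parabolic
begin

text \<open>
  Restricting the sum to the support of \<open>f\<close> keeps it finite, for the functions of interest, when \<open>W\<^sub>J\<close>
  is infinite.
\<close>

definition coset_sum :: "int poly \<Rightarrow> 'a \<Rightarrow> ('a \<Rightarrow> int poly) \<Rightarrow> int poly" where
  "coset_sum x u f = (\<Sum>z | z \<in> WJ \<and> f (u \<otimes> z) \<noteq> 0. (- x) ^ len z * f (u \<otimes> z))"

lemma coset_sum_eq:
  assumes "finite A" "A \<subseteq> WJ" "\<And>z. z \<in> WJ \<Longrightarrow> f (u \<otimes> z) \<noteq> 0 \<Longrightarrow> z \<in> A"
  shows "coset_sum x u f = (\<Sum>z\<in>A. (- x) ^ len z * f (u \<otimes> z))"
  unfolding coset_sum_def using assms by (intro sum.mono_neutral_left) auto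

definition finite_supp :: "('a \<Rightarrow> int poly) \<Rightarrow> bool" where
  "finite_supp f \<longleftrightarrow> finite {y \<in> carrier G. f y \<noteq> 0}"

lemma inj_on_mult_left: "u \<in> carrier G \<Longrightarrow> inj_on ((\<otimes>) u) (carrier G)"
  by (rule inj_onI) simp

lemma finite_coset_preimage:
  assumes "u \<in> carrier G" "finite Y"
  shows "finite {z \<in> WJ. u \<otimes> z \<in> Y}"
proof -
  have "inj_on ((\<otimes>) u) {z \<in> WJ. u \<otimes> z \<in> Y}"
    using inj_on_mult_left[OF assms(1)] by (rule inj_on_subset) auto
  moreover have "(\<otimes>) u ` {z \<in> WJ. u \<otimes> z \<in> Y} \<subseteq> Y" by auto
  ultimately show ?thesis using assms inj_on_finite by blast
qed

lemma finite_supp_coset: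
  assumes "u \<in> carrier G" "finite_supp f"
  shows "finite {z \<in> WJ. f (u \<otimes> z) \<noteq> 0}"
proof -
  have "{z \<in> WJ. f (u \<otimes> z) \<noteq> 0} = {z \<in> WJ. u \<otimes> z \<in> {y \<in> carrier G. f y \<noteq> 0}}"
    using assms by auto
  thus ?thesis using finite_coset_preimage[OF assms(1) assms(2)[unfolded finite_supp_def]] by (rule ssubst)
qed

lemma coset_sum_cong:
  assumes "u \<in> carrier G" "agree f g"
  shows "coset_sum x u f = coset_sum x u g"
proof -
  have "f (u \<otimes> z) = g (u \<otimes> z)" if "z \<in> WJ" for z
    using assms that agreeD by simp
  thus ?thesis unfolding coset_sum_def by (intro sum.cong) auto
qed

lemma coset_sum_involution:
  assumes "u \<in> carrier G" "finite_supp f" "x \<in> {-1, q_var}"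
    and "\<And>z. z \<in> WJ \<Longrightarrow> \<sigma> z \<in> WJ" "\<And>z. z \<in> WJ \<Longrightarrow> \<sigma> (\<sigma> z) = z"
    and "\<And>z. z \<in> WJ \<Longrightarrow> \<not> len (\<sigma> z) < len z \<Longrightarrow> len (\<sigma> z) = Suc (len z)"
    and g: "\<And>z. z \<in> WJ \<Longrightarrow> g (u \<otimes> z) =
      (if len (\<sigma> z) < len z then f (u \<otimes> \<sigma> z) else (q_var - 1) * f (u \<otimes> z) + q_var * f (u \<otimes> \<sigma> z))"
  shows "coset_sum x u g = other_root x * coset_sum x u f"
proof -
  define B where "B = {z \<in> WJ. f (u \<otimes> z) \<noteq> 0}"
  \<comment> \<open>Closing the support under \<open>\<sigma>\<close> keeps the pairing inside the range of summation.\<close>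
  define A where "A = B \<union> \<sigma> ` B"
  have A: "finite A" "A \<subseteq> WJ" "\<And>z. z \<in> A \<Longrightarrow> \<sigma> z \<in> A"
    using finite_supp_coset[OF assms(1,2)] assms(4,5) by (auto simp: A_def B_def)
  have AW: "z \<in> WJ" if "z \<in> A" for z using A(2) that by blast
  have "coset_sum x u g = (\<Sum>z\<in>A. (- x) ^ len z * g (u \<otimes> z))"
  proof (rule coset_sum_eq[OF A(1,2)])
    fix z assume z: "z \<in> WJ" "g (u \<otimes> z) \<noteq> 0"
    hence "f (u \<otimes> z) \<noteq> 0 \<or> f (u \<otimes> \<sigma> z) \<noteq> 0" using g[OF z(1)] by (auto split: if_splits)
    hence "z \<in> B \<or> \<sigma> z \<in> B" using z assms(4) by (auto simp: B_def)
    moreover have "z = \<sigma> (\<sigma> z)" using assms(5) z by simp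
    ultimately show "z \<in> A" unfolding A_def by blast
  qed
  also have "\<dots> = other_root x * (\<Sum>z\<in>A. (- x) ^ len z * f (u \<otimes> z))"
    by (rule twisted_sum_involution[where \<sigma> = \<sigma>]) (use A(1,3) AW assms in blast)+
  also have "(\<Sum>z\<in>A. (- x) ^ len z * f (u \<otimes> z)) = coset_sum x u f"
    by (rule coset_sum_eq[OF A(1,2), symmetric]) (simp add: A_def B_def)
  finally show ?thesis .
qed

text \<open>
  A simple reflection \<open>s\<close> maps the coset \<open>u W\<^sub>J\<close> to a lower one, to a higher one, or to itself. In
  the last case it acts as left multiplication by some \<open>j \<in> W\<^sub>J\<close> on the \<open>W\<^sub>J\<close>-factor. These cases
  become the three clauses of the recursion for \<open>R\<^sup>J\<^sup>,\<^sup>x\<close>.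
\<close>

lemma coset_sum_R_left_down:
  assumes "u \<in> MJ" "s \<in> S" "ldesc s u"
  shows "coset_sum x u (R_left s f) = coset_sum x (s \<otimes> u) f"
proof -
  have su: "s \<otimes> u \<in> MJ" using gen_mult_min_rep_down assms by blast
  have "R_left s f (u \<otimes> z) = f (s \<otimes> u \<otimes> z)" if "z \<in> WJ" for z
    using len_min_rep_mult[OF su that] len_min_rep_mult[OF assms(1) that] assms that
    by (simp add: R_left_def m_assoc)
  thus ?thesis unfolding coset_sum_def by (intro sum.cong) auto
qed

lemma coset_sum_R_left_up:
  assumes "u \<in> MJ" "s \<in> S" "\<not> ldesc s u" "s \<otimes> u \<in> MJ" "finite_supp f"
  shows "coset_sum x u (R_left s f) = (q_var - 1) * coset_sum x u f + q_var * coset_sum x (s \<otimes> u) f"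
proof -
  define A where "A = {z \<in> WJ. f (u \<otimes> z) \<noteq> 0} \<union> {z \<in> WJ. f (s \<otimes> u \<otimes> z) \<noteq> 0}"
  have A: "finite A" "A \<subseteq> WJ"
    using finite_supp_coset[of u f] finite_supp_coset[of "s \<otimes> u" f] assms by (auto simp: A_def)
  have R_left: "R_left s f (u \<otimes> z) = (q_var - 1) * f (u \<otimes> z) + q_var * f (s \<otimes> u \<otimes> z)" if "z \<in> WJ" for z
    using len_min_rep_mult[OF assms(4) that] len_min_rep_mult[OF assms(1) that] assms that
    by (simp add: R_left_def m_assoc)
  have eqs: "coset_sum x u f = (\<Sum>z\<in>A. (- x) ^ len z * f (u \<otimes> z))"
    "coset_sum x (s \<otimes> u) f = (\<Sum>z\<in>A. (- x) ^ len z * f (s \<otimes> u \<otimes> z))"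
    using A by (auto intro!: coset_sum_eq simp: A_def)
  have "coset_sum x u (R_left s f) = (\<Sum>z\<in>A. (- x) ^ len z * R_left s f (u \<otimes> z))"
    using A R_left by (intro coset_sum_eq) (auto simp: A_def)
  also have "\<dots> = (\<Sum>z\<in>A. (q_var - 1) * ((- x) ^ len z * f (u \<otimes> z)) +
      q_var * ((- x) ^ len z * f (s \<otimes> u \<otimes> z)))"
  proof (rule sum.cong[OF refl])
    fix z assume "z \<in> A"
    hence "z \<in> WJ" using A by blast
    show "(- x) ^ len z * R_left s f (u \<otimes> z) =
      (q_var - 1) * ((- x) ^ len z * f (u \<otimes> z)) + q_var * ((- x) ^ len z * f (s \<otimes> u \<otimes> z))"
      unfolding R_left[OF \<open>z \<in> WJ\<close>] by (simp only: distrib_left mult.left_commute)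
  qed
  finally show ?thesis unfolding eqs by (simp only: sum.distrib sum_distrib_left)
qed

lemma coset_sum_R_left_fixed:
  assumes "u \<in> MJ" "s \<in> S" "s \<otimes> u \<notin> MJ" "finite_supp f" "x \<in> {-1, q_var}"
  shows "coset_sum x u (R_left s f) = other_root x * coset_sum x u f"
proof -
  define j where "j = inv u \<otimes> s \<otimes> u"
  have j: "j \<in> S" "j \<in> WJ" "s \<otimes> u = u \<otimes> j"
    using gen_mult_not_min_rep[OF assms(1-3)] by (simp_all add: j_def)
  have su: "s \<otimes> (u \<otimes> z) = u \<otimes> (j \<otimes> z)" if "z \<in> WJ" for z
    using j that assms by (metis MJ_closed WJ_closed gen_closed m_assoc)
  have lens: "len (s \<otimes> (u \<otimes> z)) = len u + len (j \<otimes> z)" "len (u \<otimes> z) = len u + len z" if "z \<in> WJ" for z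
    using len_min_rep_mult[OF assms(1)] su that WJ_mult j by simp_all
  show ?thesis
  proof (rule coset_sum_involution[where \<sigma> = "\<lambda>z. j \<otimes> z"])
    fix z assume z: "z \<in> WJ"
    show "R_left s f (u \<otimes> z) = (if ldesc j z then f (u \<otimes> (j \<otimes> z))
      else (q_var - 1) * f (u \<otimes> z) + q_var * f (u \<otimes> (j \<otimes> z)))"
      using lens[OF z] by (simp add: R_left_def su[OF z])
    show "j \<otimes> z \<in> WJ" using z j WJ_mult by blast
    show "j \<otimes> (j \<otimes> z) = z" using z j by simp
    show "\<not> ldesc j z \<Longrightarrow> len (j \<otimes> z) = Suc (len z)"
      using len_gen_mult(2)[OF j(1) WJ_closed[OF z]] .
  qed (use assms in auto)
qed

lemma coset_sum_R_right:
  assumes "u \<in> MJ" "j \<in> S" "j \<in> WJ" "finite_supp f" "x \<in> {-1, q_var}"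
  shows "coset_sum x u (R_right j f) = other_root x * coset_sum x u f"
proof (rule coset_sum_involution[where \<sigma> = "\<lambda>z. z \<otimes> j"])
  fix z assume z: "z \<in> WJ"
  show zj: "z \<otimes> j \<in> WJ" using z assms WJ_mult by blast
  show "R_right j f (u \<otimes> z) = (if len (z \<otimes> j) < len z then f (u \<otimes> (z \<otimes> j))
    else (q_var - 1) * f (u \<otimes> z) + q_var * f (u \<otimes> (z \<otimes> j)))"
    using len_min_rep_mult[OF assms(1) z] len_min_rep_mult[OF assms(1) zj] assms z
    by (simp add: R_right_def m_assoc)
  show "z \<otimes> j \<otimes> j = z" using z assms by simp
  show "\<not> len (z \<otimes> j) < len z \<Longrightarrow> len (z \<otimes> j) = Suc (len z)"
    using len_mult_gen(2)[OF assms(2) WJ_closed[OF z]] .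
qed (use assms in auto)

lemma finite_supp_Rpoly:
  assumes "v \<in> carrier G"
  shows "finite_supp (\<lambda>y. Rpoly y v)"
  unfolding finite_supp_def
  by (rule finite_subset[OF _ finite_below[OF assms]]) (use Rpoly_support in blast)

definition Rpar :: "int poly \<Rightarrow> 'a \<Rightarrow> 'a \<Rightarrow> int poly" where
  "Rpar x u v = (if u \<in> MJ \<and> v \<in> MJ then coset_sum x u (\<lambda>y. Rpoly y v) else 0)"

definition coset_below :: "'a \<Rightarrow> 'a \<Rightarrow> 'a set" where
  "coset_below u v = {z \<in> WJ. le (u \<otimes> z) v}"

lemma finite_coset_below: "u \<in> carrier G \<Longrightarrow> v \<in> carrier G \<Longrightarrow> finite (coset_below u v)"
  using finite_coset_preimage[of u "{y. le y v}"] finite_below by (simp add: coset_below_def)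

lemma coset_sum_Rpoly:
  assumes "u \<in> carrier G" "v \<in> carrier G" "le y v"
  shows "coset_sum x u (\<lambda>w. Rpoly w y) = (\<Sum>z\<in>coset_below u v. (- x) ^ len z * Rpoly (u \<otimes> z) y)"
proof (rule coset_sum_eq)
  show "finite (coset_below u v)" using assms finite_coset_below by blast
  show "coset_below u v \<subseteq> WJ" by (auto simp: coset_below_def)
  fix z assume "z \<in> WJ" "Rpoly (u \<otimes> z) y \<noteq> 0"
  thus "z \<in> coset_below u v"
    unfolding coset_below_def using Rpoly_support assms(3) le_trans by blast
qed

lemma Rpar_eq:
  "u \<in> MJ \<Longrightarrow> v \<in> MJ \<Longrightarrow> Rpar x u v = (\<Sum>z\<in>coset_below u v. (- x) ^ len z * Rpoly (u \<otimes> z) v)"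
  using coset_sum_Rpoly[of u v v] by (simp add: Rpar_def)

lemma Rpar_support: 
  assumes "Rpar x u v \<noteq> 0"
  shows "u \<in> MJ" "v \<in> MJ" "le u v"
proof -
  show uv: "u \<in> MJ" "v \<in> MJ" using assms by (auto simp: Rpar_def split: if_splits)
  have "coset_below u v \<noteq> {}" using Rpar_eq[OF uv] assms by force
  then obtain z where "z \<in> WJ" "le (u \<otimes> z) v" by (auto simp: coset_below_def)
  thus "le u v" using min_rep_le uv le_trans by blast
qed

lemma coset_below_self:
  assumes "u \<in> MJ"
  shows "coset_below u u = {\<one>}"
proof (intro equalityI subsetI)
  fix z assume "z \<in> coset_below u u"
  hence z: "z \<in> WJ" "le (u \<otimes> z) u" by (auto simp: coset_below_def)
  hence "len z = 0" using le_len[OF z(2)] len_min_rep_mult assms by simp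
  thus "z \<in> {\<one>}" using z by simp
qed (use assms in \<open>simp add: coset_below_def\<close>)

lemma Rpar_self: "u \<in> MJ \<Longrightarrow> Rpar x u u = 1"
  using Rpar_eq[of u u] coset_below_self Rpoly_self by simp

lemma Rpar_recursion:
  assumes "u \<in> MJ" "v \<in> MJ" "s \<in> S" "ldesc s v"
  shows "Rpar x u v = coset_sum x u (R_left s (\<lambda>w. Rpoly w (s \<otimes> v)))"
  using coset_sum_cong[of u "\<lambda>w. Rpoly w v" "R_left s (\<lambda>w. Rpoly w (s \<otimes> v))" x] assms Rpoly_left
  by (simp add: Rpar_def agree_def)

lemma is_R_family_Rpar:
  assumes "x \<in> {-1, q_var}"
  shows "is_R_family G S J x (Rpar x)"
  unfolding is_R_family_def
proof (intro conjI allI ballI impI)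
  fix u v assume "u \<notin> MJ \<or> v \<notin> MJ"
  thus "Rpar x u v = 0" by (auto simp: Rpar_def)
next
  fix u v assume "\<not> le u v"
  thus "Rpar x u v = 0" using Rpar_support by blast
next
  fix u v assume "u \<in> MJ" "u = v"
  thus "Rpar x u v = 1" using Rpar_self by blast
next
  fix u v s assume *: "u \<in> MJ" "v \<in> MJ" "s \<in> S" "ldesc s v" "ldesc s u"
  thus "Rpar x u v = Rpar x (s \<otimes> u) (s \<otimes> v)"
    using Rpar_recursion[OF *(1-4), of x] coset_sum_R_left_down[of u s x] gen_mult_min_rep_down
    by (simp add: Rpar_def)
next
  fix u v s assume *: "u \<in> MJ" "v \<in> MJ" "s \<in> S" "ldesc s v"
    and **: "len u < len (s \<otimes> u) \<and> s \<otimes> u \<in> MJ"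
  thus "Rpar x u v = (q_var - 1) * Rpar x u (s \<otimes> v) + q_var * Rpar x (s \<otimes> u) (s \<otimes> v)"
    using Rpar_recursion[OF *, of x] coset_sum_R_left_up[of u s "\<lambda>w. Rpoly w (s \<otimes> v)" x]
      gen_mult_min_rep_down[of v s] finite_supp_Rpoly[of "s \<otimes> v"]
    by (simp add: Rpar_def)
next
  fix u v s assume *: "u \<in> MJ" "v \<in> MJ" "s \<in> S" "ldesc s v"
    and **: "len u < len (s \<otimes> u) \<and> s \<otimes> u \<notin> MJ"
  have "s \<otimes> v \<in> MJ" using gen_mult_min_rep_down * by blast
  thus "Rpar x u v = (q_var - 1 - x) * Rpar x u (s \<otimes> v)"
    using Rpar_recursion[OF *, of x] * ** coset_sum_R_left_fixed[of u s "\<lambda>w. Rpoly w (s \<otimes> v)" x]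
      finite_supp_Rpoly[of "s \<otimes> v"] assms
    by (simp add: Rpar_def other_root_def)
qed

lemma is_R_familyD:
  assumes "is_R_family G S J x R"
  shows "u \<notin> MJ \<or> v \<notin> MJ \<Longrightarrow> R u v = 0"
    and "u \<in> MJ \<Longrightarrow> v \<in> MJ \<Longrightarrow> \<not> le u v \<Longrightarrow> R u v = 0"
    and "u \<in> MJ \<Longrightarrow> R u u = 1"
    and "u \<in> MJ \<Longrightarrow> v \<in> MJ \<Longrightarrow> s \<in> S \<Longrightarrow> ldesc s v \<Longrightarrow> ldesc s u \<Longrightarrow>
      R u v = R (s \<otimes> u) (s \<otimes> v)"
    and "u \<in> MJ \<Longrightarrow> v \<in> MJ \<Longrightarrow> s \<in> S \<Longrightarrow> ldesc s v \<Longrightarrow> len u < len (s \<otimes> u) \<Longrightarrow>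
      s \<otimes> u \<in> MJ \<Longrightarrow> R u v = (q_var - 1) * R u (s \<otimes> v) + q_var * R (s \<otimes> u) (s \<otimes> v)"
    and "u \<in> MJ \<Longrightarrow> v \<in> MJ \<Longrightarrow> s \<in> S \<Longrightarrow> ldesc s v \<Longrightarrow> len u < len (s \<otimes> u) \<Longrightarrow>
      s \<otimes> u \<notin> MJ \<Longrightarrow> R u v = (q_var - 1 - x) * R u (s \<otimes> v)"
  using assms unfolding is_R_family_def by blast+

text \<open>
  A left descent of \<open>v \<in> W\<^sup>J\<close> stays in \<open>W\<^sup>J\<close>, and the recursion reduces the column of \<open>v\<close> to a shorter
  one.
\<close>

lemma is_R_family_unique:
  assumes "is_R_family G S J x R" "is_R_family G S J x R'"
  shows "R = R'"
proof (intro ext)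
  fix u v
  show "R u v = R' u v"
  proof (cases "u \<in> MJ \<and> v \<in> MJ")
    case False
    thus ?thesis using is_R_familyD(1)[OF assms(1), of u v] is_R_familyD(1)[OF assms(2), of u v] by auto
  next
    case True
    hence "u \<in> MJ" "v \<in> MJ" by auto
    thus ?thesis
    proof (induction "len v" arbitrary: u v rule: less_induct)
      case less
      show ?case
      proof (cases "v = \<one>")
        case True
        show ?thesis
        proof (cases "u = v")
          case True
          thus ?thesis using is_R_familyD(3)[OF assms(1)] is_R_familyD(3)[OF assms(2)] less.prems by simp
        next
          case False
          hence "\<not> le u v" using le_one \<open>v = \<one>\<close> by blast
          thus ?thesis
            using is_R_familyD(2)[OF assms(1) less.prems] is_R_familyD(2)[OF assms(2) less.prems] by simp
        qed
      next
        case False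
        then obtain s where s: "s \<in> S" "ldesc s v"
          using left_descent_exists[of v] less.prems by auto
        have sv: "s \<otimes> v \<in> MJ" using gen_mult_min_rep_down less.prems s by blast
        have IH: "R w (s \<otimes> v) = R' w (s \<otimes> v)" if "w \<in> MJ" for w
          using less.hyps[OF s(2) that sv] .
        have up: "\<not> ldesc s u \<Longrightarrow> len u < len (s \<otimes> u)"
          using len_gen_mult(2)[of s u] s less by simp
        consider "ldesc s u" | "len u < len (s \<otimes> u)" "s \<otimes> u \<in> MJ"
          | "len u < len (s \<otimes> u)" "s \<otimes> u \<notin> MJ" using up by blast
        thus ?thesis
        proof cases
          case 1
          have "R u v = R (s \<otimes> u) (s \<otimes> v)" "R' u v = R' (s \<otimes> u) (s \<otimes> v)"
            using is_R_familyD(4)[OF assms(1) less.prems s 1]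
              is_R_familyD(4)[OF assms(2) less.prems s 1] .
          thus ?thesis using IH[OF gen_mult_min_rep_down[OF less.prems(1) s(1) 1]] by simp
        next
          case 2
          have "R u v = (q_var - 1) * R u (s \<otimes> v) + q_var * R (s \<otimes> u) (s \<otimes> v)"
              "R' u v = (q_var - 1) * R' u (s \<otimes> v) + q_var * R' (s \<otimes> u) (s \<otimes> v)"
            using is_R_familyD(5)[OF assms(1) less.prems s 2]
              is_R_familyD(5)[OF assms(2) less.prems s 2] .
          thus ?thesis using IH[OF 2(2)] IH[OF less.prems(1)] by (simp only:)
        next
          case 3
          have "R u v = (q_var - 1 - x) * R u (s \<otimes> v)" "R' u v = (q_var - 1 - x) * R' u (s \<otimes> v)"
            using is_R_familyD(6)[OF assms(1) less.prems s 3]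
              is_R_familyD(6)[OF assms(2) less.prems s 3] .
          thus ?thesis using IH[OF less.prems(1)] by (simp only:)
        qed
      qed
    qed
  qed
qed

lemma par_R_eq: "x \<in> {-1, q_var} \<Longrightarrow> par_R G S J x = Rpar x"
  unfolding par_R_def using is_R_family_Rpar is_R_family_unique by blast

text \<open>
  The column of \<open>v z\<close> arises from that of \<open>v\<close> by the right operators of the letters of \<open>z\<close>. Right
  multiplication by such a letter permutes \<open>u W\<^sub>J\<close>, so each letter contributes one eigenvalue.
\<close>

lemma coset_sum_Rpoly_coset:
  assumes "u \<in> MJ" "v \<in> MJ" "z \<in> WJ" "x \<in> {-1, q_var}"
  shows "coset_sum x u (\<lambda>y. Rpoly y (v \<otimes> z)) = other_root x ^ len z * Rpar x u v"
  using assms(3)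
proof (induction rule: WJ_induct)
  case one
  thus ?case using assms by (simp add: Rpar_def)
next
  case (mult z j)
  have lt: "len (v \<otimes> z) < len (v \<otimes> z \<otimes> j)"
    using mult assms len_min_rep_mult[of v z] len_min_rep_mult[of v "z \<otimes> j"] WJ_mult
    by (simp add: m_assoc)
  have "coset_sum x u (\<lambda>y. Rpoly y (v \<otimes> z \<otimes> j)) = coset_sum x u (R_right j (\<lambda>w. Rpoly w (v \<otimes> z)))"
    using Rpoly_right[OF _ _ lt] mult assms by (intro coset_sum_cong agreeI) auto
  also have "\<dots> = other_root x * coset_sum x u (\<lambda>y. Rpoly y (v \<otimes> z))"
    using mult assms finite_supp_Rpoly by (intro coset_sum_R_right) auto
  finally show ?case using mult assms by (simp add: m_assoc)
qed

text \<open>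
  A sum over a coset becomes a sum whose range and weights are visible in the poset \<open>[u,v]\<close> together
  with the set \<open>A\<^sup>J\<close>.
\<close>

lemma sum_interval_coset:
  assumes "u \<in> MJ" "v \<in> MJ" "le u v"
  shows "(\<Sum>y\<in>{y \<in> bruhat_interval G S u v. \<forall>a\<in>par_atoms G S J u v. \<not> le a y}. h (len y - len u) y) =
    (\<Sum>z\<in>coset_below u v. h (len z) (u \<otimes> z))"
proof -
  let ?Y = "{y \<in> bruhat_interval G S u v. \<forall>a\<in>par_atoms G S J u v. \<not> le a y}"
  have Y: "?Y = (\<otimes>) u ` coset_below u v"
  proof (intro equalityI subsetI)
    fix y assume "y \<in> ?Y"
    hence "le u y" "le y v" "\<forall>a\<in>par_atoms G S J u v. \<not> le a y"
      by (auto simp: bruhat_interval_def)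
    moreover from this obtain z where "z \<in> WJ" "y = u \<otimes> z"
      using coset_in_interval_iff[of u v y] assms by blast
    ultimately show "y \<in> (\<otimes>) u ` coset_below u v" by (auto simp: coset_below_def)
  next
    fix y assume "y \<in> (\<otimes>) u ` coset_below u v"
    then obtain z where z: "z \<in> WJ" "y = u \<otimes> z" "le y v" by (auto simp: coset_below_def)
    hence "le u y" using min_rep_le assms by blast
    thus "y \<in> ?Y" using coset_in_interval_iff[of u v y] z assms le_closed
      by (auto simp: bruhat_interval_def)
  qed
  have "inj_on ((\<otimes>) u) (coset_below u v)"
    using inj_on_mult_left[OF MJ_closed[OF assms(1)]]
    by (rule inj_on_subset) (auto simp: coset_below_def)
  hence "(\<Sum>y\<in>?Y. h (len y - len u) y) = (\<Sum>z\<in>coset_below u v. h (len (u \<otimes> z) - len u) (u \<otimes> z))"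
    unfolding Y by (simp add: sum.reindex)
  also have "\<dots> = (\<Sum>z\<in>coset_below u v. h (len z) (u \<otimes> z))"
    by (intro sum.cong) (auto simp: coset_below_def len_min_rep_mult[OF assms(1)])
  finally show ?thesis .
qed

lemma lower_set_coset_sum:
  assumes "v \<in> carrier G"
  shows "(\<Sum>y\<in>{y. le y v}. h y) = (\<Sum>p\<in>{p \<in> MJ. le p v}. \<Sum>z\<in>coset_below p v. h (p \<otimes> z))"
proof -
  let ?X = "SIGMA p:{p \<in> MJ. le p v}. coset_below p v"
  have fin: "finite {p \<in> MJ. le p v}" using finite_below[OF assms] by (rule finite_subset[rotated]) auto
  have "bij_betw (\<lambda>(p, z). p \<otimes> z) ?X {y. le y v}"
  proof (rule bij_betwI')
    fix a b assume "a \<in> ?X" "b \<in> ?X"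
    thus "((case a of (p, z) \<Rightarrow> p \<otimes> z) = (case b of (p, z) \<Rightarrow> p \<otimes> z)) = (a = b)"
      using coset_decomposition_unique by (auto simp: coset_below_def)
  next
    fix a assume "a \<in> ?X"
    thus "(case a of (p, z) \<Rightarrow> p \<otimes> z) \<in> {y. le y v}" by (auto simp: coset_below_def)
  next
    fix y assume "y \<in> {y. le y v}"
    hence y: "le y v" "y \<in> carrier G" using le_closed by auto
    obtain p z where "p \<in> MJ" "z \<in> WJ" "y = p \<otimes> z" using coset_decomposition[OF y(2)] by blast
    moreover from this have "le p v" using min_rep_le y le_trans by blast
    ultimately show "\<exists>a\<in>?X. y = (case a of (p, z) \<Rightarrow> p \<otimes> z)"
      using y by (intro bexI[of _ "(p, z)"]) (auto simp: coset_below_def)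
  qed
  hence "(\<Sum>y\<in>{y. le y v}. h y) = (\<Sum>(p, z)\<in>?X. h (p \<otimes> z))"
    by (subst sum.reindex_bij_betw[symmetric]) (auto simp: case_prod_unfold)
  also have "\<dots> = (\<Sum>p\<in>{p \<in> MJ. le p v}. \<Sum>z\<in>coset_below p v. h (p \<otimes> z))"
    using fin finite_coset_below assms by (subst sum.Sigma) auto
  finally show ?thesis .
qed

end

section \<open>Kazhdan--Lusztig--Stanley polynomials of a kernel\<close>

definition low_part :: "nat \<Rightarrow> int poly \<Rightarrow> int poly" where
  "low_part n p = Poly (map (coeff p) [0..<(n + 1) div 2])"

lemma coeff_low_part: "coeff (low_part n p) i = (if 2 * i < n then coeff p i else 0)"
  by (auto simp: low_part_def nth_default_def)

lemma degree_low_part: "0 < n \<Longrightarrow> 2 * degree (low_part n p) < n"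
  by (metis coeff_low_part degree_0 leading_coeff_0_iff mult_0_right)

text \<open>
  If \<open>q\<^sup>n g(q\<^sup>-\<^sup>1) = -g\<close>, then the upper half of \<open>g\<close> is the negated mirror image of the lower
  half, and the middle coefficient vanishes.
\<close>

lemma q_reverse_low_part:
  assumes "degree g \<le> n" "q_reverse n g = - g" "0 < n"
  shows "q_reverse n (- low_part n g) = - low_part n g + g"
proof (rule poly_eqI)
  fix i
  have d: "degree (- low_part n g) \<le> n" using degree_low_part[OF assms(3), of g] by simp
  have "coeff (q_reverse n g) i = - coeff g i" by (simp add: assms(2))
  hence "(if i \<le> n then coeff g (n - i) else 0) = - coeff g i"
    using coeff_q_reverse[OF assms(1), of i] by simp
  thus "coeff (q_reverse n (- low_part n g)) i = coeff (- low_part n g + g) i"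
    unfolding coeff_q_reverse[OF d] coeff_add coeff_minus coeff_low_part
    by (cases "2 * i" n rule: linorder_cases) (auto split: if_splits)
qed

lemma q_reverse_low_part_unique:
  assumes "2 * degree p < n" "2 * degree r < n" "q_reverse n p = p + g" "q_reverse n r = r + g"
  shows "p = r"
proof (rule poly_eqI)
  fix i
  have *: "degree p \<le> n" "degree r \<le> n" using assms by auto
  have eq: "coeff (q_reverse n p) i - coeff p i = coeff (q_reverse n r) i - coeff r i"
    by (simp add: assms(3,4))
  show "coeff p i = coeff r i"
  proof (cases "2 * i < n")
    case True
    hence "degree p < n - i" "degree r < n - i" using assms by auto
    hence "coeff (q_reverse n p) i = 0" "coeff (q_reverse n r) i = 0"
      using * by (simp_all add: coeff_q_reverse coeff_eq_0)
    thus ?thesis using eq by simp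
  next
    case False
    thus ?thesis using assms by (simp add: coeff_eq_0)
  qed
qed

text \<open>
  Stanley's setting: a kernel \<open>R\<close> on a poset with finite lower sets, that is, a triangular matrix
  inverted by its own reversal.
\<close>

locale KLS_kernel =
  fixes X :: "'b set" and leq :: "'b \<Rightarrow> 'b \<Rightarrow> bool" and l :: "'b \<Rightarrow> nat"
    and R :: "'b \<Rightarrow> 'b \<Rightarrow> int poly"
  assumes finite_lower: "v \<in> X \<Longrightarrow> finite {u \<in> X. leq u v}"
    and leq_refl: "u \<in> X \<Longrightarrow> leq u u"
    and leq_trans: "u \<in> X \<Longrightarrow> v \<in> X \<Longrightarrow> w \<in> X \<Longrightarrow> leq u v \<Longrightarrow> leq v w \<Longrightarrow> leq u w"
    and l_strict: "u \<in> X \<Longrightarrow> v \<in> X \<Longrightarrow> leq u v \<Longrightarrow> u \<noteq> v \<Longrightarrow> l u < l v"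
    and R_support: "u \<in> X \<Longrightarrow> v \<in> X \<Longrightarrow> \<not> leq u v \<Longrightarrow> R u v = 0"
    and R_self: "u \<in> X \<Longrightarrow> R u u = 1"
    and R_degree: "u \<in> X \<Longrightarrow> v \<in> X \<Longrightarrow> degree (R u v) \<le> l v - l u"
    and R_kernel: "u \<in> X \<Longrightarrow> v \<in> X \<Longrightarrow> leq u v \<Longrightarrow>
      (\<Sum>w\<in>{w \<in> X. leq u w \<and> leq w v}. R u w * q_reverse (l v - l w) (R w v)) = (if u = v then 1 else 0)"
begin

definition is_KL :: "('b \<Rightarrow> 'b \<Rightarrow> int poly) \<Rightarrow> bool" where
  "is_KL P \<longleftrightarrow> (\<forall>u v. u \<notin> X \<or> v \<notin> X \<longrightarrow> P u v = 0) \<and>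
    (\<forall>u\<in>X. \<forall>v\<in>X. (\<not> leq u v \<longrightarrow> P u v = 0) \<and> P u u = 1 \<and>
      (leq u v \<and> u \<noteq> v \<longrightarrow> 2 * degree (P u v) < l v - l u) \<and>
      (leq u v \<longrightarrow> q_reverse (l v - l u) (P u v) =
         (\<Sum>w\<in>{w \<in> X. leq u w \<and> leq w v}. R u w * P w v)))"

definition above :: "'b \<Rightarrow> 'b \<Rightarrow> 'b set" where
  "above u v = {w \<in> X. leq u w \<and> leq w v \<and> w \<noteq> u}"

lemma l_mono: "u \<in> X \<Longrightarrow> v \<in> X \<Longrightarrow> leq u v \<Longrightarrow> l u \<le> l v"
  using l_strict less_imp_le by blast

lemma interval_above: "u \<in> X \<Longrightarrow> v \<in> X \<Longrightarrow> leq u v \<Longrightarrow>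
    {w \<in> X. leq u w \<and> leq w v} = insert u (above u v)"
  using leq_refl by (auto simp: above_def)

lemma finite_above: "v \<in> X \<Longrightarrow> finite (above u v)"
  unfolding above_def by (rule finite_subset[OF _ finite_lower]) auto

lemma sum_interval_above:
  assumes "u \<in> X" "v \<in> X" "leq u v"
  shows "(\<Sum>w\<in>{w \<in> X. leq u w \<and> leq w v}. h w) = h u + (\<Sum>w\<in>above u v. h w)"
  using finite_above[of v u] assms by (simp add: interval_above) (simp add: above_def)

lemma l_above:
  assumes "w \<in> above u v" "u \<in> X" "v \<in> X"
  shows "l u < l w" "l w \<le> l v"
  using assms l_strict[of u w] l_mono[of w v] by (auto simp: above_def)

text \<open>
  The kernel identity with \<open>q\<close> replaced by \<open>q\<^sup>-\<^sup>1\<close>.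
\<close>

lemma R_kernel':
  assumes "u \<in> X" "v \<in> X" "leq u v"
  shows "(\<Sum>w\<in>{w \<in> X. leq u w \<and> leq w v}. q_reverse (l w - l u) (R u w) * R w v) = (if u = v then 1 else 0)"
proof -
  let ?I = "{w \<in> X. leq u w \<and> leq w v}"
  have bounds: "l v - l u = (l w - l u) + (l v - l w)" if "w \<in> ?I" for w
    using that assms l_mono[of u w] l_mono[of w v] by auto
  have deg: "degree (R u w * q_reverse (l v - l w) (R w v)) \<le> l v - l u" if "w \<in> ?I" for w
  proof -
    have "degree (R u w * q_reverse (l v - l w) (R w v)) \<le> degree (R u w) + degree (q_reverse (l v - l w) (R w v))"
      by (rule degree_mult_le)
    also have "\<dots> \<le> (l w - l u) + (l v - l w)"
      using that assms by (intro add_mono R_degree degree_q_reverse) auto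
    finally show ?thesis using bounds[OF that] by simp
  qed
  have "q_reverse (l v - l u) (\<Sum>w\<in>?I. R u w * q_reverse (l v - l w) (R w v)) =
      (\<Sum>w\<in>?I. q_reverse (l v - l u) (R u w * q_reverse (l v - l w) (R w v)))"
    using deg by (rule q_reverse_sum)
  also have "\<dots> = (\<Sum>w\<in>?I. q_reverse (l w - l u) (R u w) * R w v)"
  proof (rule sum.cong[OF refl])
    fix w assume w: "w \<in> ?I"
    have "q_reverse (l v - l u) (R u w * q_reverse (l v - l w) (R w v)) =
        q_reverse (l w - l u) (R u w) * q_reverse (l v - l w) (q_reverse (l v - l w) (R w v))"
      unfolding bounds[OF w] using w assms by (intro q_reverse_mult R_degree degree_q_reverse) auto
    thus "q_reverse (l v - l u) (R u w * q_reverse (l v - l w) (R w v)) =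
        q_reverse (l w - l u) (R u w) * R w v"
      using w assms R_degree by (simp add: q_reverse_q_reverse)
  qed
  finally show ?thesis unfolding R_kernel[OF assms] by (cases "u = v") simp_all
qed

text \<open>
  The defining equation reads \<open>rev P - P = g\<close>, where \<open>g\<close> involves only smaller intervals. As all
  exponents of \<open>P\<close> lie below the middle and those of \<open>rev P\<close> above, \<open>P\<close> has to be minus the low part
  of \<open>g\<close>.
\<close>

function KL :: "'b \<Rightarrow> 'b \<Rightarrow> int poly" where
  "KL u v = (if u \<in> X \<and> v \<in> X \<and> leq u v
     then if u = v then 1 else - low_part (l v - l u) (\<Sum>w\<in>above u v. R u w * KL w v)
     else 0)"
  by auto
termination
proof (relation "measure (\<lambda>(u, v). l v - l u)")
  fix u v w assume "u \<in> X \<and> v \<in> X \<and> leq u v" "w \<in> above u v"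
  thus "((w, v), u, v) \<in> measure (\<lambda>(u, v). l v - l u)"
    using l_above[of w u v] by auto
qed simp

declare KL.simps [simp del]

lemma KL_self: "u \<in> X \<Longrightarrow> KL u u = 1"
  using leq_refl by (subst KL.simps) simp

lemma KL_degree:
  assumes "u \<in> X" "v \<in> X" "leq u v" "u \<noteq> v"
  shows "2 * degree (KL u v) < l v - l u"
  using assms l_strict[OF assms] degree_low_part[of "l v - l u"] by (subst KL.simps) simp

lemma KL_degree_le: "u \<in> X \<Longrightarrow> v \<in> X \<Longrightarrow> leq u v \<Longrightarrow> degree (KL u v) \<le> l v - l u"
  using KL_degree[of u v] KL_self[of u] by (cases "u = v") auto

text \<open>
  By \<open>q_reverse_low_part\<close> it suffices that reversal negates the sum \<open>g\<close>. Reversing \<open>g\<close>, expanding the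
  reversed polynomials by induction and exchanging the sums leaves the kernel identity \<open>R_kernel'\<close>
  without its term \<open>w = u\<close>.
\<close>

lemma KL_equation:
  assumes "u \<in> X" "v \<in> X" "leq u v"
  shows "q_reverse (l v - l u) (KL u v) = KL u v + (\<Sum>w\<in>above u v. R u w * KL w v)"
  using assms
proof (induction "l v - l u" arbitrary: u rule: less_induct)
  case less
  note u = less.prems
  show ?case
  proof (cases "u = v")
    case True
    have "above v v = {}" using u l_strict[of v] l_mono[of _ v] by (force simp: above_def)
    thus ?thesis using True u KL_self by simp
  next
    case False
    let ?Y = "above u v" and ?n = "l v - l u"
    define g where "g = (\<Sum>w\<in>?Y. R u w * KL w v)"
    have fin: "finite ?Y" using finite_above u by blast
    have Y: "w \<in> X" "leq u w" "leq w v" "w \<noteq> u" "l u < l w" "l w \<le> l v" if "w \<in> ?Y" for w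
      using that l_above[OF that] u by (auto simp: above_def)
    have bounds: "?n = (l w - l u) + (l v - l w)" if "w \<in> ?Y" for w
      using Y[OF that] by simp
    have deg: "degree (R u w * KL w v) \<le> ?n" if "w \<in> ?Y" for w
    proof -
      have "degree (R u w * KL w v) \<le> degree (R u w) + degree (KL w v)" by (rule degree_mult_le)
      also have "\<dots> \<le> (l w - l u) + (l v - l w)"
        using Y[OF that] u by (intro add_mono R_degree KL_degree_le)
      finally show ?thesis using bounds[OF that] by simp
    qed
    have IH: "q_reverse (l v - l w) (KL w v) = (\<Sum>t\<in>?Y. R w t * KL t v)" if w: "w \<in> ?Y" for w
    proof -
      have "q_reverse (l v - l w) (KL w v) = KL w v + (\<Sum>t\<in>above w v. R w t * KL t v)"
        using less.hyps[of w] Y[OF w] u by auto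
      also have "\<dots> = (\<Sum>t\<in>{t \<in> X. leq w t \<and> leq t v}. R w t * KL t v)"
        using Y[OF w] u R_self by (simp add: sum_interval_above)
      also have "\<dots> = (\<Sum>t\<in>?Y. R w t * KL t v)"
      proof (rule sum.mono_neutral_left[OF fin])
        show "{t \<in> X. leq w t \<and> leq t v} \<subseteq> ?Y"
        proof
          fix t assume "t \<in> {t \<in> X. leq w t \<and> leq t v}"
          hence t: "t \<in> X" "leq w t" "leq t v" by auto
          have "leq u t" using leq_trans[of u w t] Y[OF w] u t by blast
          moreover have "t \<noteq> u" using l_mono[of w t] Y[OF w] t by auto
          ultimately show "t \<in> ?Y" using t by (simp add: above_def)
        qed
        show "\<forall>t\<in>?Y - {t \<in> X. leq w t \<and> leq t v}. R w t * KL t v = 0"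
          using Y[OF w] Y(1,3) R_support by auto
      qed
      finally show ?thesis .
    qed
    have kern: "(\<Sum>w\<in>?Y. q_reverse (l w - l u) (R u w) * R w t) = - R u t" if t: "t \<in> ?Y" for t
    proof -
      have "(\<Sum>w\<in>?Y. q_reverse (l w - l u) (R u w) * R w t) =
          (\<Sum>w\<in>above u t. q_reverse (l w - l u) (R u w) * R w t)"
      proof (rule sum.mono_neutral_right[OF fin])
        show "above u t \<subseteq> ?Y" 
        proof
          fix w assume "w \<in> above u t"
          hence w: "w \<in> X" "leq u w" "leq w t" "w \<noteq> u" by (auto simp: above_def)
          have "leq w v" using leq_trans[of w t v] Y[OF t] u w by blast
          thus "w \<in> ?Y" using w by (simp add: above_def)
        qed
        show "\<forall>w\<in>?Y - above u t. q_reverse (l w - l u) (R u w) * R w t = 0"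
          using Y[OF t] R_support by (auto simp: above_def)
      qed
      moreover have "(\<Sum>w\<in>{w \<in> X. leq u w \<and> leq w t}. q_reverse (l w - l u) (R u w) * R w t) = 0"
        using R_kernel'[of u t] Y[OF t] u by auto
      ultimately show ?thesis
        using Y[OF t] u R_self by (simp add: sum_interval_above eq_neg_iff_add_eq_0 add.commute)
    qed
    have "q_reverse ?n g = (\<Sum>w\<in>?Y. q_reverse ?n (R u w * KL w v))"
      unfolding g_def using deg by (rule q_reverse_sum)
    also have "\<dots> = (\<Sum>w\<in>?Y. q_reverse (l w - l u) (R u w) * (\<Sum>t\<in>?Y. R w t * KL t v))"
    proof (rule sum.cong[OF refl])
      fix w assume w: "w \<in> ?Y"
      show "q_reverse ?n (R u w * KL w v) =
          q_reverse (l w - l u) (R u w) * (\<Sum>t\<in>?Y. R w t * KL t v)"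
        unfolding bounds[OF w] IH[OF w, symmetric]
        using Y[OF w] u by (intro q_reverse_mult R_degree KL_degree_le)
    qed
    also have "\<dots> = (\<Sum>t\<in>?Y. (\<Sum>w\<in>?Y. q_reverse (l w - l u) (R u w) * R w t) * KL t v)"
      unfolding sum_distrib_left sum_distrib_right by (subst sum.swap) (simp add: mult.assoc)
    also have "\<dots> = - g" by (simp add: kern g_def sum_negf)
    finally have "q_reverse ?n g = - g" .
    moreover have "degree g \<le> ?n" unfolding g_def using deg fin by (intro degree_sum_le) auto
    moreover have "0 < ?n" using l_strict[OF u False] by simp
    ultimately have "q_reverse ?n (- low_part ?n g) = - low_part ?n g + g" by (intro q_reverse_low_part)
    moreover have "KL u v = - low_part ?n g" using u False by (subst KL.simps) (simp add: g_def)
    ultimately show ?thesis by (simp add: g_def)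
  qed
qed

lemma is_KL_KL: "is_KL KL"
  unfolding is_KL_def
proof (intro conjI allI ballI impI)
  fix u v assume "u \<notin> X \<or> v \<notin> X"
  thus "KL u v = 0" by (subst KL.simps) auto
next
  fix u v assume "\<not> leq u v"
  thus "KL u v = 0" by (subst KL.simps) auto
next
  fix u v assume "u \<in> X" "v \<in> X" "leq u v"
  thus "q_reverse (l v - l u) (KL u v) = (\<Sum>w\<in>{w \<in> X. leq u w \<and> leq w v}. R u w * KL w v)"
    using KL_equation R_self by (simp add: sum_interval_above)
qed (use KL_self KL_degree in auto)

lemma is_KLD:
  assumes "is_KL P"
  shows "u \<notin> X \<or> v \<notin> X \<Longrightarrow> P u v = 0"
    and "u \<in> X \<Longrightarrow> v \<in> X \<Longrightarrow> \<not> leq u v \<Longrightarrow> P u v = 0"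
    and "u \<in> X \<Longrightarrow> P u u = 1"
    and "u \<in> X \<Longrightarrow> v \<in> X \<Longrightarrow> leq u v \<Longrightarrow> u \<noteq> v \<Longrightarrow> 2 * degree (P u v) < l v - l u"
    and "u \<in> X \<Longrightarrow> v \<in> X \<Longrightarrow> leq u v \<Longrightarrow>
      q_reverse (l v - l u) (P u v) = (\<Sum>w\<in>{w \<in> X. leq u w \<and> leq w v}. R u w * P w v)"
  using assms unfolding is_KL_def by blast+

lemma is_KL_unique:
  assumes "is_KL P" "is_KL P'"
  shows "P = P'"
proof (intro ext)
  fix u v
  show "P u v = P' u v"
  proof (induction "l v - l u" arbitrary: u rule: less_induct)
    case less
    show ?case
    proof (cases "u \<in> X \<and> v \<in> X \<and> leq u v \<and> u \<noteq> v")
      case True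
      let ?g = "\<lambda>P. \<Sum>w\<in>above u v. R u w * P w v"
      have "P w v = P' w v" if "w \<in> above u v" for w
        using less[of w] l_above[OF that] True by auto
      hence "?g P = ?g P'" by (intro sum.cong) auto
      moreover have "q_reverse (l v - l u) (P u v) = P u v + ?g P"
        "q_reverse (l v - l u) (P' u v) = P' u v + ?g P'"
        using True is_KLD(5)[OF assms(1)] is_KLD(5)[OF assms(2)] R_self
        by (simp_all add: sum_interval_above)
      ultimately show ?thesis
        using True is_KLD(4)[OF assms(1)] is_KLD(4)[OF assms(2)]
          q_reverse_low_part_unique[of "P u v" "l v - l u" "P' u v" "?g P"] by simp
    next
      case False
      thus ?thesis using is_KLD(1-3)[OF assms(1)] is_KLD(1-3)[OF assms(2)] by metis
    qed
  qed
qed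

end

section \<open>The inversion formula for R-polynomials\<close>

context coxeter_system
begin

definition Rrev :: "'a \<Rightarrow> 'a \<Rightarrow> int poly" where
  "Rrev u v = q_reverse (len v - len u) (Rpoly u v)"

lemma Rrev_support: "Rrev u v \<noteq> 0 \<Longrightarrow> le u v"
  using Rpoly_support q_reverse_0 unfolding Rrev_def by metis

lemma Rpoly_degree_diff: "degree (Rpoly u v) \<le> len v - len u"
  using Rpoly_degree[of u v] Rpoly_support[of u v] by (cases "Rpoly u v = 0") simp_all

lemma Rrev_down:
  assumes "s \<in> S" "v \<in> carrier G" "ldesc s v" "y \<in> carrier G" "ldesc s y"
  shows "Rrev y v = Rrev (s \<otimes> y) (s \<otimes> v)"
proof -
  have "Rpoly y v = Rpoly (s \<otimes> y) (s \<otimes> v)" using Rpoly_left[of s v y] assms by (simp add: R_left_def)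
  moreover have "len v - len y = len (s \<otimes> v) - len (s \<otimes> y)"
    using len_gen_mult(1)[of s v] len_gen_mult(1)[of s y] assms by simp
  ultimately show ?thesis by (simp add: Rrev_def)
qed

lemma Rrev_up:
  assumes "s \<in> S" "v \<in> carrier G" "ldesc s v" "y \<in> carrier G" "\<not> ldesc s y"
  shows "Rrev y v = (1 - q_var) * Rrev y (s \<otimes> v) + q_var * Rrev (s \<otimes> y) (s \<otimes> v)"
proof -
  let ?A = "Rpoly y (s \<otimes> v)" and ?B = "Rpoly (s \<otimes> y) (s \<otimes> v)"
  have lv: "len v = Suc (len (s \<otimes> v))" using len_gen_mult(1)[of s v] assms by simp
  have ly: "len (s \<otimes> y) = Suc (len y)" using len_gen_mult(2)[of s y] assms by simp
  have eq: "Rpoly y v = (q_var - 1) * ?A + q_var * ?B"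
    using Rpoly_left[of s v y] assms by (simp add: R_left_def)
  show ?thesis
  proof (cases "le y v")
    case True
    have "le y (s \<otimes> v)" using lift_down True assms by blast
    hence "len y \<le> len (s \<otimes> v)" using le_len by blast
    then obtain m where m: "m = len (s \<otimes> v) - len y" "len v - len y = Suc m" using lv by simp
    have dA: "degree ?A \<le> m" using Rpoly_degree_diff m by simp
    have k: "len (s \<otimes> v) - len (s \<otimes> y) = m - 1" using m ly by simp
    have dB: "degree ?B \<le> m - 1" using Rpoly_degree_diff[of "s \<otimes> y" "s \<otimes> v"] k by simp
    have rB: "q_reverse m ?B = q_var * q_reverse (m - 1) ?B"
    proof (cases "?B = 0")
      case False
      hence "len (s \<otimes> y) \<le> len (s \<otimes> v)" using Rpoly_support le_len by blast
      hence "Suc (m - 1) = m" using m(1) ly by linarith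
      thus ?thesis using q_reverse_pad[OF dB] by (simp only:)
    qed simp
    have "degree ((q_var - 1) * ?A) \<le> degree (q_var - 1) + degree ?A"
      "degree (q_var * ?B) \<le> degree q_var + degree ?B" by (rule degree_mult_le)+
    moreover have "degree (q_var - 1) \<le> 1" "degree q_var \<le> 1" by (simp_all add: one_pCons)
    ultimately have "degree ((q_var - 1) * ?A) \<le> Suc m" "degree (q_var * ?B) \<le> Suc m"
      using dA dB by linarith+
    hence "q_reverse (Suc m) (Rpoly y v) = q_reverse (Suc m) ((q_var - 1) * ?A) + q_reverse (Suc m) (q_var * ?B)"
      unfolding eq by (rule q_reverse_add)
    also have "q_reverse (Suc m) ((q_var - 1) * ?A) = q_reverse 1 (q_var - 1) * q_reverse m ?A"
      using dA by (intro q_reverse_linear) (simp_all add: one_pCons)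
    also have "q_reverse 1 (q_var - 1) = 1 - q_var" by (simp only: One_nat_def q_reverse_1_values)
    also have "q_reverse (Suc m) (q_var * ?B) = q_reverse 1 q_var * q_reverse m ?B"
      using dB by (intro q_reverse_linear) simp_all
    also have "q_reverse 1 q_var = 1" by (simp only: One_nat_def q_reverse_1_values)
    finally show ?thesis using m k rB by (simp only: Rrev_def mult_1_left)
  next
    case False
    have "\<not> le y (s \<otimes> v)" using False gen_mult_le[of s v] assms le_trans by blast
    moreover have "\<not> le (s \<otimes> y) (s \<otimes> v)"
    proof
      assume le: "le (s \<otimes> y) (s \<otimes> v)"
      have "\<not> len (s \<otimes> (s \<otimes> v)) < len (s \<otimes> v)" using assms by simp
      hence "le (s \<otimes> (s \<otimes> y)) (s \<otimes> (s \<otimes> v))"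
        by (rule lift_mult[OF le assms(1)])
      thus False using False assms by simp
    qed
    ultimately have "Rrev y (s \<otimes> v) = 0" "Rrev (s \<otimes> y) (s \<otimes> v) = 0" "Rrev y v = 0"
      using Rrev_support False by blast+
    thus ?thesis by simp
  qed
qed

lemma K_left_sum: "K_left s (\<lambda>w. \<Sum>y\<in>A. F w y * c y) u = (\<Sum>y\<in>A. K_left s (\<lambda>w. F w y) u * c y)"
proof -
  have "(\<Sum>y\<in>A. f y * c y) - d * (\<Sum>y\<in>A. g y * c y) = (\<Sum>y\<in>A. (f y - d * g y) * c y)"
    for d :: "int poly" and f g
    by (simp add: sum_distrib_left sum_subtractf left_diff_distrib mult.assoc)
  moreover have "d * (\<Sum>y\<in>A. g y * c y) = (\<Sum>y\<in>A. (d * g y) * c y)" for d :: "int poly" and g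
    by (simp add: sum_distrib_left mult.assoc)
  ultimately show ?thesis
    unfolding K_left_eval by (cases "ldesc s u") (simp_all only: if_True if_False)
qed

text \<open>
  Let \<open>s\<close> be a left descent of \<open>v\<close>. Adding the terms of \<open>y\<close> and \<open>s y\<close> shows that the sum for \<open>v\<close>, as a
  function of \<open>u\<close>, is \<open>K_left s\<close> applied to the sum for \<open>s v\<close>. By induction the latter is the
  indicator function of \<open>s v\<close>.
\<close>

lemma Rpoly_kernel:
  assumes "u \<in> carrier G" "v \<in> carrier G"
  shows "(\<Sum>y\<in>{y. le y v}. Rpoly u y * Rrev y v) = (if u = v then 1 else 0)"
  using assms
proof (induction "len v" arbitrary: u v rule: less_induct)
  case less
  note uv = less.prems
  show ?case
  proof (cases "v = \<one>")
    case True
    have "{y. le y \<one>} = {\<one>}" using le_one by auto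
    moreover have "Rrev \<one> \<one> = 1" using Rpoly_self by (simp add: Rrev_def)
    ultimately show ?thesis using True uv Rpoly_one[of u] by (simp add: delta_def)
  next
    case False
    then obtain s where s: "s \<in> S" "ldesc s v" using left_descent_exists[of v] uv by auto
    have sv: "s \<otimes> v \<in> carrier G" using s uv by simp
    let ?B = "{y. le y v}"
    have fin: "finite ?B" using finite_below uv by blast
    have B: "s \<otimes> y \<in> ?B" "y \<in> carrier G" "s \<otimes> (s \<otimes> y) = y" if "y \<in> ?B" for y
      using that lift_up s le_closed by auto
    have pairing: "sum h ?B = (\<Sum>y\<in>{y \<in> ?B. \<not> ldesc s y}. h y + h (s \<otimes> y))"
      for h :: "'a \<Rightarrow> int poly"
    proof (rule sum_involution[OF fin])
      fix y assume y: "y \<in> ?B"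
      show "\<not> len (s \<otimes> (s \<otimes> y)) < len (s \<otimes> y) \<longleftrightarrow> \<not> \<not> ldesc s y"
        using len_gen_mult(2)[of s y] B[OF y] s by (cases "ldesc s y") auto
    qed (use B in blast)+
    have alg: "r * ((1 - Q) * a + Q * b) + T * a = (T - (Q - 1) * r) * a + (Q * r) * b"
      for r Q a b T :: "int poly" by (simp add: algebra_simps)
    let ?h = "\<lambda>y. K_left s (\<lambda>w. Rpoly w y) u * Rrev y (s \<otimes> v)"
    have "(\<Sum>y\<in>?B. Rpoly u y * Rrev y v) = (\<Sum>y\<in>?B. ?h y)"
      unfolding pairing
    proof (rule sum.cong[OF refl])
      fix y assume "y \<in> {y \<in> ?B. \<not> ldesc s y}"
      hence y: "y \<in> ?B" "\<not> ldesc s y" "len y < len (s \<otimes> y)" "y \<in> carrier G"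
        using len_gen_mult(2)[of s y] B(2) s by auto
      have R: "Rpoly w (s \<otimes> y) = R_left s (\<lambda>w. Rpoly w y) w" if "w \<in> carrier G" for w
        using Rpoly_left[of s "s \<otimes> y" w] s y that by simp
      have "K_left s (\<lambda>w. Rpoly w (s \<otimes> y)) u = K_left s (R_left s (\<lambda>w. Rpoly w y)) u"
        using R s uv by (intro agreeD[OF K_left_cong]) (auto simp: agree_def)
      hence K: "K_left s (\<lambda>w. Rpoly w (s \<otimes> y)) u = q_var * Rpoly u y"
        using K_left_R_left[of s u] s uv by simp
      have "Rrev (s \<otimes> y) v = Rrev y (s \<otimes> v)"
        using Rrev_down[of s v "s \<otimes> y"] s uv y by simp
      moreover have "Rrev y v = (1 - q_var) * Rrev y (s \<otimes> v) + q_var * Rrev (s \<otimes> y) (s \<otimes> v)"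
        using Rrev_up s uv y by blast
      moreover have "K_left s (\<lambda>w. Rpoly w y) u = Rpoly u (s \<otimes> y) - (q_var - 1) * Rpoly u y"
        using R uv by (simp add: K_left_def)
      ultimately show "Rpoly u y * Rrev y v + Rpoly u (s \<otimes> y) * Rrev (s \<otimes> y) v = ?h y + ?h (s \<otimes> y)"
        unfolding K by (simp only: alg)
    qed
    also have "\<dots> = (\<Sum>y\<in>{y. le y (s \<otimes> v)}. ?h y)"
    proof (rule sum.mono_neutral_right[OF fin])
      show "{y. le y (s \<otimes> v)} \<subseteq> ?B" using gen_mult_le[of s v] s uv le_trans by blast
      show "\<forall>y\<in>?B - {y. le y (s \<otimes> v)}. ?h y = 0" using Rrev_support by auto
    qed
    also have "\<dots> = K_left s (\<lambda>w. \<Sum>y\<in>{y. le y (s \<otimes> v)}. Rpoly w y * Rrev y (s \<otimes> v)) u"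
      by (rule K_left_sum[symmetric])
    also have "\<dots> = K_left s (\<lambda>w. if w = s \<otimes> v then 1 else 0) u"
      using less.hyps[OF s(2) _ sv] s uv by (intro agreeD[OF K_left_cong]) (auto simp: agree_def)
    also have "\<dots> = (if u = v then 1 else 0)"
    proof -
      have "s \<otimes> u = s \<otimes> v \<longleftrightarrow> u = v" using s uv by (metis gen_cancel_left)
      moreover have "u = s \<otimes> v \<Longrightarrow> s \<otimes> u = v" using s uv by simp
      moreover have "v \<noteq> s \<otimes> v" using s by auto
      ultimately show ?thesis using s by (auto simp: K_left_eval)
    qed
    finally show ?thesis .
  qed
qed

end

section \<open>Parabolic Kazhdan--Lusztig polynomials\<close>

context parabolic
begin

lemma coset_below_degree:
  assumes "u \<in> MJ" "v \<in> carrier G" "z \<in> coset_below u v"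
  shows "len v - len u = len z + (len v - len (u \<otimes> z))"
proof -
  have z: "z \<in> WJ" "le (u \<otimes> z) v" using assms by (auto simp: coset_below_def)
  hence "len (u \<otimes> z) \<le> len v" using le_len by blast
  thus ?thesis using len_min_rep_mult[OF assms(1) z(1)] by simp
qed

lemma Rpar_degree:
  assumes "x \<in> {-1, q_var}" "u \<in> MJ" "v \<in> MJ"
  shows "degree (Rpar x u v) \<le> len v - len u"
  unfolding Rpar_eq[OF assms(2,3)]
proof (rule degree_sum_le)
  show "finite (coset_below u v)" using finite_coset_below assms by simp
  fix z assume z: "z \<in> coset_below u v"
  show "degree ((- x) ^ len z * Rpoly (u \<otimes> z) v) \<le> len v - len u"
    using q_reverse_x_power(1)[OF assms(1) Rpoly_degree_diff] coset_below_degree[OF assms(2) _ z] assms(3)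
    by simp
qed

lemma q_reverse_Rpar:
  assumes "x \<in> {-1, q_var}" "u \<in> MJ" "v \<in> MJ"
  shows "q_reverse (len v - len u) (Rpar x u v) =
    (\<Sum>z\<in>coset_below u v. other_root x ^ len z * Rrev (u \<otimes> z) v)"
proof -
  note bounds = coset_below_degree[OF assms(2) MJ_closed[OF assms(3)]]
  have "q_reverse (len v - len u) (Rpar x u v) =
      (\<Sum>z\<in>coset_below u v. q_reverse (len v - len u) ((- x) ^ len z * Rpoly (u \<otimes> z) v))"
    unfolding Rpar_eq[OF assms(2,3)]
    using q_reverse_x_power(1)[OF assms(1) Rpoly_degree_diff] bounds
    by (intro q_reverse_sum) simp
  also have "\<dots> = (\<Sum>z\<in>coset_below u v. other_root x ^ len z * Rrev (u \<otimes> z) v)"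
  proof (rule sum.cong[OF refl])
    fix z assume "z \<in> coset_below u v"
    show "q_reverse (len v - len u) ((- x) ^ len z * Rpoly (u \<otimes> z) v) =
        other_root x ^ len z * Rrev (u \<otimes> z) v"
      unfolding bounds[OF \<open>z \<in> coset_below u v\<close>] Rrev_def
      by (rule q_reverse_x_power(2)[OF assms(1) Rpoly_degree_diff])
  qed
  finally show ?thesis .
qed

lemma sum_coset_sum_Rpoly:
  assumes "u \<in> MJ" "v \<in> carrier G"
  shows "(\<Sum>y\<in>{y. le y v}. coset_sum x u (\<lambda>w. Rpoly w y) * h y) =
    (\<Sum>z\<in>coset_below u v. (- x) ^ len z * (\<Sum>y\<in>{y. le y v}. Rpoly (u \<otimes> z) y * h y))"
proof -
  have "(\<Sum>y\<in>{y. le y v}. coset_sum x u (\<lambda>w. Rpoly w y) * h y) =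
      (\<Sum>y\<in>{y. le y v}. (\<Sum>z\<in>coset_below u v. (- x) ^ len z * Rpoly (u \<otimes> z) y) * h y)"
    using assms coset_sum_Rpoly by (intro sum.cong) auto
  also have "\<dots> = (\<Sum>z\<in>coset_below u v. \<Sum>y\<in>{y. le y v}. (- x) ^ len z * Rpoly (u \<otimes> z) y * h y)"
    unfolding sum_distrib_right by (rule sum.swap)
  finally show ?thesis by (simp only: sum_distrib_left mult.assoc)
qed

text \<open>
  The elements below \<open>v\<close> are grouped by cosets \<open>p W\<^sub>J\<close>; within a coset \<open>coset_sum_Rpoly_coset\<close> applies.
\<close>

lemma sum_Rpar_coset:
  assumes "u \<in> MJ" "v \<in> carrier G" "x \<in> {-1, q_var}"
  shows "(\<Sum>y\<in>{y. le y v}. coset_sum x u (\<lambda>w. Rpoly w y) * h y) =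
    (\<Sum>p\<in>{p \<in> MJ. le u p \<and> le p v}. Rpar x u p * (\<Sum>z\<in>coset_below p v. other_root x ^ len z * h (p \<otimes> z)))"
proof -
  have "(\<Sum>y\<in>{y. le y v}. coset_sum x u (\<lambda>w. Rpoly w y) * h y) =
    (\<Sum>p\<in>{p \<in> MJ. le p v}. \<Sum>z\<in>coset_below p v. coset_sum x u (\<lambda>w. Rpoly w (p \<otimes> z)) * h (p \<otimes> z))"
    by (rule lower_set_coset_sum[OF assms(2)])
  also have "\<dots> = (\<Sum>p\<in>{p \<in> MJ. le p v}. Rpar x u p * (\<Sum>z\<in>coset_below p v. other_root x ^ len z * h (p \<otimes> z)))"
  proof (rule sum.cong[OF refl])
    fix p assume "p \<in> {p \<in> MJ. le p v}"
    hence p: "p \<in> MJ" by simp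
    show "(\<Sum>z\<in>coset_below p v. coset_sum x u (\<lambda>w. Rpoly w (p \<otimes> z)) * h (p \<otimes> z)) =
        Rpar x u p * (\<Sum>z\<in>coset_below p v. other_root x ^ len z * h (p \<otimes> z))"
      unfolding sum_distrib_left
    proof (rule sum.cong[OF refl])
      fix z assume "z \<in> coset_below p v"
      hence z: "z \<in> WJ" by (simp add: coset_below_def)
      show "coset_sum x u (\<lambda>w. Rpoly w (p \<otimes> z)) * h (p \<otimes> z) = Rpar x u p * (other_root x ^ len z * h (p \<otimes> z))"
        unfolding coset_sum_Rpoly_coset[OF assms(1) p z assms(3)] by (simp only: mult_ac)
    qed
  qed
  also have "\<dots> = (\<Sum>p\<in>{p \<in> MJ. le u p \<and> le p v}. Rpar x u p * (\<Sum>z\<in>coset_below p v. other_root x ^ len z * h (p \<otimes> z)))"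
  proof (rule sum.mono_neutral_right)
    show "finite {p \<in> MJ. le p v}" by (rule finite_subset[OF _ finite_below[OF assms(2)]]) auto
    show "\<forall>p\<in>{p \<in> MJ. le p v} - {p \<in> MJ. le u p \<and> le p v}.
        Rpar x u p * (\<Sum>z\<in>coset_below p v. other_root x ^ len z * h (p \<otimes> z)) = 0"
      using Rpar_support(3) by auto
  qed auto
  finally show ?thesis .
qed

text \<open>
  Reversal turns the weight \<open>-x\<close> into the other root of the Hecke relation. So the reversed \<open>R\<^sup>J\<^sup>,\<^sup>x\<close>
  carries exactly the weights of \<open>sum_Rpar_coset\<close>, and the claim reduces to the kernel identity
  of \<open>W\<close> for the elements of \<open>u W\<^sub>J\<close>.
\<close>

lemma Rpar_kernel:
  assumes "x \<in> {-1, q_var}" "u \<in> MJ" "v \<in> MJ"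
  shows "(\<Sum>w\<in>{w \<in> MJ. le u w \<and> le w v}. Rpar x u w * q_reverse (len v - len w) (Rpar x w v)) =
    (if u = v then 1 else 0)"
proof -
  have v: "v \<in> carrier G" using assms by simp
  have "(\<Sum>w\<in>{w \<in> MJ. le u w \<and> le w v}. Rpar x u w * q_reverse (len v - len w) (Rpar x w v)) =
      (\<Sum>w\<in>{w \<in> MJ. le u w \<and> le w v}. Rpar x u w * (\<Sum>z\<in>coset_below w v. other_root x ^ len z * Rrev (w \<otimes> z) v))"
    using assms q_reverse_Rpar by (intro sum.cong) auto
  also have "\<dots> = (\<Sum>z\<in>coset_below u v. (- x) ^ len z * (\<Sum>y\<in>{y. le y v}. Rpoly (u \<otimes> z) y * Rrev y v))"
    using sum_Rpar_coset[OF assms(2) v assms(1), of "\<lambda>y. Rrev y v"]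
      sum_coset_sum_Rpoly[OF assms(2) v, of x "\<lambda>y. Rrev y v"] by (simp only:)
  also have "\<dots> = (\<Sum>z\<in>coset_below u v. (- x) ^ len z * (if u \<otimes> z = v then 1 else 0))"
    using assms Rpoly_kernel v by (intro sum.cong) (auto simp: coset_below_def)
  also have "\<dots> = (if u = v then 1 else 0)"
  proof (cases "u = v")
    case True
    thus ?thesis using coset_below_self[OF assms(2)] assms(3) by simp
  next
    case False
    have "u \<otimes> z \<noteq> v" if "z \<in> coset_below u v" for z
      using coset_decomposition_unique(1)[of u v z \<one>] that False assms by (auto simp: coset_below_def)
    thus ?thesis using False by simp
  qed
  finally show ?thesis .
qed

lemma KLS_kernel_Rpar:
  assumes "x \<in> {-1, q_var}"
  shows "KLS_kernel MJ le len (Rpar x)"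
proof
  fix v assume "v \<in> MJ"
  thus "finite {u \<in> MJ. le u v}" by (intro finite_subset[OF _ finite_below[of v]]) auto
next
  fix u v assume "le u v" "u \<noteq> v"
  thus "len u < len v" using le_len[of u v] by auto
next
  fix u v assume "\<not> le u v"
  thus "Rpar x u v = 0" using Rpar_support(3) by blast
next
  fix u v w assume "le u v" "le v w"
  thus "le u w" by (rule le_trans)
qed (use assms Rpar_self Rpar_degree Rpar_kernel in auto)

lemma is_P_family_iff:
  assumes "x \<in> {-1, q_var}"
  shows "is_P_family G S J x P \<longleftrightarrow> KLS_kernel.is_KL MJ le len (Rpar x) P"
proof -
  have int: "par_interval G S J u v = {w \<in> MJ. le u w \<and> le w v}" for u v
    by (auto simp: par_interval_def bruhat_interval_def)
  have deg: "2 * int d \<le> int (len v) - int (len u) - 1 \<longleftrightarrow> 2 * d < len v - len u" for d u v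
    by linarith
  show ?thesis
    unfolding is_P_family_def KLS_kernel.is_KL_def[OF KLS_kernel_Rpar[OF assms]]
      int deg bruhat_less_def par_R_eq[OF assms] by blast
qed

lemma is_KL_par_P:
  assumes "x \<in> {-1, q_var}"
  shows "KLS_kernel.is_KL MJ le len (Rpar x) (par_P G S J x)"
proof -
  interpret KLS_kernel MJ le len "Rpar x" using KLS_kernel_Rpar[OF assms] .
  have "is_KL (THE P. is_KL P)" using is_KL_KL is_KL_unique by (metis the_equality)
  thus ?thesis unfolding par_P_def is_P_family_iff[OF assms] .
qed

end

context coxeter_system
begin

lemma ord_Rpar_eq:
  assumes "u \<in> carrier G" "v \<in> carrier G"
  shows "ord.Rpar x u v = Rpoly u v"
proof -
  have "ord.coset_below u v = (if le u v then {\<one>} else {})"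
    using assms by (auto simp: ord.coset_below_def generate_empty_eq)
  moreover have "\<not> le u v \<Longrightarrow> Rpoly u v = 0" using Rpoly_support by blast
  ultimately show ?thesis using ord.Rpar_eq[of u v x] assms by (cases "le u v") simp_all
qed

lemma KL_R_eq: "KL_R G S u v = Rpoly u v"
proof -
  have "KL_R G S u v = ord.Rpar (-1) u v" unfolding KL_R_def by (subst ord.par_R_eq) simp_all
  also have "\<dots> = Rpoly u v"
  proof (cases "u \<in> carrier G \<and> v \<in> carrier G")
    case True
    thus ?thesis using ord_Rpar_eq by blast
  next
    case False
    thus ?thesis unfolding ord.Rpar_def Rpoly_def min_reps_empty by (simp only: if_False)
  qed
  finally show ?thesis .
qed

lemma KL_P_is_KL: "KLS_kernel.is_KL (carrier G) le len (ord.Rpar (-1)) (KL_P G S)"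
  using ord.is_KL_par_P[of "-1"] by (simp add: KL_P_def)

lemma KLS_kernel_ord: "KLS_kernel (carrier G) le len (ord.Rpar (-1))"
  using ord.KLS_kernel_Rpar[of "-1"] by simp

lemma KL_P_support: "KL_P G S u v \<noteq> 0 \<Longrightarrow> le u v"
  using KLS_kernel.is_KLD(1,2)[OF KLS_kernel_ord KL_P_is_KL] by blast

lemma KL_P_self: "u \<in> carrier G \<Longrightarrow> KL_P G S u u = 1"
  using KLS_kernel.is_KLD(3)[OF KLS_kernel_ord KL_P_is_KL] by blast

lemma KL_P_degree: "le u v \<Longrightarrow> u \<noteq> v \<Longrightarrow> 2 * degree (KL_P G S u v) < len v - len u"
  using KLS_kernel.is_KLD(4)[OF KLS_kernel_ord KL_P_is_KL] le_closed by blast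

lemma KL_P_degree_le: "degree (KL_P G S u v) \<le> len v - len u"
proof (cases "KL_P G S u v = 0")
  case False
  thus ?thesis using KL_P_degree[of u v] KL_P_support[of u v] KL_P_self[of u] le_closed
    by (cases "u = v") auto
qed simp

lemma KL_P_equation:
  assumes "le u v"
  shows "q_reverse (len v - len u) (KL_P G S u v) = (\<Sum>y\<in>{y. le y v}. Rpoly u y * KL_P G S y v)"
proof -
  have c: "u \<in> carrier G" "v \<in> carrier G" using assms le_closed by auto
  have "q_reverse (len v - len u) (KL_P G S u v) =
      (\<Sum>y\<in>{y \<in> carrier G. le u y \<and> le y v}. ord.Rpar (-1) u y * KL_P G S y v)"
    using KLS_kernel.is_KLD(5)[OF KLS_kernel_ord KL_P_is_KL c assms] .
  also have "\<dots> = (\<Sum>y\<in>{y \<in> carrier G. le u y \<and> le y v}. Rpoly u y * KL_P G S y v)"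
    using c by (intro sum.cong) (simp_all add: ord_Rpar_eq)
  also have "\<dots> = (\<Sum>y\<in>{y. le y v}. Rpoly u y * KL_P G S y v)"
    using finite_below[OF c(2)] Rpoly_support le_closed by (intro sum.mono_neutral_left) auto
  finally show ?thesis .
qed

end

context parabolic
begin

definition KL_sum :: "'a \<Rightarrow> 'a \<Rightarrow> int poly" where
  "KL_sum u v = (if u \<in> MJ \<and> v \<in> MJ
     then \<Sum>z\<in>coset_below u v. (- 1) ^ len z * KL_P G S (u \<otimes> z) v else 0)"

lemma degree_signed: "degree ((- 1) ^ k * p) = degree (p :: int poly)"
  by (cases "even k") auto

text \<open>
  For \<open>x = q\<close> the other root is \<open>-1\<close>, so the weights in \<open>sum_Rpar_coset\<close> are the signs
  \<open>(-1)\<^bsup>\<ell>(z)\<^esup>\<close>; and reversal turns these signs into the weights \<open>(-q)\<^bsup>\<ell>(z)\<^esup>\<close> of \<open>R\<^sup>J\<^sup>,\<^sup>q\<close>.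
\<close>

lemma is_KL_KL_sum: "KLS_kernel.is_KL MJ le len (Rpar q_var) KL_sum"
proof -
  interpret K: KLS_kernel MJ le len "Rpar q_var" using KLS_kernel_Rpar[of q_var] by simp
  have q: "q_var \<in> {-1, q_var}" by simp
  show ?thesis
    unfolding K.is_KL_def
  proof (intro conjI allI ballI impI)
    fix u v assume "u \<notin> MJ \<or> v \<notin> MJ"
    thus "KL_sum u v = 0" by (auto simp: KL_sum_def)
  next
    fix u v assume u: "u \<in> MJ" "v \<in> MJ" and n: "\<not> le u v"
    have "coset_below u v = {}"
      using n min_rep_le[OF _ u(1)] le_trans by (auto simp: coset_below_def)
    thus "KL_sum u v = 0" by (simp add: KL_sum_def)
  next
    fix u assume "u \<in> MJ"
    thus "KL_sum u u = 1" by (simp add: KL_sum_def coset_below_self KL_P_self)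
  next
    fix u v assume u: "u \<in> MJ" "v \<in> MJ" and l: "le u v \<and> u \<noteq> v"
    have lt: "len u < len v" using l le_len[of u v] by auto
    have "degree (KL_sum u v) \<le> (len v - len u - 1) div 2"
    proof -
      have "degree ((- 1) ^ len z * KL_P G S (u \<otimes> z) v) \<le> (len v - len u - 1) div 2"
        if z: "z \<in> coset_below u v" for z
      proof -
        have "u \<otimes> z \<noteq> v"
          using coset_decomposition_unique(1)[of u v z \<one>] z l u by (auto simp: coset_below_def)
        hence "2 * degree (KL_P G S (u \<otimes> z) v) < len v - len (u \<otimes> z)"
          using z KL_P_degree by (simp add: coset_below_def)
        hence "degree (KL_P G S (u \<otimes> z) v) \<le> (len v - len u - 1) div 2"
          using coset_below_degree[OF u(1) _ z] u by simp
        thus ?thesis by (simp only: degree_signed)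
      qed
      thus ?thesis using u finite_coset_below by (simp add: KL_sum_def degree_sum_le)
    qed
    thus "2 * degree (KL_sum u v) < len v - len u" using lt by linarith
  next
    fix u v assume u: "u \<in> MJ" "v \<in> MJ" and l: "le u v"
    have v: "v \<in> carrier G" using u by simp
    let ?P = "\<lambda>y. KL_P G S y v"
    have dle: "degree ((- 1) ^ len z * ?P (u \<otimes> z)) \<le> len v - len u" if "z \<in> coset_below u v" for z
      using KL_P_degree_le[of "u \<otimes> z" v] coset_below_degree[OF u(1) v that]
      by (simp only: degree_signed)
    have "q_reverse (len v - len u) (KL_sum u v) =
        (\<Sum>z\<in>coset_below u v. q_reverse (len v - len u) ((- 1) ^ len z * ?P (u \<otimes> z)))"
      unfolding KL_sum_def using u dle by (simp add: q_reverse_sum)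
    also have "\<dots> = (\<Sum>z\<in>coset_below u v. (- q_var) ^ len z * (\<Sum>y\<in>{y. le y v}. Rpoly (u \<otimes> z) y * ?P y))"
    proof (rule sum.cong[OF refl])
      fix z assume z: "z \<in> coset_below u v"
      have m1: "q_reverse 1 (- 1) = - q_var"
        using q_reverse_linear_poly[of "-1" 0] by (simp add: one_pCons)
      have pw: "q_reverse (k + n) ((- 1) ^ k * p) = (- q_var) ^ k * q_reverse n p"
        if "degree p \<le> n" for k n p
        using q_reverse_power(2)[OF _ that, of "- 1" k] unfolding m1 by simp
      have "q_reverse (len v - len u) ((- 1) ^ len z * ?P (u \<otimes> z)) =
          (- q_var) ^ len z * q_reverse (len v - len (u \<otimes> z)) (?P (u \<otimes> z))"
        unfolding coset_below_degree[OF u(1) v z] by (rule pw[OF KL_P_degree_le])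
      thus "q_reverse (len v - len u) ((- 1) ^ len z * ?P (u \<otimes> z)) =
          (- q_var) ^ len z * (\<Sum>y\<in>{y. le y v}. Rpoly (u \<otimes> z) y * ?P y)"
        using KL_P_equation[of "u \<otimes> z" v] z by (simp only: coset_below_def mem_Collect_eq)
    qed
    also have "\<dots> = (\<Sum>p\<in>{p \<in> MJ. le u p \<and> le p v}.
        Rpar q_var u p * (\<Sum>z\<in>coset_below p v. other_root q_var ^ len z * ?P (p \<otimes> z)))"
      using sum_coset_sum_Rpoly[OF u(1) v, of q_var ?P] sum_Rpar_coset[OF u(1) v q, of ?P] by (simp only:)
    also have "\<dots> = (\<Sum>p\<in>{p \<in> MJ. le u p \<and> le p v}. Rpar q_var u p * KL_sum p v)"
      using u by (intro sum.cong) (auto simp: KL_sum_def other_root_def)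
    finally show "q_reverse (len v - len u) (KL_sum u v) =
        (\<Sum>p\<in>{p \<in> MJ. le u p \<and> le p v}. Rpar q_var u p * KL_sum p v)" .
  qed
qed

lemma par_P_q_eq: "par_P G S J q_var = KL_sum"
  using KLS_kernel.is_KL_unique[OF KLS_kernel_Rpar is_KL_par_P is_KL_KL_sum] by simp

lemma par_P_q_interval_sum:
  assumes "u \<in> MJ" "v \<in> MJ" "le u v"
  shows "par_P G S J q_var u v =
    (\<Sum>y\<in>{y \<in> bruhat_interval G S u v. \<forall>a\<in>par_atoms G S J u v. \<not> le a y}.
      (- 1) ^ (len y - len u) * KL_P G S y v)"
  using sum_interval_coset[OF assms, of "\<lambda>k y. (- 1) ^ k * KL_P G S y v"] assms
  by (simp add: par_P_q_eq KL_sum_def)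

lemma par_R_interval_sum:
  assumes "x \<in> {-1, q_var}" "u \<in> MJ" "v \<in> MJ" "le u v"
  shows "par_R G S J x u v =
    (\<Sum>y\<in>{y \<in> bruhat_interval G S u v. \<forall>a\<in>par_atoms G S J u v. \<not> le a y}.
      (- x) ^ (len y - len u) * KL_R G S y v)"
  using sum_interval_coset[OF assms(2-4), of "\<lambda>k y. (- x) ^ k * KL_R G S y v"] assms
  by (simp add: par_R_eq[OF assms(1)] Rpar_eq KL_R_eq)

end

section \<open>Transport along isomorphisms of Bruhat intervals\<close>

lemma parabolicI: "coxeter_system G S \<Longrightarrow> J \<subseteq> S \<Longrightarrow> parabolic G S J"
  by (simp add: parabolic_def parabolic_axioms_def)

text \<open>
  As \<open>I\<close> is convex up to \<open>v\<close>, the equation for \<open>P(u, v)\<close> only involves values of \<open>R\<close> and differences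
  of \<open>l\<close> on \<open>I\<close>.
\<close>

lemma KLS_kernel_transport:
  assumes "KLS_kernel X1 leq1 l1 R1" "KLS_kernel X2 leq2 l2 R2"
    and P1: "KLS_kernel.is_KL X1 leq1 l1 R1 P1" and P2: "KLS_kernel.is_KL X2 leq2 l2 R2 P2"
    and I: "I \<subseteq> X1" "\<phi> ` I \<subseteq> X2" "v \<in> I"
    and le: "\<And>a b. a \<in> I \<Longrightarrow> b \<in> I \<Longrightarrow> leq1 a b \<longleftrightarrow> leq2 (\<phi> a) (\<phi> b)"
    and inj: "inj_on \<phi> I"
    and R: "\<And>a b. a \<in> I \<Longrightarrow> b \<in> I \<Longrightarrow> R1 a b = R2 (\<phi> a) (\<phi> b)"
    and len: "\<And>a. a \<in> I \<Longrightarrow> leq1 a v \<Longrightarrow> l1 v - l1 a = l2 (\<phi> v) - l2 (\<phi> a)"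
    and conv1: "\<And>a w. a \<in> I \<Longrightarrow> w \<in> X1 \<Longrightarrow> leq1 a w \<Longrightarrow> leq1 w v \<Longrightarrow> w \<in> I"
    and conv2: "\<And>a w. a \<in> I \<Longrightarrow> w \<in> X2 \<Longrightarrow> leq2 (\<phi> a) w \<Longrightarrow> leq2 w (\<phi> v) \<Longrightarrow> w \<in> \<phi> ` I"
    and u: "u \<in> I" "leq1 u v"
  shows "P1 u v = P2 (\<phi> u) (\<phi> v)"
proof -
  interpret K1: KLS_kernel X1 leq1 l1 R1 by fact
  interpret K2: KLS_kernel X2 leq2 l2 R2 by fact
  have v: "v \<in> X1" "\<phi> v \<in> X2" using I by auto
  show ?thesis
    using u
  proof (induction "l1 v - l1 u" arbitrary: u rule: less_induct)
    case less
    have u: "u \<in> X1" "\<phi> u \<in> X2" "leq2 (\<phi> u) (\<phi> v)" using less.prems I le by auto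
    show ?case
    proof (cases "u = v")
      case True
      thus ?thesis using K1.is_KLD(3)[OF P1] K2.is_KLD(3)[OF P2] v by simp
    next
      case False
      have ne: "\<phi> u \<noteq> \<phi> v" using False inj less.prems I by (auto dest: inj_onD)
      let ?g1 = "\<Sum>w\<in>K1.above u v. R1 u w * P1 w v"
      let ?g2 = "\<Sum>w\<in>K2.above (\<phi> u) (\<phi> v). R2 (\<phi> u) w * P2 w (\<phi> v)"
      have sub: "K1.above u v \<subseteq> I" using conv1 less.prems by (auto simp: K1.above_def)
      have img: "\<phi> ` K1.above u v = K2.above (\<phi> u) (\<phi> v)"
      proof (intro equalityI subsetI)
        fix b assume "b \<in> \<phi> ` K1.above u v"
        then obtain w where w: "w \<in> K1.above u v" "b = \<phi> w" by blast
        hence "w \<in> I" "leq1 u w" "leq1 w v" "w \<noteq> u" using sub by (auto simp: K1.above_def)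
        thus "b \<in> K2.above (\<phi> u) (\<phi> v)"
          using w le I less.prems inj by (auto simp: K2.above_def dest: inj_onD)
      next
        fix b assume "b \<in> K2.above (\<phi> u) (\<phi> v)"
        hence b: "b \<in> X2" "leq2 (\<phi> u) b" "leq2 b (\<phi> v)" "b \<noteq> \<phi> u" by (auto simp: K2.above_def)
        then obtain w where w: "w \<in> I" "b = \<phi> w" using conv2 less.prems by blast
        have "leq1 u w" "leq1 w v" "w \<noteq> u" "w \<in> X1" using b w le less.prems I by auto
        thus "b \<in> \<phi> ` K1.above u v" using w by (auto simp: K1.above_def)
      qed
      have "?g2 = (\<Sum>w\<in>K1.above u v. R2 (\<phi> u) (\<phi> w) * P2 (\<phi> w) (\<phi> v))"
        unfolding img[symmetric] using inj_on_subset[OF inj sub] by (simp add: sum.reindex)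
      also have "\<dots> = ?g1"
      proof (rule sum.cong[OF refl])
        fix w assume w: "w \<in> K1.above u v"
        hence wI: "w \<in> I" "leq1 w v" using sub by (auto simp: K1.above_def)
        have "l1 v - l1 w < l1 v - l1 u" using K1.l_above[OF w u(1) v(1)] by linarith
        hence "P1 w v = P2 (\<phi> w) (\<phi> v)" using less.hyps wI by blast
        thus "R2 (\<phi> u) (\<phi> w) * P2 (\<phi> w) (\<phi> v) = R1 u w * P1 w v"
          using R[OF less.prems(1) wI(1)] by simp
      qed
      finally have g: "?g2 = ?g1" .
      have e1: "q_reverse (l1 v - l1 u) (P1 u v) = P1 u v + ?g1"
        using K1.is_KLD(5)[OF P1 u(1) v(1) less.prems(2)] K1.R_self u v less.prems
        by (simp add: K1.sum_interval_above)
      have e2: "q_reverse (l1 v - l1 u) (P2 (\<phi> u) (\<phi> v)) = P2 (\<phi> u) (\<phi> v) + ?g1"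
        using K2.is_KLD(5)[OF P2 u(2) v(2) u(3)] K2.R_self u v
        by (simp add: K2.sum_interval_above g len[OF less.prems])
      have d1: "2 * degree (P1 u v) < l1 v - l1 u"
        using K1.is_KLD(4)[OF P1 u(1) v(1) less.prems(2) False] .
      have d2: "2 * degree (P2 (\<phi> u) (\<phi> v)) < l1 v - l1 u"
        using K2.is_KLD(4)[OF P2 u(2) v(2) u(3) ne] len[OF less.prems] by simp
      show ?thesis by (rule q_reverse_low_part_unique[OF d1 d2 e1 e2])
    qed
  qed
qed

locale interval_iso = A: coxeter_system G1 S1 + B: coxeter_system G2 S2
  for G1 :: "('a, 'm) monoid_scheme" and S1 and G2 :: "('b, 'n) monoid_scheme" and S2 +
  fixes u1 v1 u2 v2 \<phi>
  assumes iso: "poset_iso (bruhat_le G1 S1) (bruhat_interval G1 S1 u1 v1)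
                  (bruhat_le G2 S2) (bruhat_interval G2 S2 u2 v2) \<phi>"
    and le_ends: "bruhat_le G1 S1 u1 v1"
begin

abbreviation "I1 \<equiv> bruhat_interval G1 S1 u1 v1"
abbreviation "I2 \<equiv> bruhat_interval G2 S2 u2 v2"

lemma phi_bij: "bij_betw \<phi> I1 I2"
  using iso by (simp add: poset_iso_def)

lemma phi_inj: "inj_on \<phi> I1"
  using phi_bij by (rule bij_betw_imp_inj_on)

lemma phi_mem: "x \<in> I1 \<Longrightarrow> \<phi> x \<in> I2"
  using phi_bij bij_betwE by blast

lemma phi_surj: "y \<in> I2 \<Longrightarrow> \<exists>x\<in>I1. y = \<phi> x"
  using phi_bij bij_betw_imp_surj_on by blast

lemma phi_le: "x \<in> I1 \<Longrightarrow> y \<in> I1 \<Longrightarrow> B.le (\<phi> x) (\<phi> y) \<longleftrightarrow> A.le x y"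
  using iso by (simp add: poset_iso_def)

lemma I1_iff: "x \<in> I1 \<longleftrightarrow> A.le u1 x \<and> A.le x v1"
  using A.le_closed by (auto simp: bruhat_interval_def)

lemma I2_iff: "x \<in> I2 \<longleftrightarrow> B.le u2 x \<and> B.le x v2"
  using B.le_closed by (auto simp: bruhat_interval_def)

lemma ends_mem: "u1 \<in> I1" "v1 \<in> I1"
  using le_ends A.le_closed A.le_refl by (auto simp: I1_iff)

lemma le_ends2: "B.le u2 v2"
  using phi_mem[OF ends_mem(1)] B.le_trans by (auto simp: I2_iff)

lemma ends_mem2: "u2 \<in> I2" "v2 \<in> I2"
  using le_ends2 B.le_closed B.le_refl by (auto simp: I2_iff)

lemma phi_ends: "\<phi> u1 = u2" "\<phi> v1 = v2"
proof -
  obtain a where a: "a \<in> I1" "u2 = \<phi> a" using phi_surj ends_mem2 by blast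
  hence "B.le (\<phi> u1) u2" using phi_le ends_mem I1_iff by blast
  moreover have "B.le u2 (\<phi> u1)" using phi_mem ends_mem I2_iff by blast
  ultimately show "\<phi> u1 = u2" using B.le_antisym by blast
  obtain b where b: "b \<in> I1" "v2 = \<phi> b" using phi_surj ends_mem2 by blast
  hence "B.le v2 (\<phi> v1)" using phi_le ends_mem I1_iff by blast
  moreover have "B.le (\<phi> v1) v2" using phi_mem ends_mem I2_iff by blast
  ultimately show "\<phi> v1 = v2" using B.le_antisym by blast
qed

lemma subinterval:
  assumes "x \<in> I1" "y \<in> I1" "A.le x y"
  shows "interval_iso G1 S1 G2 S2 x y (\<phi> x) (\<phi> y) \<phi>"
proof -
  have sub1: "bruhat_interval G1 S1 x y \<subseteq> I1"
  proof
    fix a assume "a \<in> bruhat_interval G1 S1 x y"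
    hence "A.le x a" "A.le a y" by (simp_all add: bruhat_interval_def)
    thus "a \<in> I1" using assms(1,2) A.le_trans unfolding I1_iff by blast
  qed
  have sub2: "bruhat_interval G2 S2 (\<phi> x) (\<phi> y) \<subseteq> I2"
  proof
    fix a assume "a \<in> bruhat_interval G2 S2 (\<phi> x) (\<phi> y)"
    hence "B.le (\<phi> x) a" "B.le a (\<phi> y)" by (simp_all add: bruhat_interval_def)
    thus "a \<in> I2" using phi_mem[OF assms(1)] phi_mem[OF assms(2)] B.le_trans unfolding I2_iff by blast
  qed
  have "\<phi> ` bruhat_interval G1 S1 x y = bruhat_interval G2 S2 (\<phi> x) (\<phi> y)"
  proof (intro equalityI subsetI)
    fix b assume "b \<in> \<phi> ` bruhat_interval G1 S1 x y"
    then obtain a where a: "a \<in> bruhat_interval G1 S1 x y" "b = \<phi> a" by blast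
    hence "A.le x a" "A.le a y" "a \<in> I1" using sub1 by (auto simp: bruhat_interval_def)
    hence "B.le (\<phi> x) b" "B.le b (\<phi> y)" using phi_le assms a by blast+
    thus "b \<in> bruhat_interval G2 S2 (\<phi> x) (\<phi> y)" using B.le_closed by (auto simp: bruhat_interval_def)
  next
    fix b assume b: "b \<in> bruhat_interval G2 S2 (\<phi> x) (\<phi> y)"
    then obtain a where a: "a \<in> I1" "b = \<phi> a" using sub2 phi_surj by blast
    moreover have "B.le (\<phi> x) b" "B.le b (\<phi> y)" using b by (auto simp: bruhat_interval_def)
    ultimately have "A.le x a" "A.le a y" using phi_le assms by blast+
    thus "b \<in> \<phi> ` bruhat_interval G1 S1 x y" using a A.le_closed by (auto simp: bruhat_interval_def)
  qed
  moreover have "inj_on \<phi> (bruhat_interval G1 S1 x y)" using phi_inj sub1 inj_on_subset by blast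
  ultimately have "poset_iso (bruhat_le G1 S1) (bruhat_interval G1 S1 x y)
      (bruhat_le G2 S2) (bruhat_interval G2 S2 (\<phi> x) (\<phi> y)) \<phi>"
    using phi_le sub1 unfolding poset_iso_def bij_betw_def by blast
  thus ?thesis using assms(3) by unfold_locales
qed

lemma phi_cover:
  assumes "x \<in> I1" "a \<in> I1"
  shows "bruhat_cover G2 S2 (\<phi> x) (\<phi> a) \<longleftrightarrow> bruhat_cover G1 S1 x a"
proof -
  have eq: "\<phi> p = \<phi> r \<longleftrightarrow> p = r" if "p \<in> I1" "r \<in> I1" for p r
    using that phi_inj by (auto dest: inj_onD)
  show ?thesis
  proof
    assume *: "bruhat_cover G2 S2 (\<phi> x) (\<phi> a)"
    hence "A.le x a" "x \<noteq> a" using phi_le assms by (auto simp: bruhat_cover_def bruhat_less_def)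
    moreover have "z = x \<or> z = a" if "A.le x z" "A.le z a" for z
    proof -
      have z: "z \<in> I1" using that assms A.le_trans unfolding I1_iff by blast
      hence "B.le (\<phi> x) (\<phi> z)" "B.le (\<phi> z) (\<phi> a)" using that phi_le assms by blast+
      hence "\<phi> z = \<phi> x \<or> \<phi> z = \<phi> a" using * by (auto simp: bruhat_cover_def bruhat_less_def)
      thus ?thesis using eq z assms by blast
    qed
    ultimately show "bruhat_cover G1 S1 x a" unfolding bruhat_cover_def bruhat_less_def by blast
  next
    assume *: "bruhat_cover G1 S1 x a"
    hence "B.le (\<phi> x) (\<phi> a)" "\<phi> x \<noteq> \<phi> a"
      using phi_le eq assms by (auto simp: bruhat_cover_def bruhat_less_def)
    moreover have "z = \<phi> x \<or> z = \<phi> a" if "B.le (\<phi> x) z" "B.le z (\<phi> a)" for z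
    proof -
      have "z \<in> I2" using that phi_mem assms B.le_trans unfolding I2_iff by blast
      then obtain w where w: "w \<in> I1" "z = \<phi> w" using phi_surj by blast
      hence "A.le x w" "A.le w a" using that phi_le assms by blast+
      thus ?thesis using * w by (auto simp: bruhat_cover_def bruhat_less_def)
    qed
    ultimately show "bruhat_cover G2 S2 (\<phi> x) (\<phi> a)" unfolding bruhat_cover_def bruhat_less_def by blast
  qed
qed

text \<open>
  Covers raise the length by one, so differences of lengths count the steps of saturated chains.
\<close>

lemma phi_len:
  assumes "x \<in> I1" "y \<in> I1" "A.le x y"
  shows "A.len y + B.len (\<phi> x) = B.len (\<phi> y) + A.len x"
  using assms
proof (induction "A.len y - A.len x" arbitrary: x rule: less_induct)
  case less
  show ?case
  proof (cases "x = y")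
    case False
    obtain a where a: "A.len a = Suc (A.len x)" "A.le x a" "A.le a y"
      using A.ord.min_rep_chain[of x y] less.prems False A.le_closed by auto
    have aI: "a \<in> I1" using a less.prems A.le_trans unfolding I1_iff by blast
    have "bruhat_cover G2 S2 (\<phi> x) (\<phi> a)"
      using phi_cover[OF less.prems(1) aI] A.bruhat_cover_iff a by blast
    hence "B.len (\<phi> a) = Suc (B.len (\<phi> x))" using B.bruhat_cover_iff by blast
    moreover have "A.len y - A.len a < A.len y - A.len x"
      using a(1) A.le_len[OF a(3)] by linarith
    hence "A.len y + B.len (\<phi> a) = B.len (\<phi> y) + A.len a"
      using less.hyps aI less.prems(2) a(3) by blast
    ultimately show ?thesis using a(1) by simp
  qed simp
qed

lemma phi_len_diff:
  assumes "x \<in> I1" "y \<in> I1" "A.le x y"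
  shows "B.len (\<phi> y) - B.len (\<phi> x) = A.len y - A.len x"
  using phi_len[OF assms] A.le_len[OF assms(3)] phi_le[OF assms(1,2)] assms(3) B.le_len[of "\<phi> x" "\<phi> y"]
  by linarith

lemma sum_interval_transport:
  assumes atoms: "bij_betw \<phi> (par_atoms G1 S1 J1 u1 v1) (par_atoms G2 S2 J2 u2 v2)"
    and h: "\<And>y. y \<in> I1 \<Longrightarrow> h1 y = h2 (\<phi> y)"
  shows "(\<Sum>y\<in>{y \<in> I1. \<forall>a\<in>par_atoms G1 S1 J1 u1 v1. \<not> A.le a y}. c (A.len y - A.len u1) * h1 y) =
    (\<Sum>y\<in>{y \<in> I2. \<forall>a\<in>par_atoms G2 S2 J2 u2 v2. \<not> B.le a y}. (c (B.len y - B.len u2) * h2 y :: int poly))"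
    (is "sum ?f1 ?Y1 = sum ?f2 ?Y2")
proof -
  have A1: "par_atoms G1 S1 J1 u1 v1 \<subseteq> I1"
    using A.bruhat_cover_iff by (auto simp: par_atoms_def I1_iff)
  have A2: "par_atoms G2 S2 J2 u2 v2 = \<phi> ` par_atoms G1 S1 J1 u1 v1"
    using atoms by (simp add: bij_betw_def)
  have mem: "\<phi> y \<in> ?Y2 \<longleftrightarrow> y \<in> ?Y1" if "y \<in> I1" for y
  proof -
    have "B.le (\<phi> a) (\<phi> y) \<longleftrightarrow> A.le a y" if "a \<in> par_atoms G1 S1 J1 u1 v1" for a
      using A1 that \<open>y \<in> I1\<close> phi_le by blast
    thus ?thesis using that phi_mem unfolding A2 by simp
  qed
  have img: "\<phi> ` ?Y1 = ?Y2"
  proof (intro equalityI subsetI)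
    fix b assume "b \<in> ?Y2"
    moreover from this obtain y where "y \<in> I1" "b = \<phi> y" using phi_surj by blast
    ultimately show "b \<in> \<phi> ` ?Y1" using mem by blast
  qed (use mem in blast)
  have "inj_on \<phi> ?Y1" using phi_inj by (rule inj_on_subset) auto
  hence "sum ?f2 ?Y2 = sum (\<lambda>y. ?f2 (\<phi> y)) ?Y1"
    unfolding img[symmetric] by (simp add: sum.reindex)
  also have "\<dots> = sum ?f1 ?Y1"
  proof (rule sum.cong[OF refl])
    fix y assume "y \<in> ?Y1"
    hence y: "y \<in> I1" "A.le u1 y" using I1_iff by auto
    show "?f2 (\<phi> y) = ?f1 y"
      using phi_len_diff[OF ends_mem(1) y] h[OF y(1)] phi_ends by simp
  qed
  finally show ?thesis by simp
qed

lemma par_R_transport: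
  assumes J: "J1 \<subseteq> S1" "J2 \<subseteq> S2" and x: "x \<in> {-1, q_var}"
    and M: "u1 \<in> min_reps G1 S1 J1" "v1 \<in> min_reps G1 S1 J1"
      "u2 \<in> min_reps G2 S2 J2" "v2 \<in> min_reps G2 S2 J2"
    and atoms: "bij_betw \<phi> (par_atoms G1 S1 J1 u1 v1) (par_atoms G2 S2 J2 u2 v2)"
    and R: "\<And>y. y \<in> I1 \<Longrightarrow> KL_R G1 S1 y v1 = KL_R G2 S2 (\<phi> y) v2"
  shows "par_R G1 S1 J1 x u1 v1 = par_R G2 S2 J2 x u2 v2"
proof -
  interpret PA: parabolic G1 S1 J1 by (rule parabolicI[OF A.coxeter_system_axioms J(1)])
  interpret PB: parabolic G2 S2 J2 by (rule parabolicI[OF B.coxeter_system_axioms J(2)])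
  show ?thesis
    unfolding PA.par_R_interval_sum[OF x M(1,2) le_ends] PB.par_R_interval_sum[OF x M(3,4) le_ends2]
    using R by (rule sum_interval_transport[OF atoms])
qed

lemma par_P_transport:
  assumes J: "J1 \<subseteq> S1" "J2 \<subseteq> S2"
    and M: "u1 \<in> min_reps G1 S1 J1" "v1 \<in> min_reps G1 S1 J1"
      "u2 \<in> min_reps G2 S2 J2" "v2 \<in> min_reps G2 S2 J2"
    and atoms: "bij_betw \<phi> (par_atoms G1 S1 J1 u1 v1) (par_atoms G2 S2 J2 u2 v2)"
    and P: "\<And>y. y \<in> I1 \<Longrightarrow> KL_P G1 S1 y v1 = KL_P G2 S2 (\<phi> y) v2"
  shows "par_P G1 S1 J1 q_var u1 v1 = par_P G2 S2 J2 q_var u2 v2"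
proof -
  interpret PA: parabolic G1 S1 J1 by (rule parabolicI[OF A.coxeter_system_axioms J(1)])
  interpret PB: parabolic G2 S2 J2 by (rule parabolicI[OF B.coxeter_system_axioms J(2)])
  show ?thesis
    unfolding PA.par_P_q_interval_sum[OF M(1,2) le_ends] PB.par_P_q_interval_sum[OF M(3,4) le_ends2]
    using P by (rule sum_interval_transport[OF atoms])
qed

text \<open>
  For \<open>a \<le> b\<close> in \<open>[u,v]\<^sup>J\<close> the set \<open>A\<^sup>J\<close> of \<open>[a,b]\<close> consists of covers of \<open>a\<close> that lie in
  \<open>[u,v]\<^sup>J\<close>. So \<open>par_R_transport\<close> applies to \<open>[a,b]\<close>, and the polynomials \<open>P\<^sup>J\<^sup>,\<^sup>x\<close> follow from the \<open>R\<^sup>J\<^sup>,\<^sup>x\<close>.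
\<close>

lemma full_transport:
  assumes J: "J1 \<subseteq> S1" "J2 \<subseteq> S2" and x: "x \<in> {-1, q_var}"
    and M: "u1 \<in> min_reps G1 S1 J1" "v1 \<in> min_reps G1 S1 J1"
    and par: "bij_betw \<phi> (par_interval G1 S1 J1 u1 v1) (par_interval G2 S2 J2 u2 v2)"
    and R: "\<And>y y'. y \<in> I1 \<Longrightarrow> y' \<in> I1 \<Longrightarrow> KL_R G1 S1 y y' = KL_R G2 S2 (\<phi> y) (\<phi> y')"
  shows "par_P G1 S1 J1 x u1 v1 = par_P G2 S2 J2 x u2 v2"
proof -
  interpret PA: parabolic G1 S1 J1 by (rule parabolicI[OF A.coxeter_system_axioms J(1)])
  interpret PB: parabolic G2 S2 J2 by (rule parabolicI[OF B.coxeter_system_axioms J(2)])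
  let ?I = "par_interval G1 S1 J1 u1 v1"
  have I: "y \<in> ?I \<longleftrightarrow> y \<in> I1 \<and> y \<in> min_reps G1 S1 J1" for y
    by (simp add: par_interval_def)
  have img: "\<phi> ` ?I = I2 \<inter> min_reps G2 S2 J2"
    using par by (simp add: bij_betw_def par_interval_def)
  have mr: "\<phi> y \<in> min_reps G2 S2 J2 \<longleftrightarrow> y \<in> min_reps G1 S1 J1" if yI: "y \<in> I1" for y
  proof
    assume "\<phi> y \<in> min_reps G2 S2 J2"
    then obtain w where "w \<in> ?I" "\<phi> y = \<phi> w" using img phi_mem[OF yI] by blast
    thus "y \<in> min_reps G1 S1 J1" using inj_onD[OF phi_inj _ yI, of w] I by simp
  qed (use img I yI in blast)
  have Rpar: "par_R G1 S1 J1 x a b = par_R G2 S2 J2 x (\<phi> a) (\<phi> b)" if ab: "a \<in> ?I" "b \<in> ?I" for a b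
  proof (cases "A.le a b")
    case True
    have a: "a \<in> I1" "b \<in> I1" "a \<in> min_reps G1 S1 J1" "b \<in> min_reps G1 S1 J1" using ab I by auto
    interpret sub: interval_iso G1 S1 G2 S2 a b "\<phi> a" "\<phi> b" \<phi>
      using subinterval a True by blast
    have sub: "bruhat_interval G1 S1 a b \<subseteq> I1"
    proof
      fix c assume "c \<in> bruhat_interval G1 S1 a b"
      hence "A.le a c" "A.le c b" by (simp_all add: bruhat_interval_def)
      thus "c \<in> I1" using a(1,2) A.le_trans unfolding I1_iff by blast
    qed
    have "\<phi> ` par_atoms G1 S1 J1 a b = par_atoms G2 S2 J2 (\<phi> a) (\<phi> b)"
    proof (intro equalityI subsetI)
      fix d assume "d \<in> \<phi> ` par_atoms G1 S1 J1 a b"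
      then obtain c where c: "c \<in> min_reps G1 S1 J1" "bruhat_cover G1 S1 a c" "A.le c b" "d = \<phi> c"
        by (auto simp: par_atoms_def)
      hence "c \<in> I1" using a A.bruhat_cover_iff A.le_trans unfolding I1_iff by blast
      thus "d \<in> par_atoms G2 S2 J2 (\<phi> a) (\<phi> b)"
        using c a phi_cover phi_le mr by (simp add: par_atoms_def)
    next
      fix d assume "d \<in> par_atoms G2 S2 J2 (\<phi> a) (\<phi> b)"
      hence d: "d \<in> min_reps G2 S2 J2" "bruhat_cover G2 S2 (\<phi> a) d" "B.le d (\<phi> b)"
        by (auto simp: par_atoms_def)
      hence "d \<in> I2" using phi_mem a B.bruhat_cover_iff B.le_trans unfolding I2_iff by blast
      then obtain c where c: "c \<in> I1" "d = \<phi> c" using phi_surj by blast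
      hence "c \<in> par_atoms G1 S1 J1 a b" using d a phi_cover phi_le mr by (simp add: par_atoms_def)
      thus "d \<in> \<phi> ` par_atoms G1 S1 J1 a b" using c by blast
    qed
    moreover have "par_atoms G1 S1 J1 a b \<subseteq> I1"
    proof
      fix c assume "c \<in> par_atoms G1 S1 J1 a b"
      hence "A.le a c" "A.le c b" using A.bruhat_cover_iff by (auto simp: par_atoms_def)
      thus "c \<in> I1" using a(1,2) A.le_trans unfolding I1_iff by blast
    qed
    hence "inj_on \<phi> (par_atoms G1 S1 J1 a b)" using phi_inj inj_on_subset by blast
    ultimately have "bij_betw \<phi> (par_atoms G1 S1 J1 a b) (par_atoms G2 S2 J2 (\<phi> a) (\<phi> b))"
      by (simp add: bij_betw_def)
    thus ?thesis using a mr sub R by (intro sub.par_R_transport[OF J x]) auto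
  next
    case False
    hence "\<not> B.le (\<phi> a) (\<phi> b)" using phi_le ab I by blast
    thus ?thesis
      unfolding PA.par_R_eq[OF x] PB.par_R_eq[OF x]
      using False PA.Rpar_support(3)[of x a b] PB.Rpar_support(3)[of x "\<phi> a" "\<phi> b"] by metis
  qed
  have "par_P G1 S1 J1 x u1 v1 = par_P G2 S2 J2 x (\<phi> u1) (\<phi> v1)"
  proof (rule KLS_kernel_transport[OF PA.KLS_kernel_Rpar[OF x] PB.KLS_kernel_Rpar[OF x]
        PA.is_KL_par_P[OF x] PB.is_KL_par_P[OF x], where I = ?I])
    show "?I \<subseteq> min_reps G1 S1 J1" "\<phi> ` ?I \<subseteq> min_reps G2 S2 J2" using I img by auto
    show "v1 \<in> ?I" "u1 \<in> ?I" using M I ends_mem by auto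
    show "A.le u1 v1" by (rule le_ends)
    show "inj_on \<phi> ?I" using par by (rule bij_betw_imp_inj_on)
  next
    fix a b assume ab: "a \<in> ?I" "b \<in> ?I"
    show "A.le a b \<longleftrightarrow> B.le (\<phi> a) (\<phi> b)" using ab I phi_le by blast
    show "PA.Rpar x a b = PB.Rpar x (\<phi> a) (\<phi> b)"
      using Rpar[OF ab] unfolding PA.par_R_eq[OF x] PB.par_R_eq[OF x] .
  next
    fix a assume "a \<in> ?I" "A.le a v1"
    thus "A.len v1 - A.len a = B.len (\<phi> v1) - B.len (\<phi> a)"
      using phi_len_diff[of a v1] I ends_mem by auto
  next
    fix a w assume "a \<in> ?I" "w \<in> min_reps G1 S1 J1" "A.le a w" "A.le w v1"
    thus "w \<in> ?I" using A.le_trans unfolding I I1_iff by blast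
  next
    fix a w assume w: "a \<in> ?I" "w \<in> min_reps G2 S2 J2" "B.le (\<phi> a) w" "B.le w (\<phi> v1)"
    have "B.le u2 (\<phi> a)" using phi_mem[of a] w(1) I I2_iff by blast
    hence "B.le u2 w" using w(3) B.le_trans by blast
    moreover have "B.le w v2" using w(4) phi_ends(2) by simp
    ultimately show "w \<in> \<phi> ` ?I" using w(2) I2_iff unfolding img by blast
  qed
  thus ?thesis by (simp add: phi_ends)
qed

end

theorem theorem3p3:
  fixes I :: "'a cox_interval set"
    and W1 W2 :: "'a monoid"
    and S1 S2 J1 J2 :: "'a set"
    and u1 v1 u2 v2 :: 'a
    and \<phi> :: "'a \<Rightarrow> 'a"
  assumes "bruhat_intervals I"
    and "(W1, S1, u1, v1) \<in> I" and "(W2, S2, u2, v2) \<in> I"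
    and "J1 \<subseteq> S1" and "J2 \<subseteq> S2"
    and "u1 \<in> min_reps W1 S1 J1" and "v1 \<in> min_reps W1 S1 J1"
    and "u2 \<in> min_reps W2 S2 J2" and "v2 \<in> min_reps W2 S2 J2"
    and "poset_iso (bruhat_le W1 S1) (bruhat_interval W1 S1 u1 v1)
                   (bruhat_le W2 S2) (bruhat_interval W2 S2 u2 v2) \<phi>"
    and "bij_betw \<phi> (par_atoms W1 S1 J1 u1 v1) (par_atoms W2 S2 J2 u2 v2)"
  shows "(upper_R_invariant I \<longrightarrow>
            (\<forall>x \<in> {-1, q_var}. par_R W1 S1 J1 x u1 v1 = par_R W2 S2 J2 x u2 v2)) \<and>
         (upper_P_invariant I \<longrightarrow>
            par_P W1 S1 J1 q_var u1 v1 = par_P W2 S2 J2 q_var u2 v2) \<and>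
         (poset_iso (bruhat_le W1 S1) (par_interval W1 S1 J1 u1 v1)
                    (bruhat_le W2 S2) (par_interval W2 S2 J2 u2 v2) \<phi> \<longrightarrow>
          fully_invariant I \<longrightarrow>
            (\<forall>x \<in> {-1, q_var}. par_P W1 S1 J1 x u1 v1 = par_P W2 S2 J2 x u2 v2 \<and>
               par_R W1 S1 J1 x u1 v1 = par_R W2 S2 J2 x u2 v2))"
proof -
  have W: "coxeter_system W1 S1" "coxeter_system W2 S2"
    using assms(1-3) by (auto simp: bruhat_intervals_def)
  interpret PA: parabolic W1 S1 J1 by (rule parabolicI[OF W(1) assms(4)])
  interpret PB: parabolic W2 S2 J2 by (rule parabolicI[OF W(2) assms(5)])
  show ?thesis
  proof (cases "bruhat_le W1 S1 u1 v1")
    case True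
    interpret interval_iso W1 S1 W2 S2 u1 v1 u2 v2 \<phi>
      using assms(10) True by unfold_locales
    show ?thesis
    proof (intro conjI impI ballI)
      fix x :: "int poly" assume "x \<in> {-1, q_var}" "upper_R_invariant I"
      moreover from this have "KL_R W1 S1 y v1 = KL_R W2 S2 (\<phi> y) v2" if "y \<in> I1" for y
        using assms(2,3,10) that unfolding upper_R_invariant_def by blast
      ultimately show "par_R W1 S1 J1 x u1 v1 = par_R W2 S2 J2 x u2 v2"
        using par_R_transport[OF assms(4,5)] assms(6-9,11) by blast
    next
      assume "upper_P_invariant I"
      hence "KL_P W1 S1 y v1 = KL_P W2 S2 (\<phi> y) v2" if "y \<in> I1" for y
        using assms(2,3,10) that unfolding upper_P_invariant_def by blast
      thus "par_P W1 S1 J1 q_var u1 v1 = par_P W2 S2 J2 q_var u2 v2"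
        using par_P_transport[OF assms(4,5)] assms(6-9,11) by blast
    next
      fix x :: "int poly"
      assume x: "x \<in> {-1, q_var}" and full: "fully_invariant I"
        and par: "poset_iso (bruhat_le W1 S1) (par_interval W1 S1 J1 u1 v1)
                    (bruhat_le W2 S2) (par_interval W2 S2 J2 u2 v2) \<phi>"
      have R: "KL_R W1 S1 y y' = KL_R W2 S2 (\<phi> y) (\<phi> y')" if "y \<in> I1" "y' \<in> I1" for y y'
        using full assms(2,3,10) that unfolding fully_invariant_def by blast
      show "par_P W1 S1 J1 x u1 v1 = par_P W2 S2 J2 x u2 v2"
        using full_transport[OF assms(4,5) x assms(6,7) _ R] par by (simp add: poset_iso_def)
      show "par_R W1 S1 J1 x u1 v1 = par_R W2 S2 J2 x u2 v2"
        using par_R_transport[OF assms(4,5) x assms(6-9,11)] R ends_mem phi_ends by metis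
    qed
  next
    case False
    \<comment> \<open>Both intervals are empty, and all the polynomials vanish.\<close>
    have "\<not> bruhat_le W2 S2 u2 v2"
    proof
      assume "bruhat_le W2 S2 u2 v2"
      hence "u2 \<in> bruhat_interval W2 S2 u2 v2"
        using PB.le_closed PB.le_refl by (simp add: bruhat_interval_def)
      then obtain y where "y \<in> bruhat_interval W1 S1 u1 v1"
        using assms(10) by (auto simp: poset_iso_def bij_betw_def)
      thus False using False PA.le_trans by (auto simp: bruhat_interval_def)
    qed
    hence "par_R W1 S1 J1 x u1 v1 = 0" "par_R W2 S2 J2 x u2 v2 = 0"
      "par_P W1 S1 J1 x u1 v1 = 0" "par_P W2 S2 J2 x u2 v2 = 0" if "x \<in> {-1, q_var}" for x
      using that False PA.Rpar_support(3)[of x u1 v1] PB.Rpar_support(3)[of x u2 v2] assms(6-9)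
        KLS_kernel.is_KLD(2)[OF PA.KLS_kernel_Rpar PA.is_KL_par_P, of x u1 v1]
        KLS_kernel.is_KLD(2)[OF PB.KLS_kernel_Rpar PB.is_KL_par_P, of x u2 v2]
      by (auto simp: PA.par_R_eq PB.par_R_eq)
    thus ?thesis by auto
  qed
qed

end
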